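(* Let $q$ be a prime power with characteristic $p$. (1) If there exist places of $\mathbf P^1_{\mathbf F_q}$ of odd degree $n>1$ whose Frobenius functions have degree $1$, then either $n=p$, or $n\mid q-1$, or $n\mid q+1$. (2) Suppose $n>1$ is an odd integer with $n=p$, or $n\mid q-1$, or $n\mid q+1$. Let $s\in\mathbf F_{q^2}\setminus\mathbf F_q$. If $n=p$, choose $t\in\mathbf F_q$ with nonzero absolute trace $\mathrm{Tr}_{\mathbf F_q/\mathbf F_p}(t)\ne0$ and let $T=\{x^n-xy^{n-1}-ty^n\}$. If $n\mid q-1$, let $\zeta$ be a generator of $\mathbf F_q^\times$ and let $T=\{x^n-\zeta^i y^n : 0<i<n/2,\ \gcd(i,n)=1\}$. If $n\mid q+1$, let $\xi\in\mathbf F_{q^{2n}}$ be an element of order $n(q+1)$ and let $T$ be the set of homogenized minimal polynomials over $\mathbf F_q$ of the elements $(s\xi^i+s^q)/(\xi^i+1)$ for $0<i<n/2$ with $\gcd(i,n)=1$. Then in every case, the divisors of the elements of $T$ form a complete set of unique representatives for the action of $\mathrm{PGL}_2(\mathbf F_q)$ on the set of degree-$n$ places of $\mathbf P^1_{\mathbf F_q}$ whose Frobenius functions have degree $1$.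
   Context: A degree-$n$ place of $\mathbf P^1_{\mathbf F_q}$ corresponds to a monic irreducible homogeneous polynomial $f\in\mathbf F_q[x,y]$ of degree $n$ (monic meaning $f(x,1)$ is monic); $\alpha\in\overline{\mathbf F}_q$ is a root of $f$ if $f(\alpha,1)=0$. For odd $n\ge3$, the Frobenius function of $f$ (or its place) is the unique rational function $F$ over $\mathbf F_q$ of degree at most $(n-1)/2$ with $(\alpha^q:1)=F((\alpha:1))$ for every root $\alpha$ of $f$. $\mathrm{PGL}_2(\mathbf F_q)$ acts on $\mathbf P^1(\overline{\mathbf F}_q)$ by $\begin{pmatrix}a&b\\c&d\end{pmatrix}\cdot(\alpha:\beta)=(a\alpha+b\beta:c\alpha+d\beta)$, and hence on places. A complete set of unique representatives contains exactly one element of each orbit. *)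

theory Defs
  imports
    "HOL-Analysis.Analysis"
    "HOL-Algebra.Algebraic_Closure_Type"
    "HOL-Algebra.Group_Action"
    "HOL-Computational_Algebra.Computational_Algebra"
begin

text \<open>
  Throughout, the finite field \<open>F\<^sub>q\<close> is a type \<open>'a :: finite_field\<close>, so \<open>q = CARD('a)\<close> and
  \<open>p = CHAR('a)\<close>. Its algebraic closure is \<open>'a alg_closure\<close>, with embedding \<open>to_ac\<close>.
\<close>

definition eval_ac :: "'a::finite_field poly \<Rightarrow> 'a alg_closure \<Rightarrow> 'a alg_closure" where
  "eval_ac g \<alpha> = poly (map_poly to_ac g) \<alpha>"

text \<open>The subfield with \<open>q ^ k\<close> elements of the algebraic closure.\<close>
definition ext_field :: "nat \<Rightarrow> 'a::finite_field alg_closure set" where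
  "ext_field k = {z. z ^ (CARD('a) ^ k) = z}"

definition has_mult_order :: "'b::field \<Rightarrow> nat \<Rightarrow> bool" where
  "has_mult_order z m \<longleftrightarrow> 0 < m \<and> z ^ m = 1 \<and> (\<forall>k. 0 < k \<and> k < m \<longrightarrow> z ^ k \<noteq> 1)"

definition generates_units :: "'b::field \<Rightarrow> bool" where
  "generates_units z \<longleftrightarrow> range (\<lambda>k::nat. z ^ k) = UNIV - {0}"

text \<open>The trace to the prime field, as the sum of the conjugates (an element of the prime
  subfield of \<open>'a\<close>).\<close>
definition abs_trace :: "'a::finite_field \<Rightarrow> 'a" where
  "abs_trace t = (\<Sum>i < (THE m. CARD('a) = CHAR('a) ^ m). t ^ (CHAR('a) ^ i))"

definition min_poly :: "'a::finite_field alg_closure \<Rightarrow> 'a poly" where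
  "min_poly \<alpha> = (THE g. Polynomial.lead_coeff g = 1 \<and> eval_ac g \<alpha> = 0 \<and>
     (\<forall>h. h \<noteq> 0 \<and> eval_ac h \<alpha> = 0 \<longrightarrow> Polynomial.degree g \<le> Polynomial.degree h))"


section \<open>Binary forms\<close>

text \<open>
  The ring \<open>F\<^sub>q[x,y]\<close> is \<open>'a poly poly\<close>: the inner variable is \<open>x\<close> and the outer one is \<open>y\<close>.
  Hence \<open>Polynomial.coeff (Polynomial.coeff f j) i\<close> is the coefficient of \<open>x ^ i * y ^ j\<close>,
  and \<open>poly f 1\<close> is \<open>f(x,1)\<close>.
\<close>

definition var_x :: "'a::finite_field poly poly" where
  "var_x = [:[:0, 1:]:]"

definition var_y :: "'a::finite_field poly poly" where
  "var_y = [:0, 1:]"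

definition const2 :: "'a::finite_field \<Rightarrow> 'a poly poly" where
  "const2 c = [:[:c:]:]"

definition homogeneous :: "nat \<Rightarrow> 'a::finite_field poly poly \<Rightarrow> bool" where
  "homogeneous n f \<longleftrightarrow>
     (\<forall>i j. Polynomial.coeff (Polynomial.coeff f j) i \<noteq> 0 \<longrightarrow> i + j = n)"

definition homogenize :: "'a::finite_field poly \<Rightarrow> 'a poly poly" where
  "homogenize g = (\<Sum>i \<le> Polynomial.degree g.
     const2 (Polynomial.coeff g i) * var_x ^ i * var_y ^ (Polynomial.degree g - i))"

definition place_forms :: "nat \<Rightarrow> 'a::finite_field poly poly set" where
  "place_forms n = {f. Factorial_Ring.irreducible f \<and> homogeneous n f \<and> Polynomial.lead_coeff (poly f 1) = 1}"

definition form_root :: "'a::finite_field poly poly \<Rightarrow> 'a alg_closure \<Rightarrow> bool" where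
  "form_root f \<alpha> \<longleftrightarrow> eval_ac (poly f 1) \<alpha> = 0"


section \<open>Points, divisors and places of the projective line\<close>

text \<open>A point \<open>(a : b)\<close> is the set of all its homogeneous coordinate pairs. It is a genuine
  point only for \<open>(a, b) \<noteq> (0, 0)\<close>.\<close>

type_synonym 'k point = "('k \<times> 'k) set"

definition proj_point :: "'k::field \<Rightarrow> 'k \<Rightarrow> 'k point" where
  "proj_point a b = {(c * a, c * b) | c. c \<noteq> 0}"

text \<open>
  The divisor of a nonzero form \<open>f\<close>, as the formal sum of its zeros over the algebraic closure,
  counted with multiplicity: the order of vanishing at \<open>(\<alpha> : 1)\<close> is that of \<open>f(x,1)\<close> at
  \<open>\<alpha>\<close>, and the order of vanishing at \<open>(1 : 0)\<close> is that of \<open>f(1,y)\<close> at \<open>0\<close>.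
\<close>
definition divisor :: "'a::finite_field poly poly \<Rightarrow> 'a alg_closure point multiset" where
  "divisor f = image_mset (\<lambda>\<alpha>. proj_point \<alpha> 1) (proots (map_poly to_ac (poly f 1)))
     + replicate_mset (Polynomial.order 0 (map_poly (\<lambda>c. poly c 1) f)) (proj_point 1 0)"


section \<open>Rational functions and Frobenius functions\<close>

definition lowest_terms ::
  "'a::finite_field poly fract \<Rightarrow> 'a poly \<Rightarrow> 'a poly \<Rightarrow> bool" where
  "lowest_terms F P Q \<longleftrightarrow> Q \<noteq> 0 \<and> coprime P Q \<and> F = Fraction_Field.Fract P Q"

text \<open>The degree as a map from the projective line to itself.\<close>
definition ratfun_degree :: "'a::finite_field poly fract \<Rightarrow> nat" where
  "ratfun_degree F = (THE d. \<exists>P Q. lowest_terms F P Q \<and>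
     d = max (Polynomial.degree P) (Polynomial.degree Q))"

text \<open>The value at the point \<open>(\<alpha> : 1)\<close>; poles are sent to \<open>(1 : 0)\<close>.\<close>
definition ratfun_value :: "'a::finite_field poly fract \<Rightarrow> 'a alg_closure \<Rightarrow> 'a alg_closure point"
  where "ratfun_value F \<alpha> = (THE v. \<exists>P Q. lowest_terms F P Q \<and>
     v = proj_point (eval_ac P \<alpha>) (eval_ac Q \<alpha>))"

text \<open>The Frobenius function of a form \<open>f\<close> of degree \<open>n\<close>; existence and uniqueness
  hold for \<open>f \<in> place_forms n\<close> with \<open>n \<ge> 3\<close> odd.\<close>
definition frobenius_function :: "nat \<Rightarrow> 'a::finite_field poly poly \<Rightarrow> 'a poly fract" where
  "frobenius_function n f = (THE F. ratfun_degree F \<le> (n - 1) div 2 \<and>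
     (\<forall>\<alpha>. form_root f \<alpha> \<longrightarrow> proj_point (\<alpha> ^ CARD('a)) 1 = ratfun_value F \<alpha>))"

text \<open>
  A degree-\<open>n\<close> place is the divisor of an element of \<open>place_forms n\<close> (the formal sum of the
  geometric points lying over it), and this form is determined by the place.
\<close>
definition places_frob_deg :: "nat \<Rightarrow> nat \<Rightarrow> 'a::finite_field alg_closure point multiset set" where
  "places_frob_deg n d =
     divisor ` {f \<in> place_forms n. ratfun_degree (frobenius_function n f) = d}"


section \<open>The projective linear group and its action\<close>

definition GL2 :: "('a::finite_field^2^2) monoid" where
  "GL2 = \<lparr>carrier = {A. invertible A}, mult = (**), one = mat 1\<rparr>"

definition PGL2 :: "('a::finite_field^2^2) set monoid" where
  "PGL2 = GL2 Mod {mat c | c. c \<noteq> 0}"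

definition matrix_act ::
  "'a::finite_field^2^2 \<Rightarrow> 'a alg_closure \<times> 'a alg_closure \<Rightarrow> 'a alg_closure \<times> 'a alg_closure"
  where
  "matrix_act A = (\<lambda>(u, v). (to_ac (A $ 1 $ 1) * u + to_ac (A $ 1 $ 2) * v,
                            to_ac (A $ 2 $ 1) * u + to_ac (A $ 2 $ 2) * v))"

text \<open>An element of \<open>PGL2\<close> is a coset of matrices; all matrices in it map (the coordinate set of)
  a point to the same set, so the union is just the image under any one of them.\<close>
definition point_act ::
  "('a::finite_field^2^2) set \<Rightarrow> 'a alg_closure point \<Rightarrow> 'a alg_closure point" where
  "point_act C P = (\<Union>A\<in>C. matrix_act A ` P)"

text \<open>The induced action on a set \<open>E\<close> of divisors; \<open>group_action\<close> requires maps that are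
  extensional on \<open>E\<close>.\<close>
definition divisor_act ::
  "'a::finite_field alg_closure point multiset set \<Rightarrow> ('a^2^2) set \<Rightarrow>
     'a alg_closure point multiset \<Rightarrow> 'a alg_closure point multiset" where
  "divisor_act E C = (\<lambda>D\<in>E. image_mset (point_act C) D)"

definition complete_unique_reps ::
  "('g, 'm) monoid_scheme \<Rightarrow> 'b set \<Rightarrow> ('g \<Rightarrow> 'b \<Rightarrow> 'b) \<Rightarrow> 'b set \<Rightarrow> bool" where
  "complete_unique_reps G E \<phi> R \<longleftrightarrow>
     group_action G E \<phi> \<and> R \<subseteq> E \<and> (\<forall>B\<in>orbits G E \<phi>. \<exists>!r. r \<in> R \<and> r \<in> B)"

end

theory Submission
  imports Defs "HOL-Algebra.Sylow"
begin

text \<open>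
  Let \<open>\<alpha>\<close> be a root of a form of odd degree \<open>n > 1\<close>. Its Frobenius function has degree 1 iff \<open>\<alpha>\<^sup>q = A \<alpha>\<close>
  for some \<open>A \<in> PGL\<^sub>2(F\<^sub>q)\<close>, and then \<open>A\<close> has order \<open>n\<close>. Two such places lie in the same orbit iff
  their roots are related by a Moebius transformation over \<open>F\<^sub>q\<close>, because the conjugates of \<open>\<alpha>\<close> are
  Moebius images of \<open>\<alpha>\<close>.

  Moving the fixed points of \<open>A\<close> into standard position gives one of three normal forms:
  \<open>\<alpha>\<^sup>q = \<alpha> + 1\<close> (so \<open>n = p\<close>), \<open>\<alpha>\<^sup>q = a \<alpha>\<close> with \<open>a\<close> of order \<open>n\<close> (so \<open>n\<close> divides \<open>q - 1\<close>), or
  \<open>\<alpha> = (s x + s\<^sup>q) / (x + 1)\<close> where \<open>x\<^bsup>q+1\<^esup> = e\<close> has order \<open>n\<close> and \<open>e\<^bsup>q+1\<^esup> = 1\<close> (so \<open>n\<close> divides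
  \<open>q + 1\<close>). Two roots with the same \<open>a\<close> are equivalent by a scaling, and two roots with the same \<open>e\<close> by an
  element of the nonsplit torus, which is defined over \<open>F\<^sub>q\<close> by Hilbert 90. Conversely, the cross ratio
  of \<open>\<alpha>, \<alpha>\<^sup>q, \<alpha>\<^bsup>q^2\<^esup>, \<alpha>\<^bsup>q^3\<^esup>\<close> is invariant under \<open>PGL\<^sub>2(F\<^sub>q)\<close> and equals \<open>(1 + e)\<^sup>2 / e\<close>, which
  determines \<open>e\<close> up to inversion.
\<close>

text \<open>\<open>frobenius_function\<close> and \<open>min_poly\<close> are definite descriptions,
  so nothing about degrees can be said before existence and uniqueness are shown. Existence is a
  count: for odd n there are q^(n+1) pairs (P, Q) of degree at most (n - 1) / 2, but at most q^n
  values of P(\<alpha>) - \<alpha>^q Q(\<alpha>). Oddness also keeps \<alpha> away from the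
  irrational fixed points of A, which lie in the field with q^2 elements. The value (1 + e)^2 / e is
  tr^2 / det of diag(e, 1), a conjugacy invariant of A. That it cannot tell e from 1/e is no loss:
  inverting the coordinate exchanges the two and is realised over F_q. Hence the range 0 < i < n/2,
  which picks one exponent from each pair {i, n - i}. The constants in the representatives are
  solved from the normal forms: \<alpha>^n = \<zeta>^i yields \<alpha>^q = \<zeta>^(i(q-1)/n)
  \<alpha>; for x = \<xi>^i the power x^(q+1) has order n because \<xi> has order n(q+1) and i is
  coprime to n; and x^p = x + t iterates to x^q = x + Tr(t), which is a proper translation exactly
  when the trace is nonzero.\<close>

hide_const (open) Divisibility.irreducible UnivPoly.coeff UnivPoly.monom UnivPoly.deg
  Divisibility.prime Polynomials.degree Polynomials.lead_coeff Module.smult Coset.order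

no_notation fps_nth (infixl \<open>$\<close> 75)

section \<open>The Frobenius map on the algebraic closure\<close>

text \<open>Cauchy's theorem, taken from Sylow's for the additive group: a prime r dividing q yields
  x \<noteq> 0 with r * x = 0, so r is the characteristic. Writing q as a power of p is what makes x
  \<mapsto> x^q additive.\<close>

lemma card_finite_field_char_power:
  "\<exists>m>0. CARD('a::finite_field) = CHAR('a) ^ m"
proof -
  define G where "G = \<lparr>carrier = (UNIV :: 'a set), monoid.mult = (+), one = (0 :: 'a)\<rparr>"
  have G: "group G"
  proof (rule groupI)
    fix x assume "x \<in> carrier G"
    show "\<exists>y\<in>carrier G. y \<otimes>\<^bsub>G\<^esub> x = \<one>\<^bsub>G\<^esub>"
      by (intro bexI[of _ "-x"]) (auto simp: G_def)
  qed (auto simp: G_def add_ac)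
  interpret G: group G by (rule G)
  have p: "prime CHAR('a)"
    by (rule prime_CHAR_semidom) (rule CHAR_pos)
  have pow: "x [^]\<^bsub>G\<^esub> k = of_nat k * x" for x and k :: nat
    by (induction k) (auto simp: G_def algebra_simps)
  have only: "r = CHAR('a)" if r: "prime r" "r dvd CARD('a)" for r
  proof (rule ccontr)
    assume ne: "r \<noteq> CHAR('a)"
    obtain m where m: "CARD('a) = r ^ 1 * m" using r(2) by auto
    obtain H where H: "subgroup H G" "card H = r"
      using sylow_thm[OF r(1) G, of 1 m] m by (auto simp: order_def G_def)
    have "finite H" using H(2) r(1) by (intro card_ge_0_finite) (auto simp: prime_gt_0_nat)
    moreover have "\<exists>x\<in>H. x \<noteq> 0"
    proof (rule ccontr)
      assume "\<not> ?thesis"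
      then have "H \<subseteq> {0}" by auto
      then have "card H \<le> 1" using card_mono[of "{0}" H] by simp
      with H(2) prime_gt_1_nat[OF r(1)] show False by simp
    qed
    then obtain x where x: "x \<in> H" "x \<noteq> 0" by blast
    interpret H: group "G\<lparr>carrier := H\<rparr>" by (rule subgroup.subgroup_is_group[OF H(1) G])
    have "x [^]\<^bsub>G\<lparr>carrier := H\<rparr>\<^esub> Coset.order (G\<lparr>carrier := H\<rparr>) = \<one>\<^bsub>G\<lparr>carrier := H\<rparr>\<^esub>"
      using x by (intro H.pow_order_eq_1) auto
    then have "x [^]\<^bsub>G\<^esub> r = \<one>\<^bsub>G\<^esub>"
      using H(2) by (simp add: order_def nat_pow_def)
    then have "of_nat r * x = 0" by (simp only: pow) (simp add: G_def)
    then have "of_nat r = (0 :: 'a)" using x by simp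
    then have "CHAR('a) dvd r" by (simp add: of_nat_eq_0_iff_char_dvd)
    with primes_dvd_imp_eq[OF p r(1)] ne show False by simp
  qed
  have gt: "CARD('a) > 1"
  proof -
    have "card {0::'a, 1} \<le> CARD('a)" by (rule card_mono) auto
    then show ?thesis by simp
  qed

  have "prime_factors CARD('a) \<subseteq> {CHAR('a)}"
    using only by (auto simp: in_prime_factors_iff)
  moreover have "CARD('a) = (\<Prod>r\<in>prime_factors CARD('a). r ^ multiplicity r CARD('a))"
    using gt by (simp add: prime_factorization_nat)
  ultimately have "CARD('a) = 1 \<or> CARD('a) = CHAR('a) ^ multiplicity CHAR('a) CARD('a)"
    by (auto simp: subset_singleton_iff)
  then obtain n where n: "CARD('a) = CHAR('a) ^ n" using gt by auto
  have "n > 0" using n gt by (cases n) auto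
  with n show ?thesis by blast
qed

definition frob :: "'a::finite_field alg_closure \<Rightarrow> 'a alg_closure" where
  "frob x = x ^ CARD('a)"

lemma card_field_gt_1: "CARD('a::finite_field) > 1"
proof -
  have "card {0::'a, 1} \<le> CARD('a)" by (rule card_mono) auto
  then show ?thesis by simp
qed

lemma CHAR_alg_closure_prime: "prime CHAR('a::finite_field alg_closure)"
  by (simp add: CHAR_pos prime_CHAR_semidom)

lemma frob_0 [simp]: "frob 0 = 0" and frob_1 [simp]: "frob 1 = 1"
  using card_field_gt_1 by (auto simp: frob_def)

lemma frob_mult [simp]: "frob (x * y) = frob x * frob y"
  by (simp add: frob_def power_mult_distrib)

lemma frob_divide [simp]: "frob (x / y) = frob x / frob y"
  by (simp add: frob_def power_divide)

lemma frob_power [simp]: "frob (x ^ k) = frob x ^ k"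
  by (simp add: frob_def flip: power_mult) (simp add: mult.commute)

lemma frob_add [simp]: "frob (x + y) = frob x + frob y"
  for x y :: "'a::finite_field alg_closure"
proof -
  obtain m where "CARD('a) = CHAR('a alg_closure) ^ m"
    using card_finite_field_char_power[where 'a='a] by auto
  then show ?thesis
    unfolding frob_def by (intro freshmans_dream' CHAR_alg_closure_prime)
qed

lemma frob_minus [simp]: "frob (- x) = - frob x"
proof -
  have "frob (- x) + frob x = 0" by (simp flip: frob_add)
  then show ?thesis by (simp add: eq_neg_iff_add_eq_0)
qed

lemma frob_diff [simp]: "frob (x - y) = frob x - frob y"
  using frob_add[of x "- y"] by simp

lemma frob_eq_0_iff [simp]: "frob x = 0 \<longleftrightarrow> x = 0"
  by (auto simp: frob_def)

lemma frob_eq_iff [simp]: "frob x = frob y \<longleftrightarrow> x = y"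
  using frob_eq_0_iff[of "x - y"] by simp

lemma frob_to_ac [simp]: "frob (to_ac a) = to_ac a"
  by (simp add: frob_def finite_field_power_card_eq_same flip: to_ac_power)

lemma card_power_fixed_le:
  fixes N :: nat
  assumes "N > 1"
  shows "finite {x::'a::field. x ^ N = x}" and "card {x::'a. x ^ N = x} \<le> N"
proof -
  define P :: "'a poly" where "P = monom 1 N - monom 1 1"
  have c: "coeff P N = 1" using assms by (simp add: P_def)
  then have "P \<noteq> 0" by auto
  have "degree P \<le> N" unfolding P_def
    using assms by (intro degree_diff_le) (auto intro: degree_monom_le le_trans)
  have e: "{x. x ^ N = x} = {x. poly P x = 0}"
    by (auto simp: P_def poly_monom)
  show "finite {x::'a. x ^ N = x}" unfolding e by (rule poly_roots_finite) fact
  show "card {x::'a. x ^ N = x} \<le> N" unfolding e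
    using card_poly_roots_bound[OF \<open>P \<noteq> 0\<close>] \<open>degree P \<le> N\<close> by linarith
qed

text \<open>The q elements of F_q already exhaust the at most q roots of X^q - X. This is the
  descent principle by which elements of the closure are later recognised as coefficients in
  F_q.\<close>

lemma frob_fixed_iff: "frob x = x \<longleftrightarrow> x \<in> range to_ac"
  for x :: "'a::finite_field alg_closure"
proof -
  have "range to_ac = {x::'a alg_closure. x ^ CARD('a) = x}"
  proof (rule card_seteq)
    show "finite {x::'a alg_closure. x ^ CARD('a) = x}"
      by (rule card_power_fixed_le(1)[OF card_field_gt_1])
    show "range to_ac \<subseteq> {x::'a alg_closure. x ^ CARD('a) = x}"
      using frob_to_ac by (auto simp: frob_def)
    have "card (range to_ac :: 'a alg_closure set) = CARD('a)"
      by (simp add: card_image inj_to_ac)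
    then show "card {x::'a alg_closure. x ^ CARD('a) = x} \<le> card (range to_ac :: 'a alg_closure set)"
      using card_power_fixed_le(2)[OF card_field_gt_1, where 'a="'a alg_closure"] by simp
  qed
  then show ?thesis by (auto simp: frob_def)
qed

lemma frob_fixedE:
  assumes "frob x = x"
  obtains a where "x = to_ac a"
  using assms by (auto simp: frob_fixed_iff)

lemma funpow_frob: "(frob ^^ k) x = x ^ (CARD('a) ^ k)"
  for x :: "'a::finite_field alg_closure"
  by (induction k) (simp_all add: frob_def mult.commute flip: power_mult)

lemma funpow_frob_mult [simp]: "(frob ^^ k) (x * y) = (frob ^^ k) x * (frob ^^ k) y"
  by (induction k) auto

lemma funpow_frob_add [simp]: "(frob ^^ k) (x + y) = (frob ^^ k) x + (frob ^^ k) y"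
  by (induction k) auto

lemma funpow_frob_diff [simp]: "(frob ^^ k) (x - y) = (frob ^^ k) x - (frob ^^ k) y"
  by (induction k) auto

lemma funpow_frob_to_ac [simp]: "(frob ^^ k) (to_ac a) = to_ac a"
  by (induction k) auto

lemma funpow_frob_eq_iff [simp]: "(frob ^^ k) x = (frob ^^ k) y \<longleftrightarrow> x = y"
  by (induction k) auto

lemma ext_field_iff: "x \<in> ext_field k \<longleftrightarrow> (frob ^^ k) x = x"
  by (simp add: ext_field_def funpow_frob)

text \<open>The degree of \<alpha> over F_q, measured as the length of its Frobenius orbit. Normal
  forms are described by how Frobenius acts, so this length can be read off without touching minimal
  polynomials.\<close>

definition conj_degree :: "nat \<Rightarrow> 'a::finite_field alg_closure \<Rightarrow> bool" where
  "conj_degree n \<alpha> \<longleftrightarrow> 0 < n \<and> (frob ^^ n) \<alpha> = \<alpha> \<and> (\<forall>k. 0 < k \<and> k < n \<longrightarrow> (frob ^^ k) \<alpha> \<noteq> \<alpha>)"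

lemma conj_degree_fixed_iff:
  assumes "conj_degree n \<alpha>"
  shows "(frob ^^ k) \<alpha> = \<alpha> \<longleftrightarrow> n dvd k"
proof -
  have n: "0 < n" "(frob ^^ n) \<alpha> = \<alpha>" using assms by (auto simp: conj_degree_def)
  have "(frob ^^ k) \<alpha> = (frob ^^ (k mod n)) \<alpha>"
    using funpow_mod_eq[OF n(2)] by simp
  moreover have "(frob ^^ (k mod n)) \<alpha> = \<alpha> \<longleftrightarrow> k mod n = 0"
    using assms n(1) by (auto simp: conj_degree_def)
  ultimately show ?thesis by (auto simp: dvd_eq_mod_eq_0)
qed

lemma conj_degreeI:
  assumes "0 < n" "\<And>k. (frob ^^ k) \<alpha> = \<alpha> \<longleftrightarrow> n dvd k"
  shows "conj_degree n \<alpha>"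
  using assms by (auto simp: conj_degree_def dest: dvd_imp_le)

lemma conj_degree_inj:
  assumes "conj_degree n \<alpha>"
  shows "inj_on (\<lambda>i. (frob ^^ i) \<alpha>) {..<n}"
proof (rule linorder_inj_onI)
  fix i j assume ij: "i < j" "i \<in> {..<n}" "j \<in> {..<n}"
  have "(frob ^^ j) \<alpha> = (frob ^^ i) ((frob ^^ (j - i)) \<alpha>)"
    using ij by (simp flip: funpow_add comp_apply[of "frob ^^ i"])
  moreover have "(frob ^^ (j - i)) \<alpha> \<noteq> \<alpha>"
    using assms ij by (auto simp: conj_degree_def)
  ultimately show "(frob ^^ i) \<alpha> \<noteq> (frob ^^ j) \<alpha>" by simp
qed auto

lemma conj_degree_notin_range:
  assumes "conj_degree n \<alpha>" "n > 1"
  shows "\<alpha> \<notin> range to_ac"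
proof
  assume "\<alpha> \<in> range to_ac"
  then have "(frob ^^ 1) \<alpha> = \<alpha>" by auto
  with assms show False by (auto simp: conj_degree_def)
qed

lemma conj_degree_frob:
  assumes "conj_degree n \<alpha>"
  shows "conj_degree n ((frob ^^ k) \<alpha>)"
proof (rule conj_degreeI)
  show "0 < n" using assms by (auto simp: conj_degree_def)
  fix j
  have "(frob ^^ j) ((frob ^^ k) \<alpha>) = (frob ^^ k) ((frob ^^ j) \<alpha>)"
    by (simp flip: funpow_add comp_apply[of "frob ^^ k"] comp_apply[of "frob ^^ j"] add: add.commute)
  then show "(frob ^^ j) ((frob ^^ k) \<alpha>) = (frob ^^ k) \<alpha> \<longleftrightarrow> n dvd j"
    by (simp add: conj_degree_fixed_iff[OF assms])
qed


section \<open>Minimal polynomials\<close>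

text \<open>One interface for every coefficient map in use: \<open>to_ac\<close>,
  \<open>frob\<close>, evaluation at a point, and \<open>twist\<close>. By
  \<open>coeff_hom_poly\<close> a map followed by evaluation is again an instance, so nested
  evaluations need no separate homomorphism proofs.\<close>

locale coeff_hom =
  fixes h :: "'a::comm_ring_1 \<Rightarrow> 'b::comm_ring_1"
  assumes hom_0 [simp]: "h 0 = 0" and hom_1 [simp]: "h 1 = 1"
    and hom_add [simp]: "h (x + y) = h x + h y" and hom_mult [simp]: "h (x * y) = h x * h y"
begin

lemma map_poly_pCons_hom [simp]: "map_poly h (pCons a p) = pCons (h a) (map_poly h p)"
  by (simp add: map_poly_pCons)

lemma map_poly_add_hom [simp]: "map_poly h (p + q) = map_poly h p + map_poly h q"
  by (rule poly_eqI) (simp add: coeff_map_poly)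

lemma map_poly_smult_hom [simp]: "map_poly h (Polynomial.smult a p) = Polynomial.smult (h a) (map_poly h p)"
  by (rule poly_eqI) (simp add: coeff_map_poly)

lemma map_poly_mult_hom [simp]: "map_poly h (p * q) = map_poly h p * map_poly h q"
  by (induction p) simp_all

lemma hom_minus [simp]: "h (- x) = - h x"
proof -
  have "h (- x) + h x = 0" by (simp flip: hom_add)
  then show ?thesis by (simp add: eq_neg_iff_add_eq_0)
qed

lemma map_poly_minus_hom [simp]: "map_poly h (- p) = - map_poly h p"
  by (rule poly_eqI) (simp add: coeff_map_poly)

lemma map_poly_diff_hom [simp]: "map_poly h (p - q) = map_poly h p - map_poly h q"
  using map_poly_add_hom[of p "- q"] by simp

lemma hom_diff [simp]: "h (x - y) = h x - h y"
  using hom_add[of x "- y"] by simp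

lemma map_poly_prod_hom: "map_poly h (\<Prod>i\<in>A. f i) = (\<Prod>i\<in>A. map_poly h (f i))"
  by (induction A rule: infinite_finite_induct) simp_all

lemma coeff_hom_poly: "coeff_hom (\<lambda>p. poly (map_poly h p) b)"
  by unfold_locales simp_all

end

lemma (in coeff_hom) hom_power [simp]: "h (x ^ k) = h x ^ k"
  by (induction k) simp_all

lemma (in coeff_hom) hom_sum: "h (sum f A) = (\<Sum>i\<in>A. h (f i))"
  by (induction A rule: infinite_finite_induct) simp_all

interpretation to_ac_hom: coeff_hom to_ac
  by unfold_locales simp_all

interpretation frob_hom: coeff_hom frob
  by unfold_locales simp_all

interpretation eval_ac_hom: coeff_hom "\<lambda>g. eval_ac g \<alpha>"
  unfolding eval_ac_def by (rule to_ac_hom.coeff_hom_poly)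

lemma eval_ac_pCons [simp]: "eval_ac (pCons a g) \<alpha> = to_ac a + \<alpha> * eval_ac g \<alpha>"
  by (simp add: eval_ac_def)

lemma eval_ac_monom [simp]: "eval_ac (monom c k) \<alpha> = to_ac c * \<alpha> ^ k"
  by (simp add: eval_ac_def map_poly_monom poly_monom)

lemma frob_eval_ac: "frob (eval_ac g \<alpha>) = eval_ac g (frob \<alpha>)"
  by (induction g) auto

lemma funpow_frob_eval_ac: "(frob ^^ k) (eval_ac g \<alpha>) = eval_ac g ((frob ^^ k) \<alpha>)"
  by (induction k) (auto simp: frob_eval_ac)

lemma degree_map_poly_to_ac [simp]: "degree (map_poly to_ac g) = degree g"
  by (simp add: degree_map_poly)

lemma lead_coeff_map_poly_to_ac: "lead_coeff (map_poly to_ac g) = to_ac (lead_coeff g)"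
  by (simp add: coeff_map_poly)

lemma map_poly_to_ac_eq_0_iff [simp]: "map_poly to_ac g = 0 \<longleftrightarrow> g = 0"
  by (simp add: map_poly_eq_0_iff)

lemma map_poly_to_ac_eq_iff: "map_poly to_ac g = map_poly to_ac h \<longleftrightarrow> g = h"
proof
  assume "map_poly to_ac g = map_poly to_ac h"
  then have "map_poly to_ac (g - h) = 0" by simp
  then show "g = h" by (simp only: map_poly_to_ac_eq_0_iff) simp
qed simp

lemma map_poly_frob_fixedE:
  assumes "map_poly frob P = P"
  obtains g where "P = map_poly to_ac g"
proof
  show "P = map_poly to_ac (map_poly of_ac P)"
  proof (rule poly_eqI)
    fix i
    have "frob (coeff P i) = coeff P i"
      using arg_cong[OF assms, of "\<lambda>P. coeff P i"] by (simp add: coeff_map_poly)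
    then show "coeff P i = coeff (map_poly to_ac (map_poly of_ac P)) i"
      by (simp add: coeff_map_poly frob_fixed_iff to_ac_of_ac)
  qed
qed

lemma prod_linear_dvd:
  fixes P :: "'a::field poly" and n :: nat
  assumes "inj_on x {..<n}" "\<And>i. i < n \<Longrightarrow> poly P (x i) = 0"
  shows "(\<Prod>i<n. [:- x i, 1:]) dvd P"
  using assms
proof (induction n)
  case (Suc n)
  have "(\<Prod>i<n. [:- x i, 1:]) dvd P"
    using Suc by (intro Suc.IH inj_on_subset[OF Suc.prems(1)]) auto
  then obtain R where R: "P = (\<Prod>i<n. [:- x i, 1:]) * R" by auto
  have "x n \<noteq> x i" if "i < n" for i
    using inj_onD[OF Suc.prems(1), of n i] that by auto
  then have "poly (\<Prod>i<n. [:- x i, 1:]) (x n) \<noteq> 0"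
    by (auto simp: poly_prod)
  moreover have "poly P (x n) = 0" using Suc.prems(2) by simp
  ultimately have "[:- x n, 1:] dvd R" by (simp add: R poly_eq_0_iff_dvd)
  then show ?case
    unfolding R prod.lessThan_Suc by (rule mult_dvd_mono[OF dvd_refl])
qed simp

definition conj_poly :: "nat \<Rightarrow> 'a::finite_field alg_closure \<Rightarrow> 'a alg_closure poly" where
  "conj_poly n \<alpha> = (\<Prod>i<n. [:- (frob ^^ i) \<alpha>, 1:])"

lemma degree_conj_poly [simp]: "degree (conj_poly n \<alpha>) = n"
  by (simp add: conj_poly_def degree_prod_eq_sum_degree)

lemma lead_coeff_conj_poly: "lead_coeff (conj_poly n \<alpha>) = 1"
  unfolding conj_poly_def by (subst lead_coeff_prod) simp

lemma poly_conj_poly_self: "0 < n \<Longrightarrow> poly (conj_poly n \<alpha>) \<alpha> = 0"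
  by (auto simp: conj_poly_def poly_prod intro!: bexI[of _ 0])

text \<open>Frobenius permutes the linear factors cyclically, so the coefficients of the product are
  fixed and descend to F_q.\<close>

lemma map_poly_frob_conj_poly:
  assumes "(frob ^^ n) \<alpha> = \<alpha>"
  shows "map_poly frob (conj_poly n \<alpha>) = conj_poly n \<alpha>"
proof -
  have "map_poly frob (conj_poly n \<alpha>) = (\<Prod>i<n. [:- (frob ^^ Suc i) \<alpha>, 1:])"
    by (simp add: conj_poly_def frob_hom.map_poly_prod_hom)
  also have "\<dots> = conj_poly n \<alpha>"
  proof (cases n)
    case (Suc m)
    have "(\<Prod>i<n. [:- (frob ^^ Suc i) \<alpha>, 1:]) = (\<Prod>i<m. [:- (frob ^^ Suc i) \<alpha>, 1:]) * [:- \<alpha>, 1:]"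
      using assms by (simp add: Suc del: funpow.simps)
    also have "\<dots> = conj_poly n \<alpha>"
      unfolding conj_poly_def Suc by (subst prod.lessThan_Suc_shift) (simp add: mult.commute)
    finally show ?thesis .
  qed (simp add: conj_poly_def)
  finally show ?thesis .
qed

lemma conj_poly_dvd:
  assumes "conj_degree n \<alpha>" "eval_ac g \<alpha> = 0"
  shows "conj_poly n \<alpha> dvd map_poly to_ac g"
  unfolding conj_poly_def
proof (rule prod_linear_dvd[OF conj_degree_inj[OF assms(1)]])
  fix i
  have "eval_ac g ((frob ^^ i) \<alpha>) = (frob ^^ i) 0"
    using assms(2) by (simp flip: funpow_frob_eval_ac)
  moreover have "(frob ^^ i) 0 = (0 :: 'a alg_closure)" by (induction i) auto
  ultimately show "poly (map_poly to_ac g) ((frob ^^ i) \<alpha>) = 0" by (simp add: eval_ac_def)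
qed

lemma conj_degree_le_degree:
  assumes "conj_degree n \<alpha>" "eval_ac g \<alpha> = 0" "g \<noteq> 0"
  shows "n \<le> degree g"
  using dvd_imp_degree_le[OF conj_poly_dvd[OF assms(1,2)]] assms(3) by simp

lemma monic_root_unique:
  assumes "conj_degree n \<alpha>"
    and g: "degree g = n" "lead_coeff g = 1" "eval_ac g \<alpha> = 0"
  shows "map_poly to_ac g = conj_poly n \<alpha>"
proof -
  obtain R where R: "map_poly to_ac g = conj_poly n \<alpha> * R"
    using conj_poly_dvd[OF assms(1) g(3)] by auto
  have "g \<noteq> 0" using g by auto
  then have nz: "conj_poly n \<alpha> \<noteq> 0" "R \<noteq> 0" using R by auto
  have "degree g = n + degree R"
    using arg_cong[OF R, of degree] nz by (simp add: degree_mult_eq)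
  then have "degree R = 0" using g(1) by simp
  then obtain c where c: "R = [:c:]" by (rule degree_eq_zeroE)
  have "lead_coeff (map_poly to_ac g) = 1" using g(2) by (simp only: lead_coeff_map_poly_to_ac) simp
  then have "lead_coeff (conj_poly n \<alpha>) * c = 1"
    unfolding R by (subst (asm) lead_coeff_mult) (simp add: c)
  then have "c = 1" unfolding lead_coeff_conj_poly by simp
  with R c show ?thesis by simp
qed

text \<open>The product over the Frobenius orbit descends to F_q and divides every polynomial over
  F_q vanishing at \<alpha>. This resolves the definite description in
  \<open>min_poly\<close>.\<close>

lemma map_poly_min_poly:
  assumes "conj_degree n \<alpha>"
  shows "map_poly to_ac (min_poly \<alpha>) = conj_poly n \<alpha>"
proof -
  have n: "0 < n" "(frob ^^ n) \<alpha> = \<alpha>" using assms by (auto simp: conj_degree_def)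
  obtain g where g: "conj_poly n \<alpha> = map_poly to_ac g"
    using map_poly_frob_fixedE[OF map_poly_frob_conj_poly[OF n(2)]] by blast
  have deg: "degree g = n" using arg_cong[OF g, of degree] by simp
  have lead: "lead_coeff g = 1"
    using lead_coeff_conj_poly[of n \<alpha>] unfolding g lead_coeff_map_poly_to_ac
    by (metis to_ac_1 to_ac_eq_iff)
  have root: "eval_ac g \<alpha> = 0" using poly_conj_poly_self[OF n(1)] by (simp add: eval_ac_def flip: g)
  have "min_poly \<alpha> = g"
    unfolding min_poly_def
  proof (rule the_equality)
    show "lead_coeff g = 1 \<and> eval_ac g \<alpha> = 0 \<and>
      (\<forall>h. h \<noteq> 0 \<and> eval_ac h \<alpha> = 0 \<longrightarrow> degree g \<le> degree h)"
      using lead root deg conj_degree_le_degree[OF assms] by auto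
  next
    fix g' assume g': "lead_coeff g' = 1 \<and> eval_ac g' \<alpha> = 0 \<and>
      (\<forall>h. h \<noteq> 0 \<and> eval_ac h \<alpha> = 0 \<longrightarrow> degree g' \<le> degree h)"
    have "g \<noteq> 0" "g' \<noteq> 0" using lead g' by auto
    then have "degree g' \<le> degree g" "n \<le> degree g'"
      using g' root conj_degree_le_degree[OF assms, of g'] by blast+
    then have "degree g' = n" using deg by simp
    then have "map_poly to_ac g' = conj_poly n \<alpha>"
      using g' by (intro monic_root_unique[OF assms]) auto
    then show "g' = g" by (simp add: g map_poly_to_ac_eq_iff)
  qed
  with g show ?thesis by simp
qed

lemma min_poly_unique:
  assumes "conj_degree n \<alpha>" "degree g = n" "lead_coeff g = 1" "eval_ac g \<alpha> = 0"
  shows "g = min_poly \<alpha>"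
  using monic_root_unique[OF assms] map_poly_min_poly[OF assms(1)]
    map_poly_to_ac_eq_iff[of g "min_poly \<alpha>"] by simp

lemma min_poly_props:
  assumes "conj_degree n \<alpha>"
  shows "degree (min_poly \<alpha>) = n" "lead_coeff (min_poly \<alpha>) = 1" "eval_ac (min_poly \<alpha>) \<alpha> = 0"
proof -
  note m = map_poly_min_poly[OF assms]
  show "degree (min_poly \<alpha>) = n" using arg_cong[OF m, of degree] by simp
  show "lead_coeff (min_poly \<alpha>) = 1"
    using lead_coeff_map_poly_to_ac[of "min_poly \<alpha>"] by (simp only: m lead_coeff_conj_poly) (metis to_ac_1 to_ac_eq_iff)
  show "eval_ac (min_poly \<alpha>) \<alpha> = 0"
    using poly_conj_poly_self[of n \<alpha>] assms by (simp add: eval_ac_def m conj_degree_def)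
qed

lemma field_poly_is_unit_iff: "g dvd 1 \<longleftrightarrow> g \<noteq> 0 \<and> degree g = 0"
  for g :: "'a::field poly"
  by (cases "g = 0") (auto simp: is_unit_iff_degree)

text \<open>Whichever factor vanishes at \<alpha> already has the full degree, which leaves degree 0
  for the other.\<close>

lemma irreducible_of_conj_degree:
  assumes "conj_degree (degree g) \<alpha>" "eval_ac g \<alpha> = 0"
  shows "irreducible g"
proof (rule Factorial_Ring.irreducibleI)
  have n: "degree g > 0" using assms by (auto simp: conj_degree_def)
  then show "g \<noteq> 0" by auto
  show "\<not> g dvd 1" using n by (simp add: field_poly_is_unit_iff)
  fix a b assume ab: "g = a * b"
  then have nz: "a \<noteq> 0" "b \<noteq> 0" using n by auto
  have d: "degree g = degree a + degree b" using ab nz by (simp add: degree_mult_eq)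
  have "eval_ac a \<alpha> = 0 \<or> eval_ac b \<alpha> = 0" using assms(2) by (simp add: ab)
  then show "a dvd 1 \<or> b dvd 1"
    using conj_degree_le_degree[OF assms(1), of a] conj_degree_le_degree[OF assms(1), of b] d nz
    by (auto simp: field_poly_is_unit_iff)
qed

text \<open>The Frobenius orbit stays among the finitely many roots of a polynomial over F_q; a
  repetition is cancelled down to a period of \<alpha> itself because Frobenius is
  injective.\<close>

lemma conj_degree_exists:
  fixes \<alpha> :: "'a::finite_field alg_closure"
  obtains k where "conj_degree k \<alpha>"
proof -
  obtain g :: "'a poly" where g: "g \<noteq> 0" "eval_ac g \<alpha> = 0"
    using alg_closure_algebraic[of \<alpha>] by (auto simp: eval_ac_def)
  have "finite {x. poly (map_poly to_ac g) x = 0}"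
    using g by (intro poly_roots_finite) simp
  moreover have "(frob ^^ i) \<alpha> \<in> {x. poly (map_poly to_ac g) x = 0}" for i
  proof -
    have "eval_ac g ((frob ^^ i) \<alpha>) = (frob ^^ i) 0" using g by (simp flip: funpow_frob_eval_ac)
    moreover have "(frob ^^ i) 0 = (0 :: 'a alg_closure)" by (induction i) auto
    ultimately show ?thesis by (simp add: eval_ac_def)
  qed
  ultimately have fin: "finite (range (\<lambda>i. (frob ^^ i) \<alpha>))"
    by (elim finite_subset[rotated]) blast
  have "\<exists>i j. i < j \<and> (frob ^^ i) \<alpha> = (frob ^^ j) \<alpha>"
  proof (rule ccontr)
    assume "\<not> ?thesis"
    then have "inj (\<lambda>i. (frob ^^ i) \<alpha>)" by (intro linorder_injI) auto
    then show False using fin by (simp add: finite_image_iff)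
  qed
  then obtain i j where ij: "i < j" "(frob ^^ i) \<alpha> = (frob ^^ j) \<alpha>" by blast
  have "(frob ^^ j) \<alpha> = (frob ^^ i) ((frob ^^ (j - i)) \<alpha>)"
    using ij(1) by (simp flip: funpow_add comp_apply[of "frob ^^ i"])
  with ij have ex: "j - i > 0 \<and> (frob ^^ (j - i)) \<alpha> = \<alpha>" by simp
  define k where "k = (LEAST k. k > 0 \<and> (frob ^^ k) \<alpha> = \<alpha>)"
  have "k > 0 \<and> (frob ^^ k) \<alpha> = \<alpha>"
    unfolding k_def by (rule LeastI) (rule ex)
  moreover have "\<not> (j > 0 \<and> (frob ^^ j) \<alpha> = \<alpha>)" if "j < k" for j
    using that unfolding k_def by (rule not_less_Least)
  ultimately have "conj_degree k \<alpha>" by (auto simp: conj_degree_def)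
  then show ?thesis by (rule that)
qed

lemma conj_degree_of_irreducible:
  assumes "irreducible g" "eval_ac g \<alpha> = 0"
  shows "conj_degree (degree g) \<alpha>"
proof -
  obtain k where k: "conj_degree k \<alpha>" by (rule conj_degree_exists)
  define m where "m = min_poly \<alpha>"
  note m = min_poly_props[OF k, folded m_def]
  have k0: "k > 0" using k by (simp add: conj_degree_def)
  have "eval_ac (g mod m) \<alpha> = eval_ac (m * (g div m) + g mod m) \<alpha>"
    by (simp only: eval_ac_hom.hom_add eval_ac_hom.hom_mult m(3)) simp
  also have "\<dots> = 0" using assms(2) by simp
  finally have "g mod m = 0"
    using conj_degree_le_degree[OF k, of "g mod m"] degree_mod_less[of m g] m(1) k0
    by (cases "m = 0"; cases "g mod m = 0") auto
  then obtain r where r: "g = m * r" by (auto simp: mod_eq_0_iff_dvd)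
  moreover have "\<not> m dvd 1" using m(1) k0 by (simp add: field_poly_is_unit_iff)
  ultimately have "r dvd 1" using Factorial_Ring.irreducibleD[OF assms(1) r] by auto
  then have "degree r = 0" "r \<noteq> 0" by (auto simp: field_poly_is_unit_iff)
  then have "degree g = k" using m(1) k0 by (subst r, subst degree_mult_eq) auto
  with k show ?thesis by simp
qed


section \<open>Binary forms and places\<close>

text \<open>The substitution \<open>x \<mapsto> x z, y \<mapsto> z\<close> turns the total degree into the degree in the outer
  variable \<open>z\<close>, so that a form of degree \<open>n\<close> becomes \<open>f(x,1) z\<^sup>n\<close>.\<close>

definition twist_inner :: "'a::comm_ring_1 poly \<Rightarrow> 'a poly poly" where
  "twist_inner h = poly (map_poly (\<lambda>c. [:[:c:]:]) h) [:0, [:0, 1:]:]"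

definition twist :: "'a::comm_ring_1 poly poly \<Rightarrow> 'a poly poly" where
  "twist f = poly (map_poly twist_inner f) [:0, 1:]"

interpretation const_hom: coeff_hom "\<lambda>c::'a::comm_ring_1. [:[:c:]:]"
  by unfold_locales (simp_all add: one_pCons)

interpretation twist_inner_hom: coeff_hom twist_inner
  using const_hom.coeff_hom_poly[of "[:0, [:0, 1:]:]"] by (simp add: twist_inner_def[abs_def])

interpretation twist_hom: coeff_hom twist
  using twist_inner_hom.coeff_hom_poly[of "[:0, 1:]"] by (simp add: twist_def[abs_def])

lemma twist_inner_pCons: "twist_inner (pCons a h) = [:[:a:]:] + [:0, [:0, 1:]:] * twist_inner h"
  by (simp add: twist_inner_def)

lemma twist_pCons: "twist (pCons h f) = twist_inner h + [:0, 1:] * twist f"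
  by (simp add: twist_def)

lemma coeff_twist_inner: "coeff (twist_inner h) k = monom (coeff h k) k"
proof (induction h arbitrary: k)
  case (pCons a h)
  then show ?case
    by (cases k) (simp_all add: twist_inner_pCons monom_0 monom_Suc)
qed simp

lemma coeff_twist:
  "coeff (coeff (twist f) k) i = (if i \<le> k then coeff (coeff f (k - i)) i else 0)"
proof (induction f arbitrary: k)
  case (pCons h f)
  show ?case
  proof (cases k)
    case (Suc k')
    then show ?thesis
      using pCons.IH[of k'] by (auto simp: twist_pCons coeff_twist_inner Suc_diff_le not_le le_Suc_eq)
  qed (auto simp: twist_pCons coeff_twist_inner)
qed simp

lemma twist_eq_iff: "twist f = twist g \<longleftrightarrow> f = g"
proof
  assume eq: "twist f = twist g"
  have "coeff (coeff f j) i = coeff (coeff g j) i" for i j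
    using arg_cong[OF eq, of "\<lambda>u. coeff (coeff u (i + j)) i"] by (simp add: coeff_twist)
  then show "f = g" by (intro poly_eqI)
qed simp

lemma poly_twist_inner_1: "poly (twist_inner h) 1 = h"
  by (induction h) (simp_all add: twist_inner_pCons)

lemma poly_twist_1: "poly (twist f) 1 = poly f 1"
  by (induction f) (simp_all add: twist_pCons poly_twist_inner_1)

lemma homogeneous_coeff_eq_0:
  "homogeneous n f \<Longrightarrow> i + j \<noteq> n \<Longrightarrow> coeff (coeff f j) i = 0"
  by (auto simp: homogeneous_def)

text \<open>Turns a condition on coefficients into one equation; as \<open>twist\<close> is a ring
  homomorphism, homogeneity of explicit forms becomes a computation.\<close>

lemma homogeneous_iff_twist: "homogeneous n f \<longleftrightarrow> twist f = monom (poly f 1) n"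
proof
  assume hom: "homogeneous n f"
  have z: "coeff (twist f) k = 0" if "k \<noteq> n" for k
  proof (rule poly_eqI)
    fix i
    have "coeff (coeff f (k - i)) i = 0" if "i \<le> k"
      using hom \<open>k \<noteq> n\<close> that by (force simp: homogeneous_def)
    then show "coeff (coeff (twist f) k) i = coeff 0 i" by (simp add: coeff_twist)
  qed
  have eq: "twist f = monom (coeff (twist f) n) n"
    by (rule poly_eqI) (simp add: z)
  moreover have "poly f 1 = coeff (twist f) n"
    using arg_cong[OF eq, of "\<lambda>u. poly u 1"] by (simp add: poly_monom poly_twist_1)
  ultimately show "twist f = monom (poly f 1) n" by simp
next
  assume eq: "twist f = monom (poly f 1) n"
  have "i + j = n" if "coeff (coeff f j) i \<noteq> 0" for i j
  proof -
    have "coeff (coeff (twist f) (i + j)) i \<noteq> 0" using that by (simp add: coeff_twist)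
    then show ?thesis unfolding eq by (auto split: if_splits)
  qed
  then show "homogeneous n f" by (simp add: homogeneous_def)
qed

lemma twist_const2 [simp]: "twist (const2 c) = [:[:c:]:]"
  by (simp add: const2_def twist_pCons twist_inner_pCons)

lemma twist_var_x [simp]: "twist var_x = monom (monom 1 1) 1"
  by (intro poly_eqI) (auto simp: var_x_def coeff_twist coeff_pCons coeff_monom split: nat.split)

lemma twist_var_y [simp]: "twist var_y = monom 1 1"
  by (intro poly_eqI) (auto simp: var_y_def coeff_twist coeff_pCons coeff_monom split: nat.split)

lemma monom_power: "(monom c k) ^ i = monom (c ^ i) (k * i)" for c :: "'a::comm_ring_1"
  by (induction i) (simp_all add: mult_monom monom_0 one_pCons)

lemma twist_homogenize: "twist (homogenize g) = monom g (degree g)"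
proof -
  have "twist (homogenize g) = (\<Sum>i\<le>degree g. monom (monom (coeff g i) i) (degree g))"
    unfolding homogenize_def twist_hom.hom_sum
    by (rule sum.cong)
      (simp_all add: monom_power smult_monom mult_monom)
  also have "\<dots> = monom (\<Sum>i\<le>degree g. monom (coeff g i) i) (degree g)"
    by (rule poly_eqI) (simp add: coeff_sum)
  finally show ?thesis by (simp add: poly_as_sum_of_monoms)
qed

lemma homogenize_props:
  "poly (homogenize g) 1 = g" "homogeneous (degree g) (homogenize g)"
proof -
  show 1: "poly (homogenize g) 1 = g"
    using poly_twist_1[of "homogenize g"] by (simp add: twist_homogenize poly_monom)
  show "homogeneous (degree g) (homogenize g)"
    by (simp add: homogeneous_iff_twist twist_homogenize 1)
qed

text \<open>Setting y = 1 loses only powers of y, and an irreducible form divisible by y has degree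
  1; hence the bound n \<ge> 2. A factorisation of f(x,1) homogenizes to one of f.\<close>

lemma irreducible_homogeneousD:
  fixes f :: "'a::finite_field poly poly"
  assumes irr: "irreducible f" and hom: "homogeneous n f" and n: "n \<ge> 2"
  shows "degree (poly f 1) = n" "irreducible (poly f 1)"
proof -
  define g where "g = poly f 1"
  have tw: "twist f = monom g n" using hom by (simp add: homogeneous_iff_twist g_def)
  have "f \<noteq> 0" using irr by auto
  then have "g \<noteq> 0" using tw twist_eq_iff[of f 0] by auto
  have c: "coeff (coeff f (n - i)) i = coeff g i" if "i \<le> n" for i
    using arg_cong[OF tw, of "\<lambda>u. coeff (coeff u n) i"] that by (simp add: coeff_twist)
  have "degree g \<le> n"
  proof (rule degree_le, intro allI impI)
    fix i assume "n < i"
    then show "coeff g i = 0"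
      using arg_cong[OF tw, of "\<lambda>u. coeff (coeff u n) i"] by (simp add: coeff_twist)
  qed
  \<comment> \<open>Without x^n the form is divisible by y, hence equal to y up to a unit; its
    \<open>twist\<close> then has outer degree 1, against n \<ge> 2.\<close>
  moreover have "coeff g n \<noteq> 0"
  proof
    assume "coeff g n = 0"
    have "coeff f 0 = 0"
    proof (rule poly_eqI)
      fix i show "coeff (coeff f 0) i = coeff 0 i"
        using homogeneous_coeff_eq_0[OF hom, of i 0] c[of n] \<open>coeff g n = 0\<close>
        by (cases "i = n") auto
    qed
    then obtain f' where f': "f = [:0, 1:] * f'" by (cases f) auto
    have "\<not> [:0, 1::'a poly:] dvd 1"
    proof
      assume "[:0, 1::'a poly:] dvd 1"
      then obtain u where "1 = [:0, 1::'a poly:] * u" by (elim dvdE)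
      then have "poly 1 0 = poly ([:0, 1::'a poly:] * u) 0" by simp
      then show False by simp
    qed
    with Factorial_Ring.irreducibleD[OF irr f'] have "f' dvd 1" by simp
    then obtain e where "1 = f' * e" by (elim dvdE)
    from arg_cong[OF this, of twist] have e: "twist f' * twist e = 1" by simp
    then have nz: "twist f' \<noteq> 0" "twist e \<noteq> 0" by auto
    have "degree (twist f' * twist e) = 0" by (simp add: e)
    then have d: "degree (twist f') = 0" using nz by (simp add: degree_mult_eq)
    have "twist f = [:0, 1:] * twist f'" by (simp add: f' twist_pCons)
    then have "degree (monom g n) = degree ([:0, 1:] * twist f')" unfolding tw[symmetric] by simp
    also have "\<dots> = 1" using nz d by (subst degree_mult_eq) auto
    finally show False using \<open>g \<noteq> 0\<close> n by (simp add: degree_monom_eq)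
  qed
  ultimately have deg: "degree g = n" by (intro antisym le_degree)
  then show "degree (poly f 1) = n" by (simp add: g_def)
  have "irreducible g"
  proof (rule Factorial_Ring.irreducibleI)
    show "g \<noteq> 0" by fact
    show "\<not> g dvd 1" using deg n by (simp add: field_poly_is_unit_iff)
    fix a b assume ab: "g = a * b"
    with \<open>g \<noteq> 0\<close> have nz: "a \<noteq> 0" "b \<noteq> 0" by auto
    have "twist f = twist (homogenize a * homogenize b)"
      using deg nz by (simp add: tw twist_homogenize mult_monom ab degree_mult_eq)
    then have "f = homogenize a * homogenize b" by (simp only: twist_eq_iff)
    with irr have "homogenize a dvd 1 \<or> homogenize b dvd 1" by (rule Factorial_Ring.irreducibleD)
    moreover have "u dvd 1" if "homogenize u dvd 1" for u :: "'a poly"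
    proof -
      from that obtain w where "1 = homogenize u * w" by (elim dvdE)
      from arg_cong[OF this, of "\<lambda>v. poly v 1"] have "1 = u * poly w 1"
        by (simp add: homogenize_props)
      then show ?thesis by (rule dvdI)
    qed
    ultimately show "a dvd 1 \<or> b dvd 1" by blast
  qed
  then show "irreducible (poly f 1)" by (simp add: g_def)
qed

text \<open>Powers of the variable are peeled off one at a time: the constant coefficient of A * B
  vanishes, hence that of A or of B. Applied to \<open>twist\<close>, it shows that a factor of a
  form is again a form.\<close>

lemma monom_factor:
  fixes A B :: "'a::idom poly"
  assumes "A * B = monom c n" "c \<noteq> 0"
  shows "\<exists>a i. A = monom a i \<and> a \<noteq> 0"
  using assms(1)
proof (induction n arbitrary: A B)
  case 0
  have "A * B \<noteq> 0" using 0 assms(2) by (simp add: monom_0)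
  then have nz: "A \<noteq> 0" "B \<noteq> 0" by auto
  have "degree (A * B) = 0" using 0 by (simp add: monom_0)
  then have "degree A = 0" using nz by (simp add: degree_mult_eq)
  then obtain a where "A = [:a:]" by (rule degree_eq_zeroE)
  with nz have "A = monom a 0 \<and> a \<noteq> 0" by (simp add: monom_0)
  then show ?case by blast
next
  case (Suc n)
  have "coeff A 0 * coeff B 0 = 0"
    using arg_cong[OF Suc.prems, of "\<lambda>u. coeff u 0"] by (simp add: coeff_mult_0)
  then consider "coeff A 0 = 0" | "coeff B 0 = 0" by auto
  then show ?case
  proof cases
    case 1
    then obtain A' where A': "A = pCons 0 A'" by (cases A) auto
    then have "pCons 0 (A' * B) = pCons 0 (monom c n)" using Suc.prems by (simp add: monom_Suc)
    then have "A' * B = monom c n" by simp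
    from Suc.IH[OF this] obtain a i where "A' = monom a i" "a \<noteq> 0" by blast
    then have "A = monom a (Suc i) \<and> a \<noteq> 0" by (simp add: A' monom_Suc)
    then show ?thesis by blast
  next
    case 2
    then obtain B' where B': "B = pCons 0 B'" by (cases B) auto
    then have "pCons 0 (A * B') = pCons 0 (monom c n)" using Suc.prems by (simp add: monom_Suc)
    then have "A * B' = monom c n" by simp
    then show ?thesis by (rule Suc.IH)
  qed
qed

text \<open>Such a factor is c * y^i; the coefficient of x^n in f is nonzero, so y does not divide f
  and i = 0.\<close>

lemma unit_factor_of_form:
  fixes f u v :: "'a::finite_field poly poly"
  assumes hom: "homogeneous n f" and deg: "degree (poly f 1) = n" "poly f 1 \<noteq> 0"
    and f: "f = u * v" and unit: "poly u 1 dvd 1"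
  shows "u dvd 1"
proof -
  have "twist u * twist v = monom (poly f 1) n"
    using hom by (simp add: homogeneous_iff_twist f)
  from monom_factor[OF this deg(2)] obtain a i where ai: "twist u = monom a i" "a \<noteq> 0" by blast
  then have "a = poly u 1" using poly_twist_1[of u] by (simp add: poly_monom)
  then have "degree a = 0" using unit by (auto simp: field_poly_is_unit_iff)
  then obtain c where c: "a = [:c:]" by (rule degree_eq_zeroE)
  have u: "coeff (coeff u j) k = (if j = i \<and> k = 0 then c else 0)" for j k
    using arg_cong[OF ai(1), of "\<lambda>w. coeff (coeff w (k + j)) k"]
    by (auto simp: coeff_twist c coeff_pCons split: if_splits nat.splits)
  have "i = 0"
  proof (rule ccontr)
    assume "i \<noteq> 0"
    then have "coeff u 0 = 0" by (intro poly_eqI) (simp add: u)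
    then have "coeff f 0 = 0" by (simp add: f coeff_mult_0)
    moreover have "coeff (coeff (twist f) n) n \<noteq> 0"
      using hom deg by (auto simp: homogeneous_iff_twist)
    ultimately show False by (simp add: coeff_twist)
  qed
  have "u = [:[:c:]:]"
    by (intro poly_eqI) (auto simp: u \<open>i = 0\<close> coeff_pCons split: nat.split)
  then have "u * [:[:inverse c:]:] = 1" using ai(2) c by (simp flip: one_pCons)
  then have "1 = u * [:[:inverse c:]:]" by simp
  then show ?thesis by (rule dvdI)
qed

lemma irreducible_homogeneousI:
  fixes f :: "'a::finite_field poly poly"
  assumes hom: "homogeneous n f" and deg: "degree (poly f 1) = n" and irr: "irreducible (poly f 1)"
  shows "irreducible f"
proof (rule Factorial_Ring.irreducibleI)
  have nz: "poly f 1 \<noteq> 0" using irr by auto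
  then show "f \<noteq> 0" by auto
  show "\<not> f dvd 1"
  proof
    assume "f dvd 1"
    then obtain w where "1 = f * w" by (elim dvdE)
    from arg_cong[OF this, of "\<lambda>v. poly v 1"] have "1 = poly f 1 * poly w 1" by simp
    then have "poly f 1 dvd 1" by (rule dvdI)
    with irr show False by (simp add: Factorial_Ring.irreducible_def)
  qed
  fix u v assume uv: "f = u * v"
  then have "poly f 1 = poly u 1 * poly v 1" by simp
  then have "poly u 1 dvd 1 \<or> poly v 1 dvd 1" by (rule Factorial_Ring.irreducibleD[OF irr])
  then show "u dvd 1 \<or> v dvd 1"
    using unit_factor_of_form[OF hom deg nz uv] unit_factor_of_form[OF hom deg nz, of v u] uv
    by (auto simp: mult.commute)
qed

text \<open>The place through \<alpha>, written without a form. Later arguments about places are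
  carried out on such orbits.\<close>

definition orbit_divisor :: "nat \<Rightarrow> 'a::finite_field alg_closure \<Rightarrow> 'a alg_closure point multiset" where
  "orbit_divisor n \<alpha> = image_mset (\<lambda>i. proj_point ((frob ^^ i) \<alpha>) 1) (mset_set {..<n})"

lemma place_formsD:
  assumes "f \<in> place_forms n" "n \<ge> 2"
  shows "degree (poly f 1) = n" "irreducible (poly f 1)" "lead_coeff (poly f 1) = 1" "homogeneous n f"
  using assms irreducible_homogeneousD[of f n] by (auto simp: place_forms_def)

lemma form_root_exists:
  assumes "degree (poly f 1) > 0"
  obtains \<alpha> where "form_root f \<alpha>"
proof -
  have "degree (map_poly to_ac (poly f 1)) > 0" using assms by simp
  then obtain \<alpha> where "poly (map_poly to_ac (poly f 1)) \<alpha> = 0"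
    using alg_closed_imp_poly_has_root by blast
  then show ?thesis by (intro that[of \<alpha>]) (simp add: form_root_def eval_ac_def)
qed

lemma place_forms_root_exists:
  assumes "f \<in> place_forms n" "n \<ge> 2"
  obtains \<alpha> where "form_root f \<alpha>"
  using form_root_exists[of f] place_formsD(1)[OF assms] assms(2) by auto

lemma place_forms_root:
  assumes "f \<in> place_forms n" "n \<ge> 2" "form_root f \<alpha>"
  shows "conj_degree n \<alpha>" "poly f 1 = min_poly \<alpha>"
proof -
  note p = place_formsD[OF assms(1,2)]
  have root: "eval_ac (poly f 1) \<alpha> = 0" using assms(3) by (simp add: form_root_def)
  show "conj_degree n \<alpha>" using conj_degree_of_irreducible[OF p(2) root] p(1) by simp
  then show "poly f 1 = min_poly \<alpha>" using p root by (intro min_poly_unique) auto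
qed

lemma place_formsI:
  assumes "homogeneous n f" "degree (poly f 1) = n" "lead_coeff (poly f 1) = 1"
    "conj_degree n \<alpha>" "form_root f \<alpha>"
  shows "f \<in> place_forms n"
  using assms irreducible_of_conj_degree[of "poly f 1" \<alpha>] irreducible_homogeneousI[of n f]
  by (auto simp: place_forms_def form_root_def)

lemma form_root_iff_conjugate:
  assumes "f \<in> place_forms n" "n \<ge> 2" "form_root f \<alpha>"
  shows "form_root f \<beta> \<longleftrightarrow> (\<exists>i<n. \<beta> = (frob ^^ i) \<alpha>)"
proof -
  note p = place_forms_root[OF assms]
  show ?thesis
    by (auto simp: form_root_def p(2) eval_ac_def map_poly_min_poly[OF p(1)] conj_poly_def poly_prod)
qed

lemma divisor_eq_orbit_divisor:
  fixes f :: "'a::finite_field poly poly"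
  assumes "f \<in> place_forms n" "n \<ge> 2" "form_root f \<alpha>"
  shows "divisor f = orbit_divisor n \<alpha>"
proof -
  note p = place_forms_root[OF assms] and d = place_formsD[OF assms(1,2)]
  \<comment> \<open>The coefficient of x^n in f is 1, so f(1,y) does not vanish at y = 0 and the
    point at infinity contributes nothing to the divisor.\<close>
  have "coeff (coeff (twist f) n) n = 1"
    using d by (simp add: homogeneous_iff_twist)
  define c where "c = coeff (coeff f 0) n"
  have "c \<noteq> 0" using \<open>coeff (coeff (twist f) n) n = 1\<close> by (simp add: coeff_twist c_def)
  have "coeff f 0 = monom c n"
    using homogeneous_coeff_eq_0[OF d(4), of _ 0] by (intro poly_eqI) (auto simp: c_def)
  then have "poly (coeff f 0) 1 \<noteq> 0"
    using \<open>c \<noteq> 0\<close> by (simp add: poly_monom)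
  then have "poly (map_poly (\<lambda>c. poly c 1) f) 0 \<noteq> 0"
    by (simp add: poly_0_coeff_0 coeff_map_poly)
  then have o: "Polynomial.order 0 (map_poly (\<lambda>c. poly c 1) f) = 0"
    by (rule order_0I)
  have "proots (conj_poly n \<alpha>) = (\<Sum>i<n. proots [:- (frob ^^ i) \<alpha>, 1:])"
    unfolding conj_poly_def by (rule proots_prod) auto
  also have "\<dots> = image_mset (\<lambda>i. (frob ^^ i) \<alpha>) (mset_set {..<n})"
    by (simp add: sum_unfold_sum_mset)
  finally have "proots (map_poly to_ac (poly f 1)) = image_mset (\<lambda>i. (frob ^^ i) \<alpha>) (mset_set {..<n})"
    by (simp add: p(2) map_poly_min_poly[OF p(1)])
  then show ?thesis
    by (simp add: divisor_def orbit_divisor_def o image_mset.compositionality comp_def)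
qed

lemma homogenize_min_poly:
  assumes "conj_degree n \<alpha>"
  shows "homogenize (min_poly \<alpha>) \<in> place_forms n" "form_root (homogenize (min_poly \<alpha>)) \<alpha>"
proof -
  note m = min_poly_props[OF assms]
  show 1: "form_root (homogenize (min_poly \<alpha>)) \<alpha>"
    by (simp add: form_root_def homogenize_props m)
  show "homogenize (min_poly \<alpha>) \<in> place_forms n"
    using 1 m assms homogenize_props(2)[of "min_poly \<alpha>"]
    by (intro place_formsI[of n _ \<alpha>]) (auto simp: homogenize_props(1))
qed


section \<open>Frobenius functions\<close>

text \<open>A nonzero element of least degree in the ideal generated by P and Q divides both, by
  division with remainder.\<close>

lemma coprime_poly_bezout:
  fixes P Q :: "'a::field poly"
  assumes "coprime P Q"
  obtains u v where "u * P + v * Q = 1"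
proof -
  define S where "S = {u * P + v * Q | u v. True}"
  have SI: "u * P + v * Q \<in> S" for u v by (auto simp: S_def)
  have PQ: "P \<in> S" "Q \<in> S" using SI[of 1 0] SI[of 0 1] by auto
  have "P \<noteq> 0 \<or> Q \<noteq> 0" using assms by auto
  then have "\<exists>d. d \<in> S \<and> d \<noteq> 0" using PQ by auto
  then obtain d where d: "d \<in> S" "d \<noteq> 0" and min: "\<And>e. e \<in> S \<Longrightarrow> e \<noteq> 0 \<Longrightarrow> degree d \<le> degree e"
    using ex_has_least_nat[of "\<lambda>d. d \<in> S \<and> d \<noteq> 0" _ degree] by blast
  obtain u v where uv: "d = u * P + v * Q" using d by (auto simp: S_def)
  have dvd: "d dvd R" if "R \<in> S" for R
  proof -
    obtain u' v' where uv': "R = u' * P + v' * Q" using \<open>R \<in> S\<close> by (auto simp: S_def)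
    have "R mod d = R - d * (R div d)" by (simp add: minus_mult_div_eq_mod)
    also have "\<dots> = (u' - u * (R div d)) * P + (v' - v * (R div d)) * Q"
      using uv uv' by (simp add: algebra_simps)
    finally have "R mod d \<in> S" using SI by metis
    then have "R mod d = 0" using min[of "R mod d"] degree_mod_less[OF d(2), of R] by force
    then show ?thesis by (simp add: mod_eq_0_iff_dvd)
  qed
  have "d dvd 1" using coprime_common_divisor[OF assms] dvd PQ by blast
  then obtain e where e: "1 = d * e" by (elim dvdE)
  have "(e * u) * P + (e * v) * Q = 1" using e uv by (simp add: algebra_simps)
  then show ?thesis by (rule that)
qed

lemma lowest_terms_factor:
  assumes "lowest_terms F P Q" "F = Fraction_Field.Fract P' Q'" "Q' \<noteq> 0"
  obtains w where "P' = P * w" "Q' = Q * w" "w \<noteq> 0"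
proof -
  have Q: "Q \<noteq> 0" "coprime P Q" "F = Fraction_Field.Fract P Q"
    using assms(1) by (auto simp: lowest_terms_def)
  have cross: "P * Q' = P' * Q"
    using Q assms(2,3) by (simp add: eq_fract)
  obtain u v where uv: "u * P + v * Q = 1" using coprime_poly_bezout[OF Q(2)] .
  \<comment> \<open>If P' = P * w and Q' = Q * w, then u * P' + v * Q' = w; this forces the choice
    of the common factor.\<close>
  have "Q * (u * P' + v * Q') = u * (P' * Q) + v * Q * Q'" by (simp add: algebra_simps)
  also have "\<dots> = (u * P + v * Q) * Q'" unfolding cross[symmetric] by (simp add: algebra_simps)
  finally have q: "Q' = Q * (u * P' + v * Q')" using uv by simp
  have "P * (u * P' + v * Q') = u * P * P' + v * (P * Q')" by (simp add: algebra_simps)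
  also have "\<dots> = (u * P + v * Q) * P'" unfolding cross by (simp add: algebra_simps)
  finally have p: "P' = P * (u * P' + v * Q')" using uv by simp
  have "u * P' + v * Q' \<noteq> 0" using q assms(3) by auto
  with p q show ?thesis by (rule that)
qed

lemma lowest_terms_unique:
  assumes "lowest_terms F P Q" "lowest_terms F P' Q'"
  obtains c where "c \<noteq> 0" "P' = Polynomial.smult c P" "Q' = Polynomial.smult c Q"
proof -
  have Q': "Q' \<noteq> 0" "coprime P' Q'" "F = Fraction_Field.Fract P' Q'"
    using assms(2) by (auto simp: lowest_terms_def)
  obtain w where w: "P' = P * w" "Q' = Q * w" "w \<noteq> 0"
    using lowest_terms_factor[OF assms(1) Q'(3,1)] .
  have "w dvd 1" using coprime_common_divisor[OF Q'(2), of w] w by simp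
  then have "degree w = 0" using w(3) by (simp add: field_poly_is_unit_iff)
  then obtain c where "w = [:c:]" by (rule degree_eq_zeroE)
  with w show ?thesis by (intro that[of c]) auto
qed

lemma lowest_terms_exists:
  obtains P Q where "lowest_terms F P Q"
proof -
  obtain a b where "F = Fraction_Field.Fract a b" "b \<noteq> 0" by (cases F)
  then have "\<exists>PQ. snd PQ \<noteq> 0 \<and> F = Fraction_Field.Fract (fst PQ) (snd PQ)" by auto
  then obtain PQ where PQ: "snd PQ \<noteq> 0 \<and> F = Fraction_Field.Fract (fst PQ) (snd PQ)"
    and min: "\<And>RS. snd RS \<noteq> 0 \<and> F = Fraction_Field.Fract (fst RS) (snd RS) \<Longrightarrow> degree (snd PQ) \<le> degree (snd RS)"
    using ex_has_least_nat[of "\<lambda>PQ. snd PQ \<noteq> 0 \<and> F = Fraction_Field.Fract (fst PQ) (snd PQ)" _ "\<lambda>PQ. degree (snd PQ)"]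
    by blast
  obtain P Q where [simp]: "PQ = (P, Q)" by (cases PQ)
  have "coprime P Q"
  proof (rule coprimeI)
    fix d assume "d dvd P" "d dvd Q"
    then obtain P' Q' where d: "P = d * P'" "Q = d * Q'" by (auto elim!: dvdE)
    have nz: "d \<noteq> 0" "Q' \<noteq> 0" using PQ d by auto
    have "F = Fraction_Field.Fract P' Q'" using PQ d nz by (simp add: eq_fract)
    then have "degree Q \<le> degree Q'" using min[of "(P', Q')"] nz by simp
    then show "d dvd 1" using d nz by (simp add: degree_mult_eq field_poly_is_unit_iff)
  qed
  with PQ show ?thesis by (intro that[of P Q]) (simp add: lowest_terms_def)
qed

section \<open>Degrees and values of rational functions\<close>

lemma proj_point_cmult: "k \<noteq> 0 \<Longrightarrow> proj_point (k * a) (k * b) = proj_point a b"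
proof -
  assume k: "k \<noteq> 0"
  have "\<exists>c'. c * (k * a) = c' * a \<and> c * (k * b) = c' * b \<and> c' \<noteq> 0" if "c \<noteq> 0" for c
    using that k by (intro exI[of _ "c * k"]) simp
  moreover have "\<exists>c'. c * a = c' * (k * a) \<and> c * b = c' * (k * b) \<and> c' \<noteq> 0" if "c \<noteq> 0" for c
    using that k by (intro exI[of _ "c / k"]) simp
  ultimately show ?thesis unfolding proj_point_def by fastforce
qed

lemma proj_point_eq_iff: "proj_point x 1 = proj_point u v \<longleftrightarrow> v \<noteq> 0 \<and> u = x * v"
proof
  assume eq: "proj_point x 1 = proj_point u v"
  have "(x, 1) \<in> proj_point x 1" by (auto simp: proj_point_def intro: exI[of _ 1])
  then obtain c where "x = c * u" "1 = c * v" "c \<noteq> 0" unfolding eq by (auto simp: proj_point_def)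
  then show "v \<noteq> 0 \<and> u = x * v" by (auto simp: field_simps)
next
  assume "v \<noteq> 0 \<and> u = x * v"
  then show "proj_point x 1 = proj_point u v"
    using proj_point_cmult[of v x 1] by (simp add: mult.commute)
qed

lemma ratfun_degree_eq:
  assumes "lowest_terms F P Q"
  shows "ratfun_degree F = max (degree P) (degree Q)"
  unfolding ratfun_degree_def
proof (rule the_equality)
  fix d assume "\<exists>P Q. lowest_terms F P Q \<and> d = max (degree P) (degree Q)"
  then obtain P' Q' where *: "lowest_terms F P' Q'" "d = max (degree P') (degree Q')" by blast
  obtain c where "c \<noteq> 0" "P' = Polynomial.smult c P" "Q' = Polynomial.smult c Q"
    using lowest_terms_unique[OF assms *(1)] .
  with * show "d = max (degree P) (degree Q)" by simp
qed (use assms in blast)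

lemma ratfun_value_eq:
  assumes "lowest_terms F P Q"
  shows "ratfun_value F \<alpha> = proj_point (eval_ac P \<alpha>) (eval_ac Q \<alpha>)"
  unfolding ratfun_value_def
proof (rule the_equality)
  fix v assume "\<exists>P Q. lowest_terms F P Q \<and> v = proj_point (eval_ac P \<alpha>) (eval_ac Q \<alpha>)"
  then obtain P' Q' where *: "lowest_terms F P' Q'" "v = proj_point (eval_ac P' \<alpha>) (eval_ac Q' \<alpha>)"
    by blast
  obtain c where c: "c \<noteq> 0" "P' = Polynomial.smult c P" "Q' = Polynomial.smult c Q"
    using lowest_terms_unique[OF assms *(1)] .
  have "eval_ac (Polynomial.smult c R) \<alpha> = to_ac c * eval_ac R \<alpha>" for R
    by (simp add: eval_ac_def)
  with * c show "v = proj_point (eval_ac P \<alpha>) (eval_ac Q \<alpha>)" by (simp add: proj_point_cmult)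
qed (use assms in blast)

text \<open>Trades an equality of point sets for an equation between values of polynomials: the
  point (\<alpha>^q : 1) is finite, so \<alpha> must not be a pole of F.\<close>

lemma frob_value_iff:
  assumes "lowest_terms F P Q"
  shows "proj_point (frob \<alpha>) 1 = ratfun_value F \<alpha> \<longleftrightarrow>
    eval_ac Q \<alpha> \<noteq> 0 \<and> eval_ac P \<alpha> = frob \<alpha> * eval_ac Q \<alpha>"
  by (simp add: ratfun_value_eq[OF assms] proj_point_eq_iff)

lemma conj_degree_eval_nonzero:
  "conj_degree n \<alpha> \<Longrightarrow> g \<noteq> 0 \<Longrightarrow> degree g < n \<Longrightarrow> eval_ac g \<alpha> \<noteq> 0"
  using conj_degree_le_degree[of n \<alpha> g] by auto

lemma card_ext_field_le:
  assumes "0 < n"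
  shows "finite (ext_field n :: 'a::finite_field alg_closure set)"
    "card (ext_field n :: 'a alg_closure set) \<le> CARD('a) ^ n"
proof -
  have "CARD('a) ^ n > 1" by (rule one_less_power[OF card_field_gt_1 assms])
  from card_power_fixed_le[OF this, where 'a="'a alg_closure"]
  show "finite (ext_field n :: 'a alg_closure set)"
    "card (ext_field n :: 'a alg_closure set) \<le> CARD('a) ^ n"
    by (simp_all add: ext_field_def)
qed

text \<open>Thue's lemma: there are more pairs of polynomials of degree at most \<open>(n - 1) / 2\<close> than
  elements of the field with \<open>q\<^sup>n\<close> elements.\<close>
lemma rational_approximation:
  fixes \<alpha> \<beta> :: "'a::finite_field alg_closure"
  assumes \<alpha>: "\<alpha> \<in> ext_field n" and \<beta>: "\<beta> \<in> ext_field n" and n: "0 < n" "n < 2 * Suc m"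
  obtains P Q where "degree P \<le> m" "degree Q \<le> m" "P \<noteq> 0 \<or> Q \<noteq> 0" "eval_ac P \<alpha> = \<beta> * eval_ac Q \<alpha>"
proof -
  define L where "L = {xs :: 'a list. set xs \<subseteq> UNIV \<and> length xs = Suc m}"
  have L: "finite L" "card L = CARD('a) ^ Suc m"
    unfolding L_def by (rule finite_lists_length_eq, simp) (subst card_lists_length_eq, simp_all)
  define T where "T = (\<lambda>(xs, ys). eval_ac (Poly xs) \<alpha> - \<beta> * eval_ac (Poly ys) \<alpha>)"
  have "T ` (L \<times> L) \<subseteq> ext_field n"
    using \<alpha> \<beta> by (auto simp: T_def ext_field_iff funpow_frob_eval_ac)
  then have "card (T ` (L \<times> L)) \<le> CARD('a) ^ n"
    using card_mono[of "ext_field n" "T ` (L \<times> L)"] card_ext_field_le[OF n(1), where 'a='a] by linarith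
  also have "\<dots> < CARD('a) ^ (2 * Suc m)"
    using card_field_gt_1 n(2) by (intro power_strict_increasing) auto
  also have "\<dots> = card (L \<times> L)" by (simp add: card_cartesian_product L power_add mult_2 power2_eq_square)
  \<comment> \<open>Two colliding pairs are subtracted: \<open>T\<close> is additive in the
    polynomials, and the degree bounds survive differences.\<close>
  finally have "\<not> inj_on T (L \<times> L)" by (rule pigeonhole)
  then obtain x1 y1 x2 y2 where xy: "x1 \<in> L" "y1 \<in> L" "x2 \<in> L" "y2 \<in> L"
    "T (x1, y1) = T (x2, y2)" "x1 \<noteq> x2 \<or> y1 \<noteq> y2"
    unfolding inj_on_def by blast
  have inj: "x = y" if "Poly x = Poly y" "x \<in> L" "y \<in> L" for x y
  proof (rule nth_equalityI)
    show len: "length x = length y" using that by (simp add: L_def)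
    fix i assume "i < length x"
    then show "x ! i = y ! i"
      using arg_cong[OF that(1), of "\<lambda>p. coeff p i"] len by (simp add: nth_default_nth)
  qed
  have deg: "degree (Poly x - Poly y) \<le> m" if "x \<in> L" "y \<in> L" for x y
  proof (rule degree_le, intro allI impI)
    fix i assume "m < i"
    then show "coeff (Poly x - Poly y) i = 0"
      using that by (simp add: nth_default_beyond L_def)
  qed
  have "eval_ac (Poly x1 - Poly x2) \<alpha> = \<beta> * eval_ac (Poly y1 - Poly y2) \<alpha>"
    using xy(5) by (simp add: T_def algebra_simps)
  moreover have "Poly x1 - Poly x2 \<noteq> 0 \<or> Poly y1 - Poly y2 \<noteq> 0"
    using xy(6) inj xy(1-4) by auto
  ultimately show ?thesis using that deg xy(1-4) by blast
qed

text \<open>The body of the definite description, named so that existence and uniqueness can be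
  proved separately.\<close>

definition is_frobenius_function :: "nat \<Rightarrow> 'a::finite_field poly poly \<Rightarrow> 'a poly fract \<Rightarrow> bool" where
  "is_frobenius_function n f F \<longleftrightarrow> ratfun_degree F \<le> (n - 1) div 2 \<and>
     (\<forall>\<alpha>. form_root f \<alpha> \<longrightarrow> proj_point (frob \<alpha>) 1 = ratfun_value F \<alpha>)"

text \<open>A single root suffices: Frobenius permutes the roots of f transitively and commutes with
  evaluation of P and Q. There is no pole because Q has degree below n.\<close>

lemma is_frobenius_functionI:
  assumes f: "f \<in> place_forms n" "n \<ge> 2" "form_root f \<alpha>"
    and F: "lowest_terms F P Q" "degree P \<le> (n - 1) div 2" "degree Q \<le> (n - 1) div 2"
    and eq: "eval_ac P \<alpha> = frob \<alpha> * eval_ac Q \<alpha>"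
  shows "is_frobenius_function n f F"
  unfolding is_frobenius_function_def
proof (intro conjI allI impI)
  show "ratfun_degree F \<le> (n - 1) div 2" using F by (simp add: ratfun_degree_eq)
  fix \<beta> assume "form_root f \<beta>"
  then obtain i where i: "\<beta> = (frob ^^ i) \<alpha>" using form_root_iff_conjugate[OF f] by auto
  have c: "conj_degree n \<beta>" by (rule place_forms_root(1)[OF f(1,2) \<open>form_root f \<beta>\<close>])
  have "eval_ac P \<beta> = (frob ^^ i) (frob \<alpha> * eval_ac Q \<alpha>)"
    by (simp only: i eq flip: funpow_frob_eval_ac)
  also have "\<dots> = frob \<beta> * eval_ac Q \<beta>"
    by (simp add: i funpow_frob_eval_ac funpow_swap1)
  finally have "eval_ac P \<beta> = frob \<beta> * eval_ac Q \<beta>" .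
  moreover have "eval_ac Q \<beta> \<noteq> 0"
    using F f(2) by (intro conj_degree_eval_nonzero[OF c]) (auto simp: lowest_terms_def)
  ultimately show "proj_point (frob \<beta>) 1 = ratfun_value F \<beta>"
    by (simp add: frob_value_iff[OF F(1)])
qed

text \<open>Two candidates P/Q and P'/Q' agree at \<alpha>, so P * Q' - P' * Q, of degree at most n
  - 1, vanishes at a point of degree n and is zero.\<close>

lemma is_frobenius_function_unique:
  assumes f: "f \<in> place_forms n" "n \<ge> 2"
    and F: "is_frobenius_function n f F" "is_frobenius_function n f F'"
  shows "F = F'"
proof -
  obtain \<alpha> where \<alpha>: "form_root f \<alpha>" using place_forms_root_exists[OF f] .
  note c = place_forms_root(1)[OF f \<alpha>]
  obtain P Q where PQ: "lowest_terms F P Q" by (rule lowest_terms_exists)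
  obtain P' Q' where PQ': "lowest_terms F' P' Q'" by (rule lowest_terms_exists)
  have e: "eval_ac P \<alpha> = frob \<alpha> * eval_ac Q \<alpha>" "eval_ac P' \<alpha> = frob \<alpha> * eval_ac Q' \<alpha>"
    using F \<alpha> frob_value_iff[OF PQ] frob_value_iff[OF PQ'] by (auto simp: is_frobenius_function_def)
  have d: "degree P \<le> (n - 1) div 2" "degree Q \<le> (n - 1) div 2"
    "degree P' \<le> (n - 1) div 2" "degree Q' \<le> (n - 1) div 2"
    using F by (auto simp: is_frobenius_function_def ratfun_degree_eq[OF PQ] ratfun_degree_eq[OF PQ'])
  have "eval_ac (P * Q' - P' * Q) \<alpha> = 0" by (simp add: e)
  moreover have "degree (P * Q' - P' * Q) < n"
  proof -
    have "degree (P * Q') \<le> n - 1" "degree (P' * Q) \<le> n - 1"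
      using degree_mult_le[of P Q'] degree_mult_le[of P' Q] d by auto
    then have "degree (P * Q' - P' * Q) \<le> n - 1" by (rule degree_diff_le)
    then show ?thesis using f(2) by simp
  qed
  ultimately have "P * Q' - P' * Q = 0" using conj_degree_eval_nonzero[OF c] by blast
  then show ?thesis using PQ PQ' by (simp add: lowest_terms_def eq_fract)
qed

lemma is_frobenius_function_exists:
  assumes f: "f \<in> place_forms n" "n \<ge> 2" and "odd n"
  obtains F where "is_frobenius_function n f F"
proof -
  obtain \<alpha> where \<alpha>: "form_root f \<alpha>" using place_forms_root_exists[OF f] .
  note c = place_forms_root(1)[OF f \<alpha>]
  define m where "m = (n - 1) div 2"
  \<comment> \<open>Here oddness matters: 2 (m + 1) = n + 1 exceeds n, while for even n it would
    equal n.\<close>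
  have m: "n < 2 * Suc m" "m < n" "0 < n" using \<open>odd n\<close> f(2) by (auto simp: m_def elim!: oddE)
  have ext: "\<alpha> \<in> ext_field n" "frob \<alpha> \<in> ext_field n"
    using conj_degree_fixed_iff[OF c, of n] by (auto simp: ext_field_iff simp flip: funpow_swap1)
  obtain P Q where PQ: "degree P \<le> m" "degree Q \<le> m" "P \<noteq> 0 \<or> Q \<noteq> 0"
    "eval_ac P \<alpha> = frob \<alpha> * eval_ac Q \<alpha>"
    using rational_approximation[OF ext m(3,1)] .
  have "Q \<noteq> 0"
  proof
    assume "Q = 0"
    then have "P \<noteq> 0" "eval_ac P \<alpha> = 0" using PQ by auto
    then show False using conj_degree_eval_nonzero[OF c, of P] PQ(1) m(2) by simp
  qed
  obtain P0 Q0 where lt: "lowest_terms (Fraction_Field.Fract P Q) P0 Q0" by (rule lowest_terms_exists)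
  obtain w where w: "P = P0 * w" "Q = Q0 * w" "w \<noteq> 0"
    using lowest_terms_factor[OF lt refl \<open>Q \<noteq> 0\<close>] .
  have le: "degree A \<le> m" if "degree (A * w) \<le> m" for A
    using that w(3) by (cases "A = 0") (auto simp: degree_mult_eq)
  \<comment> \<open>Thue's lemma need not give coprime polynomials; the common factor w cannot
    vanish at \<alpha> because of its degree, so it cancels from the relation.\<close>
  have "degree w < n" using \<open>Q \<noteq> 0\<close> PQ(2) m(2) w by (auto simp: degree_mult_eq)
  then have "eval_ac w \<alpha> \<noteq> 0" using conj_degree_eval_nonzero[OF c w(3)] by simp
  then have "eval_ac P0 \<alpha> = frob \<alpha> * eval_ac Q0 \<alpha>" using PQ(4) by (simp add: w)
  then have "is_frobenius_function n f (Fraction_Field.Fract P Q)"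
    using PQ(1,2) le[of P0] le[of Q0] w(1,2)
    by (intro is_frobenius_functionI[OF f \<alpha> lt]) (auto simp: m_def)
  then show ?thesis by (rule that)
qed

lemma frobenius_function_eqI:
  assumes "f \<in> place_forms n" "n \<ge> 2" "is_frobenius_function n f F"
  shows "frobenius_function n f = F"
proof -
  have "frobenius_function n f = (THE F. is_frobenius_function n f F)"
    by (simp add: frobenius_function_def is_frobenius_function_def frob_def)
  also have "\<dots> = F"
    using assms is_frobenius_function_unique by (intro the_equality) blast+
  finally show ?thesis .
qed

text \<open>Cross-multiplied form of \<beta> = (a \<alpha> + b) / (c \<alpha> + d), free of
  division. For \<alpha> outside F_q the denominator never vanishes.\<close>

definition moebius_rel :: "'a::finite_field alg_closure \<Rightarrow> 'a alg_closure \<Rightarrow> bool" where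
  "moebius_rel \<alpha> \<beta> \<longleftrightarrow> (\<exists>a b c d. a * d - b * c \<noteq> 0 \<and>
     \<beta> * (to_ac c * \<alpha> + to_ac d) = to_ac a * \<alpha> + to_ac b)"

lemma degree_1_ratfun:
  fixes a b c d :: "'a::finite_field"
  assumes "a * d - b * c \<noteq> 0"
  shows "lowest_terms (Fraction_Field.Fract [:b, a:] [:d, c:]) [:b, a:] [:d, c:]"
    "max (degree [:b, a:]) (degree [:d, c:]) = 1"
proof -
  have "coprime [:b, a:] [:d, c:]"
  proof (rule coprimeI)
    fix w assume w: "w dvd [:b, a:]" "w dvd [:d, c:]"
    have "w dvd Polynomial.smult a [:d, c:] - Polynomial.smult c [:b, a:]"
      using w by (intro dvd_diff dvd_smult)
    also have "Polynomial.smult a [:d, c:] - Polynomial.smult c [:b, a:] = [:a * d - b * c:]"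
      by (simp add: mult.commute)
    finally show "w dvd 1" using assms dvd_trans is_unit_const_poly_iff
      by (metis dvd_field_iff)
  qed
  then show "lowest_terms (Fraction_Field.Fract [:b, a:] [:d, c:]) [:b, a:] [:d, c:]"
    using assms by (auto simp: lowest_terms_def)
  show "max (degree [:b, a:]) (degree [:d, c:]) = 1" using assms by auto
qed

text \<open>For odd n > 1 the degree bound (n - 1) / 2 is at least 1, so a degree-1 map over F_q
  that sends \<alpha> to \<alpha>^q is the Frobenius function by uniqueness.\<close>

lemma frobenius_degree_1_iff:
  assumes f: "f \<in> place_forms n" and n: "odd n" "n > 1" and \<alpha>: "form_root f \<alpha>"
  shows "ratfun_degree (frobenius_function n f) = 1 \<longleftrightarrow> moebius_rel \<alpha> (frob \<alpha>)"
proof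
  have n2: "n \<ge> 2" using n by simp
  have n3: "1 \<le> (n - 1) div 2" using n by (auto elim!: oddE)
  {
    assume d1: "ratfun_degree (frobenius_function n f) = 1"
    obtain F where F: "is_frobenius_function n f F"
      using is_frobenius_function_exists[OF f n2 n(1)] .
    then have FF: "frobenius_function n f = F" by (rule frobenius_function_eqI[OF f n2])
    obtain P Q where PQ: "lowest_terms F P Q" by (rule lowest_terms_exists)
    have deg: "max (degree P) (degree Q) = 1" using d1 by (simp add: FF ratfun_degree_eq[OF PQ])
    have lin: "\<exists>a b. R = [:b, a:]" if "degree R \<le> 1" for R :: "'a poly"
      using that by (intro exI[of _ "coeff R 1"] exI[of _ "coeff R 0"] poly_eqI)
        (auto simp: coeff_pCons coeff_eq_0 split: nat.split)
    obtain a b c d where ab: "P = [:b, a:]" and cd: "Q = [:d, c:]"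
      using lin[of P] lin[of Q] deg by (metis max.cobounded1 max.cobounded2)
    have eq: "eval_ac P \<alpha> = frob \<alpha> * eval_ac Q \<alpha>"
      using F \<alpha> frob_value_iff[OF PQ] by (auto simp: is_frobenius_function_def)
    \<comment> \<open>A vanishing determinant makes P and Q proportional; one that is not constant
      would then divide both, against coprimality.\<close>
    have "a * d - b * c \<noteq> 0"
    proof
      assume z: "a * d - b * c = 0"
      have cop: "coprime P Q" using PQ by (simp add: lowest_terms_def)
      have ac: "a \<noteq> 0 \<or> c \<noteq> 0" using deg by (auto simp: ab cd)
      define w where "w = (if a \<noteq> 0 then P else Q)"
      have "w dvd P \<and> w dvd Q"
      proof (cases "a = 0")
        case True
        then have "P = 0" using z ac by (auto simp: ab)
        then show ?thesis using True by (simp add: w_def)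
      next
        case False
        have "Q = Polynomial.smult (c / a) P" using False z by (simp add: ab cd field_simps)
        then show ?thesis using False by (simp add: w_def dvd_smult)
      qed
      then have "w dvd 1" using coprime_common_divisor[OF cop] by blast
      then have "degree w = 0" by (simp add: field_poly_is_unit_iff)
      then show False using ac by (auto simp: w_def ab cd split: if_splits)
    qed
    then show "moebius_rel \<alpha> (frob \<alpha>)"
      unfolding moebius_rel_def using eq
      by (intro exI[of _ a] exI[of _ b] exI[of _ c] exI[of _ d]) (simp add: ab cd algebra_simps)
  }
  assume "moebius_rel \<alpha> (frob \<alpha>)"
  then obtain a b c d where abcd: "a * d - b * c \<noteq> 0"
    "frob \<alpha> * (to_ac c * \<alpha> + to_ac d) = to_ac a * \<alpha> + to_ac b"
    unfolding moebius_rel_def by blast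
  note r = degree_1_ratfun[OF abcd(1)]
  have "is_frobenius_function n f (Fraction_Field.Fract [:b, a:] [:d, c:])"
    using r(2) n3 abcd(2) by (intro is_frobenius_functionI[OF f n2 \<alpha> r(1)]) (auto simp: algebra_simps)
  then have "frobenius_function n f = Fraction_Field.Fract [:b, a:] [:d, c:]"
    by (rule frobenius_function_eqI[OF f n2])
  then show "ratfun_degree (frobenius_function n f) = 1"
    using r(2) by (simp only: ratfun_degree_eq[OF r(1)])
qed

definition frob_moebius :: "nat \<Rightarrow> 'a::finite_field alg_closure set" where
  "frob_moebius n = {\<alpha>. conj_degree n \<alpha> \<and> moebius_rel \<alpha> (frob \<alpha>)}"

lemma divisor_in_places_frob_deg_1:
  assumes "f \<in> place_forms n" "odd n" "n > 1" "form_root f \<alpha>" "\<alpha> \<in> frob_moebius n"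
  shows "divisor f \<in> places_frob_deg n 1"
  using assms frobenius_degree_1_iff[of f n \<alpha>] by (auto simp: places_frob_deg_def frob_moebius_def)

lemma places_frob_deg_1:
  assumes "odd n" "n > 1"
  shows "places_frob_deg n 1 = orbit_divisor n ` frob_moebius n"
proof (intro antisym subsetI)
  have n2: "n \<ge> 2" using assms by simp
  fix D :: "'a alg_closure point multiset"
  {
    assume "D \<in> places_frob_deg n 1"
    then obtain f where f: "f \<in> place_forms n" "ratfun_degree (frobenius_function n f) = 1" "D = divisor f"
      by (auto simp: places_frob_deg_def)
    obtain \<alpha> where \<alpha>: "form_root f \<alpha>" using place_forms_root_exists[OF f(1) n2] .
    have "\<alpha> \<in> frob_moebius n"
      using f(2) frobenius_degree_1_iff[OF f(1) assms \<alpha>] place_forms_root(1)[OF f(1) n2 \<alpha>]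
      by (simp add: frob_moebius_def)
    then show "D \<in> orbit_divisor n ` frob_moebius n"
      using divisor_eq_orbit_divisor[OF f(1) n2 \<alpha>] f(3) by blast
  next
    assume "D \<in> orbit_divisor n ` frob_moebius n"
    then obtain \<alpha> where \<alpha>: "\<alpha> \<in> frob_moebius n" "D = orbit_divisor n \<alpha>" by blast
    then have "conj_degree n \<alpha>" by (simp add: frob_moebius_def)
    note h = homogenize_min_poly[OF this]
    show "D \<in> places_frob_deg n 1"
      using divisor_in_places_frob_deg_1[OF h(1) assms h(2) \<alpha>(1)]
        divisor_eq_orbit_divisor[OF h(1) n2 h(2)] \<alpha>(2) by simp
  }
qed


section \<open>The action of the projective linear group\<close>

lemma moebius_relI:
  "a * d - b * c \<noteq> 0 \<Longrightarrow> \<beta> * (to_ac c * \<alpha> + to_ac d) = to_ac a * \<alpha> + to_ac b \<Longrightarrow> moebius_rel \<alpha> \<beta>"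
  unfolding moebius_rel_def by blast

lemma moebius_rel_refl: "moebius_rel \<alpha> \<alpha>"
  by (rule moebius_relI[of 1 1 0 0]) auto

lemma moebius_rel_sym:
  assumes "moebius_rel \<alpha> \<beta>"
  shows "moebius_rel \<beta> \<alpha>"
proof -
  obtain a b c d where *: "a * d - b * c \<noteq> 0"
    "\<beta> * (to_ac c * \<alpha> + to_ac d) = to_ac a * \<alpha> + to_ac b"
    using assms unfolding moebius_rel_def by blast
  show ?thesis
    by (rule moebius_relI[of d a "- b" "- c"]) (use * in \<open>auto simp: algebra_simps\<close>)
qed

lemma moebius_rel_trans:
  assumes "moebius_rel \<alpha> \<beta>" "moebius_rel \<beta> \<gamma>"
  shows "moebius_rel \<alpha> \<gamma>"
proof -
  obtain a b c d where *: "a * d - b * c \<noteq> 0"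
    "\<beta> * (to_ac c * \<alpha> + to_ac d) = to_ac a * \<alpha> + to_ac b"
    using assms unfolding moebius_rel_def by blast
  obtain a' b' c' d' where **: "a' * d' - b' * c' \<noteq> 0"
    "\<gamma> * (to_ac c' * \<beta> + to_ac d') = to_ac a' * \<beta> + to_ac b'"
    using assms unfolding moebius_rel_def by blast
  show ?thesis
  proof (rule moebius_relI)
    have "(a' * a + b' * c) * (c' * b + d' * d) - (a' * b + b' * d) * (c' * a + d' * c)
      = (a * d - b * c) * (a' * d' - b' * c')" by (simp add: algebra_simps)
    then show "(a' * a + b' * c) * (c' * b + d' * d) - (a' * b + b' * d) * (c' * a + d' * c) \<noteq> 0"
      using * ** by simp
    have "\<gamma> * (to_ac c' * (to_ac a * \<alpha> + to_ac b) + to_ac d' * (to_ac c * \<alpha> + to_ac d))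
        = \<gamma> * (to_ac c' * \<beta> + to_ac d') * (to_ac c * \<alpha> + to_ac d)"
      unfolding *(2)[symmetric] by (simp add: algebra_simps)
    also have "\<dots> = to_ac a' * (to_ac a * \<alpha> + to_ac b) + to_ac b' * (to_ac c * \<alpha> + to_ac d)"
      unfolding *(2)[symmetric] ** by (simp add: algebra_simps)
    finally show "\<gamma> * (to_ac (c' * a + d' * c) * \<alpha> + to_ac (c' * b + d' * d))
      = to_ac (a' * a + b' * c) * \<alpha> + to_ac (a' * b + b' * d)"
      by (simp add: algebra_simps)
  qed
qed

text \<open>The coefficients lie in F_q and are fixed by Frobenius; that the group action commutes
  with Frobenius rests on this.\<close>

lemma moebius_eq_frob:
  assumes "\<beta> * (to_ac c * \<alpha> + to_ac d) = to_ac a * \<alpha> + to_ac b"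
  shows "(frob ^^ i) \<beta> * (to_ac c * (frob ^^ i) \<alpha> + to_ac d) = to_ac a * (frob ^^ i) \<alpha> + to_ac b"
  using arg_cong[OF assms, of "frob ^^ i"] by simp

lemma moebius_rel_frob:
  assumes "moebius_rel \<alpha> \<beta>"
  shows "moebius_rel ((frob ^^ i) \<alpha>) ((frob ^^ i) \<beta>)"
  using assms moebius_eq_frob unfolding moebius_rel_def by metis

lemma moebius_rel_funpow_frob:
  assumes "moebius_rel \<alpha> (frob \<alpha>)"
  shows "moebius_rel \<alpha> ((frob ^^ i) \<alpha>)"
proof (induction i)
  case (Suc i)
  then show ?case
    using moebius_rel_trans[OF Suc moebius_rel_frob[OF assms, of i]] by (simp add: funpow_swap1)
qed (simp add: moebius_rel_refl)

lemma moebius_denominator: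
  assumes "\<alpha> \<notin> range to_ac" "a * d - b * c \<noteq> 0"
  shows "to_ac c * \<alpha> + to_ac d \<noteq> 0"
proof
  assume eq: "to_ac c * \<alpha> + to_ac d = 0"
  show False
  proof (cases "c = 0")
    case False
    then have "\<alpha> = to_ac (- d / c)" using eq by (simp add: field_simps eq_neg_iff_add_eq_0)
    with assms show False by blast
  qed (use eq assms in auto)
qed

text \<open>A Moebius map over F_q is injective and commutes with Frobenius, so it preserves the
  length of the orbit.\<close>

lemma moebius_rel_conj_degree:
  assumes \<alpha>: "conj_degree n \<alpha>" "n > 1" and rel: "moebius_rel \<alpha> \<beta>"
  shows "conj_degree n \<beta>"
proof (rule conj_degreeI)
  show "0 < n" using \<alpha> by simp
  obtain a b c d where *: "a * d - b * c \<noteq> 0"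
    "\<beta> * (to_ac c * \<alpha> + to_ac d) = to_ac a * \<alpha> + to_ac b"
    using rel unfolding moebius_rel_def by blast
  note den = moebius_denominator[OF conj_degree_notin_range[OF \<alpha>] *(1)]
  \<comment> \<open>The identity (a - c \<beta>) (c \<alpha> + d) = a d - b c shows that the inverse
    map has no pole at \<beta>.\<close>
  have "(to_ac a - to_ac c * \<beta>) * (to_ac c * \<alpha> + to_ac d) =
      to_ac a * (to_ac c * \<alpha> + to_ac d) - to_ac c * (\<beta> * (to_ac c * \<alpha> + to_ac d))"
    by (simp add: algebra_simps)
  also have "\<dots> = to_ac (a * d - b * c)" unfolding *(2) by (simp add: algebra_simps)
  also have "\<dots> \<noteq> 0" using *(1) by (simp only: to_ac_eq_0_iff) simp
  finally have ne: "to_ac a - to_ac c * \<beta> \<noteq> 0" by auto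
  fix k
  have "(frob ^^ k) \<beta> = \<beta> \<longleftrightarrow> (frob ^^ k) \<alpha> = \<alpha>"
  proof
    assume "(frob ^^ k) \<beta> = \<beta>"
    then have "\<beta> * (to_ac c * (frob ^^ k) \<alpha> + to_ac d) = to_ac a * (frob ^^ k) \<alpha> + to_ac b"
      using moebius_eq_frob[OF *(2), of k] by simp
    then have "(to_ac a - to_ac c * \<beta>) * (frob ^^ k) \<alpha> = \<beta> * to_ac d - to_ac b"
      by (simp add: algebra_simps eq_diff_eq diff_eq_eq)
    also have "\<dots> = (to_ac a - to_ac c * \<beta>) * \<alpha>"
      using *(2) by (simp add: algebra_simps eq_diff_eq diff_eq_eq)
    finally show "(frob ^^ k) \<alpha> = \<alpha>" using ne by simp
  next
    assume "(frob ^^ k) \<alpha> = \<alpha>"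
    then have "(frob ^^ k) \<beta> * (to_ac c * \<alpha> + to_ac d) = \<beta> * (to_ac c * \<alpha> + to_ac d)"
      using moebius_eq_frob[OF *(2), of k] *(2) by simp
    with den show "(frob ^^ k) \<beta> = \<beta>" by simp
  qed
  then show "(frob ^^ k) \<beta> = \<beta> \<longleftrightarrow> n dvd k" by (simp add: conj_degree_fixed_iff[OF \<alpha>(1)])
qed

lemma moebius_rel_frob_moebius:
  assumes "\<alpha> \<in> frob_moebius n" "n > 1" "moebius_rel \<alpha> \<beta>"
  shows "\<beta> \<in> frob_moebius n"
proof -
  have "moebius_rel \<beta> (frob \<beta>)"
    using moebius_rel_trans[OF moebius_rel_trans[OF moebius_rel_sym[OF assms(3)]]
        moebius_rel_frob[OF assms(3), of 1]] assms(1)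
    by (simp add: frob_moebius_def)
  then show ?thesis
    using moebius_rel_conj_degree[OF _ assms(2,3)] assms(1) by (simp add: frob_moebius_def)
qed

section \<open>The group PGL_2(F_q) and its action on divisors\<close>

lemma invertible_mat_1: "invertible (mat 1 :: 'a::finite_field^2^2)"
  unfolding invertible_def by (intro exI[of _ "mat 1"]) simp

lemma group_GL2: "group (GL2 :: ('a::finite_field^2^2) monoid)"
proof (rule groupI)
  fix A :: "'a^2^2" assume "A \<in> carrier GL2"
  then show "\<exists>B\<in>carrier GL2. B \<otimes>\<^bsub>GL2\<^esub> A = \<one>\<^bsub>GL2\<^esub>"
    by (auto simp: GL2_def invertible_def)
qed (auto simp: GL2_def invertible_mult matrix_mul_assoc invertible_mat_1)

abbreviation scalar_mats :: "('a::finite_field^2^2) set" where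
  "scalar_mats \<equiv> {mat c | c. c \<noteq> 0}"

lemma mat_mult_component: "(mat c ** A) $ i $ j = c * A $ i $ j"
  and mult_mat_component: "(A ** mat c) $ i $ j = A $ i $ j * c"
  for A :: "'a::finite_field^2^2"
  by (simp_all add: matrix_matrix_mult_def mat_def if_distrib if_distribR cong: if_cong)

lemma mat_mult_commute: "mat c ** A = A ** mat c" for A :: "'a::finite_field^2^2"
  by (simp add: vec_eq_iff mat_mult_component mult_mat_component mult.commute)

lemma mat_mult_mat: "mat c ** mat d = (mat (c * d) :: 'a::finite_field^2^2)"
  by (simp add: vec_eq_iff mat_mult_component) (simp add: mat_def)

lemma normal_scalar_mats: "scalar_mats \<lhd> (GL2 :: ('a::finite_field^2^2) monoid)"
proof -
  interpret group "GL2 :: ('a^2^2) monoid" by (rule group_GL2)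
  have inv: "invertible (mat c :: 'a^2^2)" if "c \<noteq> 0" for c
    unfolding invertible_def using that by (intro exI[of _ "mat (inverse c)"]) (simp add: mat_mult_mat)
  have "subgroup scalar_mats (GL2 :: ('a^2^2) monoid)"
  proof (rule subgroupI)
    show "scalar_mats \<subseteq> carrier (GL2 :: ('a^2^2) monoid)" using inv by (auto simp: GL2_def)
    show "scalar_mats \<noteq> ({} :: ('a^2^2) set)" by (auto intro: exI[of _ 1])
    fix A B :: "'a^2^2" assume "A \<in> scalar_mats"
    then obtain c where c: "A = mat c" "c \<noteq> 0" by auto
    have "inv\<^bsub>GL2\<^esub> A = mat (inverse c)"
      using c inv[of c] inv[of "inverse c"] by (intro inv_equality) (auto simp: GL2_def mat_mult_mat)
    then show "inv\<^bsub>GL2\<^esub> A \<in> scalar_mats" using c(2) by (auto intro!: exI[of _ "inverse c"])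
    assume "B \<in> scalar_mats"
    then show "A \<otimes>\<^bsub>GL2\<^esub> B \<in> scalar_mats" using c
      by (auto simp: GL2_def mat_mult_mat intro: exI[of _ "c * _"])
  qed
  then show ?thesis
    by (rule normalI) (auto simp: r_coset_def l_coset_def GL2_def mat_mult_commute)
qed

lemma group_PGL2: "group (PGL2 :: ('a::finite_field^2^2) set monoid)"
  unfolding PGL2_def by (rule normal.factorgroup_is_group[OF normal_scalar_mats])

abbreviation proj_class :: "'a::finite_field^2^2 \<Rightarrow> ('a^2^2) set" where
  "proj_class A \<equiv> scalar_mats #>\<^bsub>GL2\<^esub> A"

lemma carrier_PGL2: "carrier PGL2 = proj_class ` {A. invertible A}"
  by (simp add: PGL2_def carrier_FactGroup) (simp add: GL2_def)

lemma proj_class_eq: "proj_class A = {mat c ** A | c. c \<noteq> 0}"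
  by (auto simp: r_coset_def GL2_def)

lemma matrix_act_mult: "matrix_act (A ** B) P = matrix_act A (matrix_act B P)"
  by (cases P) (simp add: matrix_act_def matrix_matrix_mult_def sum_2 algebra_simps)

lemma point_act_mult:
  "point_act (C \<otimes>\<^bsub>PGL2\<^esub> D) P = point_act C (point_act D P)"
  by (simp add: PGL2_def point_act_def set_mult_def GL2_def matrix_act_mult image_image image_UN)
    blast

lemma point_act_proj_class:
  "point_act (proj_class A) (proj_point u v) =
    proj_point (to_ac (A $ 1 $ 1) * u + to_ac (A $ 1 $ 2) * v) (to_ac (A $ 2 $ 1) * u + to_ac (A $ 2 $ 2) * v)"
    (is "?L = proj_point ?x ?y")
proof -
  have act: "matrix_act (mat c ** A) (k * u, k * v) = ((to_ac c * k) * ?x, (to_ac c * k) * ?y)" for c k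
    by (simp add: matrix_act_def mat_mult_component algebra_simps)
  show ?thesis
  proof (intro antisym subsetI)
    fix w assume "w \<in> ?L"
    then obtain c k where "c \<noteq> 0" "k \<noteq> 0" "w = matrix_act (mat c ** A) (k * u, k * v)"
      by (auto simp: point_act_def proj_class_eq proj_point_def)
    then show "w \<in> proj_point ?x ?y" unfolding act proj_point_def
      by (auto intro!: exI[of _ "to_ac c * k"])
  next
    fix w assume "w \<in> proj_point ?x ?y"
    then obtain k where k: "k \<noteq> 0" "w = (k * ?x, k * ?y)" by (auto simp: proj_point_def)
    then have "w = matrix_act (mat 1 ** A) (k * u, k * v)" unfolding act by simp
    moreover have "mat 1 ** A \<in> proj_class A" unfolding proj_class_eq by (auto intro!: exI[of _ 1])
    moreover have "(k * u, k * v) \<in> proj_point u v" using k by (auto simp: proj_point_def)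
    ultimately show "w \<in> ?L" unfolding point_act_def by blast
  qed
qed

lemma invertible_2_iff: "invertible A \<longleftrightarrow> A $ 1 $ 1 * A $ 2 $ 2 - A $ 1 $ 2 * A $ 2 $ 1 \<noteq> 0"
  for A :: "'a::field^2^2"
  by (simp add: invertible_det_nz det_2)

text \<open>The matrix acts compatibly with Frobenius, so the i-th conjugate of \<alpha> goes to the
  i-th conjugate of \<beta>.\<close>

lemma act_orbit_divisor:
  assumes A: "invertible A" and \<alpha>: "conj_degree n \<alpha>" "n > 1"
    and \<beta>: "\<beta> * (to_ac (A $ 2 $ 1) * \<alpha> + to_ac (A $ 2 $ 2)) = to_ac (A $ 1 $ 1) * \<alpha> + to_ac (A $ 1 $ 2)"
  shows "image_mset (point_act (proj_class A)) (orbit_divisor n \<alpha>) = orbit_divisor n \<beta>"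
proof -
  have "point_act (proj_class A) (proj_point ((frob ^^ i) \<alpha>) 1) = proj_point ((frob ^^ i) \<beta>) 1" for i
  proof -
    have "to_ac (A $ 2 $ 1) * (frob ^^ i) \<alpha> + to_ac (A $ 2 $ 2) \<noteq> 0"
      by (rule moebius_denominator[OF conj_degree_notin_range[OF conj_degree_frob[OF \<alpha>(1)] \<alpha>(2)]])
        (use A in \<open>simp add: invertible_2_iff\<close>)
    then show ?thesis
      using moebius_eq_frob[OF \<beta>, of i]
      by (simp add: point_act_proj_class proj_point_eq_iff eq_commute[of _ "proj_point _ 1"])
  qed
  then show ?thesis by (simp add: orbit_divisor_def image_mset.compositionality comp_def)
qed

lemma proj_class_orbit_divisor:
  assumes A: "invertible A" and \<alpha>: "conj_degree n \<alpha>" "n > 1"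
  obtains \<beta> where "moebius_rel \<alpha> \<beta>"
    "image_mset (point_act (proj_class A)) (orbit_divisor n \<alpha>) = orbit_divisor n \<beta>"
proof -
  define \<beta> where "\<beta> = (to_ac (A $ 1 $ 1) * \<alpha> + to_ac (A $ 1 $ 2)) / (to_ac (A $ 2 $ 1) * \<alpha> + to_ac (A $ 2 $ 2))"
  have det: "A $ 1 $ 1 * A $ 2 $ 2 - A $ 1 $ 2 * A $ 2 $ 1 \<noteq> 0"
    using A by (simp add: invertible_2_iff)
  have "to_ac (A $ 2 $ 1) * \<alpha> + to_ac (A $ 2 $ 2) \<noteq> 0"
    by (rule moebius_denominator[OF conj_degree_notin_range[OF \<alpha>] det])
  then have \<beta>: "\<beta> * (to_ac (A $ 2 $ 1) * \<alpha> + to_ac (A $ 2 $ 2)) = to_ac (A $ 1 $ 1) * \<alpha> + to_ac (A $ 1 $ 2)"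
    by (simp add: \<beta>_def)
  show ?thesis
    by (rule that[OF moebius_relI[OF det \<beta>] act_orbit_divisor[OF A \<alpha> \<beta>]])
qed

text \<open>Bijectivity of each map comes from the action of the inverse element; extensionality
  makes the maps elements of \<open>BijGroup E\<close>.\<close>

lemma group_actionI:
  assumes G: "group G"
    and cl: "\<And>g x. g \<in> carrier G \<Longrightarrow> x \<in> E \<Longrightarrow> \<phi> g x \<in> E"
    and ext: "\<And>g. g \<in> carrier G \<Longrightarrow> \<phi> g \<in> extensional E"
    and mult: "\<And>g h x. g \<in> carrier G \<Longrightarrow> h \<in> carrier G \<Longrightarrow> x \<in> E \<Longrightarrow> \<phi> (g \<otimes>\<^bsub>G\<^esub> h) x = \<phi> g (\<phi> h x)"
    and one: "\<And>x. x \<in> E \<Longrightarrow> \<phi> \<one>\<^bsub>G\<^esub> x = x"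
  shows "group_action G E \<phi>"
proof -
  interpret group G by (rule G)
  have Bij: "\<phi> g \<in> Bij E" if g: "g \<in> carrier G" for g
  proof -
    have "bij_betw (\<phi> g) E E"
    proof (rule bij_betw_byWitness[of _ "\<phi> (inv\<^bsub>G\<^esub> g)"])
      show "\<forall>x\<in>E. \<phi> (inv\<^bsub>G\<^esub> g) (\<phi> g x) = x" "\<forall>x\<in>E. \<phi> g (\<phi> (inv\<^bsub>G\<^esub> g) x) = x"
        using g mult[of "inv\<^bsub>G\<^esub> g" g] mult[of g "inv\<^bsub>G\<^esub> g"] one by simp_all
    qed (use g cl in auto)
    then show ?thesis using ext[OF g] by (simp add: Bij_def)
  qed
  have "\<phi> (g \<otimes>\<^bsub>G\<^esub> h) = compose E (\<phi> g) (\<phi> h)" if "g \<in> carrier G" "h \<in> carrier G" for g h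
    using that ext[of "g \<otimes>\<^bsub>G\<^esub> h"] mult by (intro extensionalityI[of _ E]) (auto simp: compose_def)
  then have "\<phi> \<in> hom G (BijGroup E)"
    using Bij by (auto simp: hom_def BijGroup_def)
  then show ?thesis
    by (simp add: group_action_def group_hom_def group_hom_axioms_def group_BijGroup G)
qed

lemma group_action_PGL2:
  assumes n: "odd n" "n > 1"
  shows "group_action (PGL2 :: ('a::finite_field^2^2) set monoid)
    (places_frob_deg n 1) (divisor_act (places_frob_deg n 1))"
proof (rule group_actionI[OF group_PGL2])
  let ?E = "places_frob_deg n 1 :: 'a alg_closure point multiset set"
  have cl: "image_mset (point_act C) D \<in> ?E" if C: "C \<in> carrier PGL2" and D: "D \<in> ?E" for C D
  proof -
    obtain A where A: "C = proj_class A" "invertible A" using C by (auto simp: carrier_PGL2)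
    obtain \<alpha> where \<alpha>: "\<alpha> \<in> frob_moebius n" "D = orbit_divisor n \<alpha>"
      using D by (auto simp: places_frob_deg_1[OF n, unfolded One_nat_def])
    then have "conj_degree n \<alpha>" by (simp add: frob_moebius_def)
    then obtain \<beta> where "moebius_rel \<alpha> \<beta>" "image_mset (point_act C) D = orbit_divisor n \<beta>"
      using proj_class_orbit_divisor[OF A(2) _ n(2)] A(1) \<alpha>(2) by blast
    with moebius_rel_frob_moebius[OF \<alpha>(1) n(2)] show ?thesis by (simp add: places_frob_deg_1[OF n, unfolded One_nat_def])
  qed
  fix C D :: "('a^2^2) set" and x assume x: "x \<in> ?E"
  {
    assume C: "C \<in> carrier PGL2"
    show "divisor_act ?E C x \<in> ?E" using cl[OF C x] x by (simp add: divisor_act_def)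
    assume D: "D \<in> carrier PGL2"
    show "divisor_act ?E (C \<otimes>\<^bsub>PGL2\<^esub> D) x = divisor_act ?E C (divisor_act ?E D x)"
      using x cl[OF D x] point_act_mult[of C D, abs_def]
      by (simp add: divisor_act_def image_mset.compositionality comp_def)
  }
  obtain \<alpha> where \<alpha>: "x = orbit_divisor n \<alpha>" "conj_degree n \<alpha>"
    using x by (auto simp: places_frob_deg_1[OF n, unfolded One_nat_def] frob_moebius_def)
  have "\<one>\<^bsub>PGL2\<^esub> = proj_class (mat 1 :: 'a^2^2)"
    unfolding proj_class_eq by (simp add: PGL2_def)
  moreover have "image_mset (point_act (proj_class (mat 1))) (orbit_divisor n \<alpha>) = orbit_divisor n \<alpha>"
    by (rule act_orbit_divisor[OF _ \<alpha>(2) n(2)]) (simp_all add: invertible_mat_1, simp_all add: mat_def)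
  ultimately show "divisor_act ?E \<one>\<^bsub>PGL2\<^esub> x = x" using x by (simp add: divisor_act_def \<alpha>(1))
next
  fix C :: "('a^2^2) set"
  show "divisor_act (places_frob_deg n 1) C \<in> extensional (places_frob_deg n 1)"
    by (simp add: divisor_act_def)
qed

lemma orbit_divisor_orbit_iff:
  fixes \<alpha> \<beta> :: "'a::finite_field alg_closure" and n :: nat
  defines "E \<equiv> places_frob_deg n 1 :: 'a alg_closure point multiset set"
  assumes n: "odd n" "n > 1" and \<alpha>: "\<alpha> \<in> frob_moebius n" and \<beta>: "\<beta> \<in> frob_moebius n"
  shows "orbit_divisor n \<beta> \<in> orbit PGL2 (divisor_act E) (orbit_divisor n \<alpha>) \<longleftrightarrow> moebius_rel \<alpha> \<beta>"
proof
  have E: "orbit_divisor n \<alpha> \<in> E" using \<alpha> by (simp add: E_def places_frob_deg_1[OF n, unfolded One_nat_def])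
  have c: "conj_degree n \<alpha>" using \<alpha> by (simp add: frob_moebius_def)
  {
    assume "orbit_divisor n \<beta> \<in> orbit PGL2 (divisor_act E) (orbit_divisor n \<alpha>)"
    then obtain A where A: "invertible A"
      "orbit_divisor n \<beta> = image_mset (point_act (proj_class A)) (orbit_divisor n \<alpha>)"
      using E by (auto simp: orbit_def carrier_PGL2 divisor_act_def)
    obtain \<beta>' where \<beta>': "moebius_rel \<alpha> \<beta>'" "orbit_divisor n \<beta> = orbit_divisor n \<beta>'"
      using proj_class_orbit_divisor[OF A(1) c n(2)] A(2) by metis
    have "proj_point ((frob ^^ 0) \<beta>) 1 \<in> set_mset (orbit_divisor n \<beta>)"
      using n(2) unfolding orbit_divisor_def set_image_mset
      by (intro image_eqI[where x = 0]) auto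
    then obtain i where "proj_point \<beta> 1 = proj_point ((frob ^^ i) \<beta>') 1"
      unfolding \<beta>'(2) by (auto simp: orbit_divisor_def)
    \<comment> \<open>Equal divisors only show that \<beta> and \<beta>' are conjugate. This is
      where Frobenius degree 1 enters: conjugates are then Moebius equivalent.\<close>
    then have i: "\<beta> = (frob ^^ i) \<beta>'" by (simp add: proj_point_eq_iff)
    have "moebius_rel \<beta>' (frob \<beta>')"
      using moebius_rel_frob_moebius[OF \<alpha> n(2) \<beta>'(1)] by (simp add: frob_moebius_def)
    then show "moebius_rel \<alpha> \<beta>"
      unfolding i by (rule moebius_rel_trans[OF \<beta>'(1) moebius_rel_funpow_frob])
  }
  assume "moebius_rel \<alpha> \<beta>"
  then obtain a b c' d where *: "a * d - b * c' \<noteq> 0"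
    "\<beta> * (to_ac c' * \<alpha> + to_ac d) = to_ac a * \<alpha> + to_ac b"
    unfolding moebius_rel_def by blast
  define A :: "'a^2^2" where "A = vector [vector [a, b], vector [c', d]]"
  have comps: "A $ 1 $ 1 = a" "A $ 1 $ 2 = b" "A $ 2 $ 1 = c'" "A $ 2 $ 2 = d"
    by (simp_all add: A_def vector_2)
  have A: "invertible A" using *(1) by (simp add: invertible_2_iff comps)
  have "divisor_act E (proj_class A) (orbit_divisor n \<alpha>) = orbit_divisor n \<beta>"
    using act_orbit_divisor[OF A c n(2), of \<beta>] *(2) E by (simp add: comps divisor_act_def)
  moreover have "proj_class A \<in> carrier PGL2" using A by (simp add: carrier_PGL2)
  ultimately show "orbit_divisor n \<beta> \<in> orbit PGL2 (divisor_act E) (orbit_divisor n \<alpha>)"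
    unfolding orbit_def by force
qed

text \<open>Common frame of the three cases. What it leaves to each of them is a statement about
  roots: every \<alpha> is equivalent to some \<open>r i\<close>, and different indices give
  inequivalent roots.\<close>

lemma complete_unique_reps_places:
  fixes f :: "'i \<Rightarrow> 'a::finite_field poly poly" and r :: "'i \<Rightarrow> 'a alg_closure"
  assumes n: "odd n" "n > 1"
    and f: "\<And>i. i \<in> I \<Longrightarrow> f i \<in> place_forms n" "\<And>i. i \<in> I \<Longrightarrow> form_root (f i) (r i)"
    and r: "\<And>i. i \<in> I \<Longrightarrow> r i \<in> frob_moebius n"
    and ex: "\<And>\<alpha>. \<alpha> \<in> frob_moebius n \<Longrightarrow> \<exists>i\<in>I. moebius_rel \<alpha> (r i)"
    and unique: "\<And>i j. i \<in> I \<Longrightarrow> j \<in> I \<Longrightarrow> moebius_rel (r i) (r j) \<Longrightarrow> i = j"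
  shows "complete_unique_reps (PGL2 :: ('a^2^2) set monoid) (places_frob_deg n 1)
    (divisor_act (places_frob_deg n 1)) (divisor ` f ` I)"
  unfolding complete_unique_reps_def
proof (intro conjI ballI)
  have n2: "n \<ge> 2" using n by simp
  have div: "divisor (f i) = orbit_divisor n (r i)" if "i \<in> I" for i
    using divisor_eq_orbit_divisor[OF f(1) n2 f(2)] that by simp
  let ?E = "places_frob_deg n 1 :: 'a alg_closure point multiset set"
  show "group_action (PGL2 :: ('a^2^2) set monoid) ?E (divisor_act ?E)"
    by (rule group_action_PGL2[OF n])
  show "divisor ` f ` I \<subseteq> ?E" using div r by (auto simp: places_frob_deg_1[OF n, unfolded One_nat_def])
  fix B assume "B \<in> orbits PGL2 ?E (divisor_act ?E)"
  then obtain \<alpha> where \<alpha>: "\<alpha> \<in> frob_moebius n"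
    and B: "B = orbit PGL2 (divisor_act ?E) (orbit_divisor n \<alpha>)"
    by (auto simp: orbits_def places_frob_deg_1[OF n, unfolded One_nat_def])
  have mem: "divisor (f i) \<in> B \<longleftrightarrow> moebius_rel \<alpha> (r i)" if "i \<in> I" for i
    using orbit_divisor_orbit_iff[OF n \<alpha> r[OF that]] by (simp add: B div that)
  obtain i where i: "i \<in> I" "moebius_rel \<alpha> (r i)" using ex[OF \<alpha>] by blast
  show "\<exists>!D. D \<in> divisor ` f ` I \<and> D \<in> B"
  proof (rule ex1I[of _ "divisor (f i)"])
    show "divisor (f i) \<in> divisor ` f ` I \<and> divisor (f i) \<in> B" using i mem by simp
    fix D assume "D \<in> divisor ` f ` I \<and> D \<in> B"
    then obtain j where j: "j \<in> I" "D = divisor (f j)" "moebius_rel \<alpha> (r j)" using mem by auto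
    have "moebius_rel (r i) (r j)" using moebius_rel_trans[OF moebius_rel_sym[OF i(2)] j(3)] .
    then show "D = divisor (f i)" using unique i j by blast
  qed
qed


section \<open>Moebius transformations that act as Frobenius\<close>

definition cross_ratio :: "'k::field \<Rightarrow> 'k \<Rightarrow> 'k \<Rightarrow> 'k \<Rightarrow> 'k" where
  "cross_ratio x0 x1 x2 x3 = ((x0 - x2) * (x1 - x3)) / ((x0 - x1) * (x2 - x3))"

text \<open>Each difference is multiplied by (a d - b c) / (D i * D j), with \<open>D i\<close> the
  denominator at \<open>x i\<close>; every index occurs once above and once below in the cross
  ratio, so all factors cancel.\<close>

lemma cross_ratio_moebius:
  fixes x y :: "nat \<Rightarrow> 'k::field"
  assumes det: "a * d - b * c \<noteq> 0"
    and y: "\<And>i. y i * (c * x i + d) = a * x i + b" and den: "\<And>i. c * x i + d \<noteq> 0"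
  shows "cross_ratio (y 0) (y 1) (y 2) (y 3) = cross_ratio (x 0) (x 1) (x 2) (x 3)"
proof -
  define D where "D i = c * x i + d" for i
  have diff: "y i - y j = (a * d - b * c) * (x i - x j) / (D i * D j)" for i j
  proof -
    have "(y i - y j) * (D i * D j) = (y i * D i) * D j - (y j * D j) * D i"
      by (simp add: algebra_simps)
    also have "\<dots> = (a * d - b * c) * (x i - x j)"
      using y by (simp add: D_def algebra_simps)
    finally have "(y i - y j) * (D i * D j) = (a * d - b * c) * (x i - x j)" .
    moreover have "D i * D j \<noteq> 0" using den by (simp add: D_def)
    ultimately show ?thesis by (metis nonzero_mult_div_cancel_right)
  qed
  have nz: "D i \<noteq> 0" for i using den by (simp add: D_def)
  show ?thesis
    unfolding cross_ratio_def diff using det nz by (simp add: divide_simps)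
qed

lemma cross_ratio_geometric:
  fixes x e :: "'k::field"
  assumes "x \<noteq> 0" "e \<noteq> 0" "e \<noteq> 1"
  shows "cross_ratio x (x * e) (x * e ^ 2) (x * e ^ 3) = (1 + e) ^ 2 / e"
proof -
  define k where "k = x * x * e * (1 - e) * (1 - e)"
  have "k \<noteq> 0" using assms by (simp add: k_def)
  have "(x - x * e ^ 2) * (x * e - x * e ^ 3) = k * (1 + e) ^ 2"
    by (simp add: k_def algebra_simps power2_eq_square power3_eq_cube)
  moreover have "(x - x * e) * (x * e ^ 2 - x * e ^ 3) = k * e"
    by (simp add: k_def algebra_simps power2_eq_square power3_eq_cube)
  ultimately show ?thesis using \<open>k \<noteq> 0\<close> by (simp add: cross_ratio_def)
qed

lemma geometric_invariant_eqD:
  fixes e e' :: "'k::field"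
  assumes "(1 + e) ^ 2 / e = (1 + e') ^ 2 / e'" "e \<noteq> 0" "e' \<noteq> 0"
  shows "e = e' \<or> e * e' = 1"
proof -
  have "(1 + e) ^ 2 * e' = (1 + e') ^ 2 * e" using assms by (simp add: field_simps)
  then have "(e' - e) * (1 - e * e') = 0" by (simp add: algebra_simps power2_eq_square)
  then show ?thesis by auto
qed

definition frob_cross_ratio :: "'a::finite_field alg_closure \<Rightarrow> 'a alg_closure" where
  "frob_cross_ratio \<alpha> =
     cross_ratio ((frob ^^ 0) \<alpha>) ((frob ^^ 1) \<alpha>) ((frob ^^ 2) \<alpha>) ((frob ^^ 3) \<alpha>)"

lemma frob_cross_ratio_cong:
  assumes \<alpha>: "conj_degree n \<alpha>" "n > 1" and rel: "moebius_rel \<alpha> \<beta>"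
  shows "frob_cross_ratio \<alpha> = frob_cross_ratio \<beta>"
proof -
  obtain a b c d where *: "a * d - b * c \<noteq> 0"
    "\<beta> * (to_ac c * \<alpha> + to_ac d) = to_ac a * \<alpha> + to_ac b"
    using rel unfolding moebius_rel_def by blast
  have "to_ac a * to_ac d - to_ac b * to_ac c = to_ac (a * d - b * c)" by simp
  also have "\<dots> \<noteq> 0" using *(1) by (simp only: to_ac_eq_0_iff) simp
  finally have det: "to_ac a * to_ac d - to_ac b * to_ac c \<noteq> 0" .
  have den: "to_ac c * (frob ^^ i) \<alpha> + to_ac d \<noteq> 0" for i
    by (rule moebius_denominator[OF conj_degree_notin_range[OF conj_degree_frob[OF \<alpha>(1)] \<alpha>(2)] *(1)])
  show ?thesis
    unfolding frob_cross_ratio_def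
    by (rule cross_ratio_moebius[OF det moebius_eq_frob[OF *(2)] den, symmetric])
qed

text \<open>Frobenius acts on \<alpha> as a matrix A over F_q, and the split is by a fixed point of
  A. If \<infinity> is fixed, the map is already affine; a fixed point in F_q is moved to
  \<infinity>; any other one is a root of a quadratic over F_q and lies in the field with q^2
  elements.\<close>

lemma frob_moebius_fixed_point_cases:
  assumes \<alpha>: "\<alpha> \<in> frob_moebius n" and n: "n > 1"
  obtains (rational) a b \<beta> where "moebius_rel \<alpha> \<beta>" "a \<noteq> 0" "frob \<beta> = to_ac a * \<beta> + to_ac b"
  | (irrational) a b c d r where "a * d - b * c \<noteq> 0"
      "frob \<alpha> * (to_ac c * \<alpha> + to_ac d) = to_ac a * \<alpha> + to_ac b"
      "r \<in> ext_field 2 - range to_ac" "r * (to_ac c * r + to_ac d) = to_ac a * r + to_ac b"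
proof -
  have cd: "conj_degree n \<alpha>" using \<alpha> by (simp add: frob_moebius_def)
  note nr = conj_degree_notin_range[OF cd n]
  obtain a b c d where *: "a * d - b * c \<noteq> 0"
    "frob \<alpha> * (to_ac c * \<alpha> + to_ac d) = to_ac a * \<alpha> + to_ac b"
    using \<alpha> unfolding frob_moebius_def moebius_rel_def by blast
  show ?thesis
  proof (cases "c = 0")
    case True
    then have "d \<noteq> 0" "a \<noteq> 0" using *(1) by auto
    then show ?thesis using * True
      by (intro rational[of \<alpha> "a / d" "b / d"] moebius_rel_refl) (auto simp: field_simps)
  next
    case c: False
    define P where "P = [:- to_ac b, to_ac d - to_ac a, to_ac c:]"
    have "degree P > 0" using c by (simp add: P_def)
    then obtain r where "poly P r = 0" using alg_closed_imp_poly_has_root by blast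
    then have r: "r * (to_ac c * r + to_ac d) = to_ac a * r + to_ac b"
      by (simp add: P_def algebra_simps)
    show ?thesis
    proof (cases "r \<in> range to_ac")
      case True
      then obtain r' where r': "r = to_ac r'" by blast
      have "to_ac b = to_ac (r' * (c * r' + d) - a * r')" using r by (simp add: r' algebra_simps)
      then have b: "b = r' * (c * r' + d) - a * r'" by (simp only: to_ac_eq_iff)
      \<comment> \<open>The two factors are the eigenvalues of A: c r' + d belongs to the vector
        (r', 1), and the other is the trace minus that.\<close>
      have det: "(a - r' * c) * (c * r' + d) = a * d - b * c" by (simp add: b algebra_simps)
      \<comment> \<open>Sends the fixed point r to \<infinity>, so that Frobenius becomes affine in
        \<beta>.\<close>
      define \<beta> where "\<beta> = 1 / (\<alpha> - r)"
      have ne: "\<alpha> - r \<noteq> 0" using nr r' by auto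
      have "moebius_rel \<alpha> \<beta>"
        by (rule moebius_relI[of 0 "- r'" 1 1]) (use ne in \<open>simp_all add: \<beta>_def r'\<close>)
      moreover have "(c * r' + d) / (a - r' * c) \<noteq> 0" using det *(1) by auto
      moreover have "frob \<beta> = to_ac ((c * r' + d) / (a - r' * c)) * \<beta> + to_ac (c / (a - r' * c))"
      proof -
        define k where "k = to_ac a - r * to_ac c"
        have "k = to_ac (a - r' * c)" by (simp add: k_def r')
        moreover have "a - r' * c \<noteq> 0" using det *(1) by auto
        ultimately have k: "k \<noteq> 0" by (simp only: to_ac_eq_0_iff) simp
        have "(frob \<alpha> - r) * (to_ac c * \<alpha> + to_ac d) = to_ac a * \<alpha> + to_ac b - r * (to_ac c * \<alpha> + to_ac d)"
          by (simp only: left_diff_distrib *(2))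
        also have "\<dots> = k * (\<alpha> - r)"
          by (simp add: b k_def r' algebra_simps)
        finally have eq: "(frob \<alpha> - r) * (to_ac c * \<alpha> + to_ac d) = k * (\<alpha> - r)" .
        have "frob (\<alpha> - r) \<noteq> 0" using ne by (simp only: frob_eq_0_iff) simp
        then have ne': "frob \<alpha> - r \<noteq> 0" by (simp add: r')
        have "frob \<beta> = 1 / (frob \<alpha> - r)" by (simp add: \<beta>_def r')
        also have "\<dots> = (to_ac c * \<alpha> + to_ac d) / (k * (\<alpha> - r))"
          using eq ne ne' k by (simp add: field_simps)
        also have "\<dots> = (to_ac c * r + to_ac d) / k * \<beta> + to_ac c / k"
          using ne k by (simp add: \<beta>_def field_simps)
        finally show ?thesis by (simp add: k_def r')
      qed
      ultimately show ?thesis by (rule rational)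
    next
      case nr: False
      then have fr: "frob r \<noteq> r" by (simp add: frob_fixed_iff)
      have "poly P (frob x) = frob (poly P x)" for x by (simp add: P_def)
      then have root: "poly P x = 0 \<Longrightarrow> poly P (frob x) = 0" for x by simp
      \<comment> \<open>Three conjugates are roots of a quadratic, so two of them agree; as r is not
        fixed and Frobenius is injective, these are r and its second iterate.\<close>
      have "poly P r = 0" "poly P (frob r) = 0" "poly P (frob (frob r)) = 0"
        using root \<open>poly P r = 0\<close> by blast+
      then have sub: "{r, frob r, frob (frob r)} \<subseteq> {x. poly P x = 0}" by simp
      have "P \<noteq> 0" "degree P \<le> 2" using c by (simp_all add: P_def)
      then have "card {x. poly P x = 0} \<le> 2" using card_poly_roots_bound[of P] by simp
      moreover have "card {r, frob r, frob (frob r)} \<le> card {x. poly P x = 0}"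
        using sub poly_roots_finite[OF \<open>P \<noteq> 0\<close>] by (rule card_mono[rotated])
      ultimately have "card {r, frob r, frob (frob r)} \<le> 2" by linarith
      then have "frob (frob r) = r" using fr by (auto simp: card_insert_if split: if_splits)
      then have "r \<in> ext_field 2 - range to_ac" using nr by (simp add: ext_field_iff eval_nat_numeral)
      with * r show ?thesis by (intro irrational) auto
    qed
  qed
qed

lemma of_nat_alg_closure_eq_0_iff: "(of_nat k :: 'a::finite_field alg_closure) = 0 \<longleftrightarrow> CHAR('a) dvd k"
  by (simp add: of_nat_eq_0_iff_char_dvd)

lemma conj_degree_iff:
  "n > 0 \<Longrightarrow> conj_degree n \<alpha> \<longleftrightarrow> (\<forall>k. (frob ^^ k) \<alpha> = \<alpha> \<longleftrightarrow> n dvd k)"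
  using conj_degree_fixed_iff conj_degreeI by blast

lemma frob_of_nat [simp]: "frob (of_nat k) = of_nat k"
  by (induction k) auto

text \<open>Iterating k times adds k t, so the orbit length is the additive order of t. The normal
  form uses t = 1, the explicit representative uses the trace.\<close>

lemma conj_degree_additive:
  fixes \<gamma> :: "'a::finite_field alg_closure"
  assumes "frob \<gamma> = \<gamma> + to_ac t" "t \<noteq> 0"
  shows "conj_degree n \<gamma> \<longleftrightarrow> n = CHAR('a)"
proof -
  have "(frob ^^ k) \<gamma> = \<gamma> + of_nat k * to_ac t" for k
    by (induction k) (simp_all add: assms(1) algebra_simps)
  then have *: "(frob ^^ k) \<gamma> = \<gamma> \<longleftrightarrow> CHAR('a) dvd k" for k
    using assms(2) by (simp add: of_nat_alg_closure_eq_0_iff)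
  have "conj_degree CHAR('a) \<gamma>" using * by (intro conj_degreeI) (simp_all add: CHAR_pos)
  moreover have "n = CHAR('a)" if "conj_degree n \<gamma>"
  proof -
    have "CHAR('a) dvd k \<longleftrightarrow> n dvd k" for k
      using *[of k] conj_degree_fixed_iff[OF that, of k] by (simp only:)
    from this[of n] this[of "CHAR('a)"] show ?thesis by (simp add: dvd_antisym)
  qed
  ultimately show ?thesis by blast
qed

lemma funpow_frob_multiplicative:
  assumes "frob \<gamma> = to_ac a * \<gamma>"
  shows "(frob ^^ k) \<gamma> = \<gamma> * to_ac a ^ k"
  by (induction k) (simp_all add: assms algebra_simps)

lemma conj_degree_multiplicative:
  assumes "frob \<gamma> = to_ac a * \<gamma>" "\<gamma> \<noteq> 0" "n > 0"
  shows "conj_degree n \<gamma> \<longleftrightarrow> (\<forall>k. to_ac a ^ k = 1 \<longleftrightarrow> n dvd k)"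
proof -
  have "(frob ^^ k) \<gamma> = \<gamma> \<longleftrightarrow> to_ac a ^ k = 1" for k
    using assms(2) by (simp add: funpow_frob_multiplicative[OF assms(1)])
  then show ?thesis by (simp only: conj_degree_iff[OF assms(3)])
qed

text \<open>If a = 1, dividing by b leaves the translation by 1, and b = 0 would put \<beta> in F_q.
  Otherwise the affine map has the fixed point - b / (a - 1), which is translated to 0.\<close>

lemma frob_affine_normal_form:
  assumes \<alpha>: "conj_degree n \<alpha>" "n > 1" and rel: "moebius_rel \<alpha> \<beta>" and a: "a \<noteq> 0"
    and \<beta>: "frob \<beta> = to_ac a * \<beta> + to_ac b"
  obtains (additive) \<gamma> where "moebius_rel \<alpha> \<gamma>" "frob \<gamma> = \<gamma> + 1"
  | (multiplicative) \<gamma> where "moebius_rel \<alpha> \<gamma>" "frob \<gamma> = to_ac a * \<gamma>" "\<gamma> \<noteq> 0"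
proof -
  note c = moebius_rel_conj_degree[OF \<alpha> rel]
  have nr: "\<beta> \<notin> range to_ac" by (rule conj_degree_notin_range[OF c \<alpha>(2)])
  show ?thesis
  proof (cases "a = 1")
    case True
    have b: "b \<noteq> 0" using nr \<beta> True by (auto simp flip: frob_fixed_iff)
    have "moebius_rel \<beta> (\<beta> / to_ac b)"
      by (rule moebius_relI[of 1 b 0 0]) (use b in auto)
    moreover have "frob (\<beta> / to_ac b) = \<beta> / to_ac b + 1" using \<beta> True b by (simp add: field_simps)
    ultimately show ?thesis using moebius_rel_trans[OF rel] by (intro additive) auto
  next
    case False
    define \<gamma> where "\<gamma> = \<beta> + to_ac (b / (a - 1))"
    have "moebius_rel \<beta> \<gamma>" by (rule moebius_relI[of 1 1 "b / (a - 1)" 0]) (auto simp: \<gamma>_def)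
    moreover have "a * (b / (a - 1)) = b + b / (a - 1)"
      using False by (simp add: field_simps)
    from arg_cong[OF this, of to_ac] have "frob \<gamma> = to_ac a * \<gamma>"
      by (simp only: \<gamma>_def \<beta> frob_add frob_to_ac distrib_left to_ac_mult to_ac_add add.assoc)
    moreover have "\<gamma> \<noteq> 0"
    proof
      assume "\<gamma> = 0"
      then have "\<beta> = to_ac (- (b / (a - 1)))" by (simp add: \<gamma>_def eq_neg_iff_add_eq_0)
      with nr show False by blast
    qed
    ultimately show ?thesis using moebius_rel_trans[OF rel] by (intro multiplicative) auto
  qed
qed

text \<open>For \<open>s \<in> F\<^sub>q\<^sup>2 - F\<^sub>q\<close>, the map \<open>nonsplit_map s\<close> sends \<open>0\<close> and \<open>\<infinity>\<close> to \<open>s\<^sup>q\<close> and \<open>s\<close>, the fixed points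
  of a nonsplit torus of \<open>PGL\<^sub>2(F\<^sub>q)\<close>; it turns multiplication by \<open>u\<close> with \<open>u\<^sup>q\<^sup>+\<^sup>1 = 1\<close> into the action of
  that torus. The value at \<open>-1\<close>, which should be \<open>\<infinity>\<close>, is junk.\<close>

definition nonsplit_map :: "'a::finite_field alg_closure \<Rightarrow> 'a alg_closure \<Rightarrow> 'a alg_closure" where
  "nonsplit_map s x = (s * x + frob s) / (x + 1)"

lemma nonsplit_map_inverse:
  assumes "x \<noteq> 0"
  shows "nonsplit_map s (1 / x) = (s + frob s * x) / (x + 1)"
proof -
  have *: "s * (1 / x) + frob s = (s + frob s * x) / x" "1 / x + 1 = (x + 1) / x"
    using assms by (simp_all add: add_divide_distrib)
  show ?thesis unfolding nonsplit_map_def * using assms by (simp add: distrib_right)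
qed

section \<open>Points in the coordinate of a nonsplit torus\<close>

context
  fixes s :: "'a::finite_field alg_closure"
  assumes s: "s \<in> ext_field 2 - range to_ac"
begin

lemma frob_s: "frob (frob s) = s" "s - frob s \<noteq> 0" "frob s \<noteq> s"
  using s by (auto simp: ext_field_iff eval_nat_numeral simp flip: frob_fixed_iff)

lemma nonsplit_map_eq_iff:
  assumes "x \<noteq> -1" "y \<noteq> -1"
  shows "nonsplit_map s x = nonsplit_map s y \<longleftrightarrow> x = y"
proof
  have nz: "x + 1 \<noteq> 0" "y + 1 \<noteq> 0" using assms by (auto simp: eq_neg_iff_add_eq_0)
  assume "nonsplit_map s x = nonsplit_map s y"
  then have "(s * x + frob s) * (y + 1) = (s * y + frob s) * (x + 1)"
    using nz by (simp add: nonsplit_map_def frac_eq_eq)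
  then have "(s - frob s) * (x - y) = 0" by (simp add: algebra_simps)
  then show "x = y" using frob_s by simp
qed simp

text \<open>Frobenius exchanges s and \<open>frob s\<close>, so it sends the value at x to the value
  at 1 / \<open>frob x\<close>, which is x / e. The remaining conclusions carry the side conditions
  over to x / e, so that the step can be iterated.\<close>

lemma frob_nonsplit_map:
  assumes x: "x * frob x = e" "x \<noteq> -1" "x \<noteq> 0"
  shows "frob (nonsplit_map s x) = nonsplit_map s (x / e)"
    "x / e \<noteq> -1" "x / e \<noteq> 0" "frob e * e = 1 \<Longrightarrow> x / e * frob (x / e) = e"
proof -
  have e: "x / e = 1 / frob x" "e \<noteq> 0" using x by auto
  have "frob x \<noteq> frob (- 1)" using x(2) by (simp only: frob_eq_iff) simp
  then have fx: "frob x + 1 \<noteq> 0" by (simp add: eq_neg_iff_add_eq_0)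
  show "x / e \<noteq> 0" using x e by simp
  show "x / e \<noteq> -1"
  proof
    assume "x / e = - 1"
    then have "1 / frob x = - 1" by (simp only: e(1))
    then have "1 = - frob x" using x(3) by (simp add: divide_eq_eq)
    then have "frob x + 1 = frob x + - frob x" by (rule arg_cong)
    with fx show False by simp
  qed
  have "nonsplit_map s (1 / frob x) = (s + frob s * frob x) / (frob x + 1)"
    using x(3) by (intro nonsplit_map_inverse) simp
  also have "\<dots> = frob (nonsplit_map s x)" by (simp add: nonsplit_map_def frob_s add.commute)
  finally show "frob (nonsplit_map s x) = nonsplit_map s (x / e)" unfolding e(1) by (rule sym)
  assume "frob e * e = 1"
  moreover have "x / e * frob (x / e) = e / (frob e * e)" using x(1) by (simp add: mult.commute)
  ultimately show "x / e * frob (x / e) = e" by simp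
qed

lemma funpow_frob_nonsplit_map:
  assumes x: "x * frob x = e" "x \<noteq> -1" "x \<noteq> 0" and e: "frob e * e = 1"
  shows "(frob ^^ k) (nonsplit_map s x) = nonsplit_map s (x / e ^ k)" "x / e ^ k \<noteq> -1"
    "x / e ^ k * frob (x / e ^ k) = e"
proof -
  have "(frob ^^ k) (nonsplit_map s x) = nonsplit_map s (x / e ^ k) \<and> x / e ^ k \<noteq> -1 \<and>
    x / e ^ k \<noteq> 0 \<and> x / e ^ k * frob (x / e ^ k) = e"
  proof (induction k)
    case (Suc k)
    then have IH: "(frob ^^ k) (nonsplit_map s x) = nonsplit_map s (x / e ^ k)"
      "x / e ^ k * frob (x / e ^ k) = e" "x / e ^ k \<noteq> -1" "x / e ^ k \<noteq> 0" by blast+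
    have eq: "x / e ^ Suc k = x / e ^ k / e" by simp
    note f = frob_nonsplit_map[OF IH(2-4)]
    show ?case
      unfolding eq using f(1-3) f(4)[OF e] by (intro conjI) (simp_all only: funpow.simps(2) o_apply IH(1) simp_thms)
  qed (use x in auto)
  then show "(frob ^^ k) (nonsplit_map s x) = nonsplit_map s (x / e ^ k)" "x / e ^ k \<noteq> -1"
    "x / e ^ k * frob (x / e ^ k) = e" by auto
qed

lemma conj_degree_nonsplit_map:
  assumes x: "x * frob x = e" "x \<noteq> -1" "x \<noteq> 0" and e: "frob e * e = 1" and n: "n > 0"
  shows "conj_degree n (nonsplit_map s x) \<longleftrightarrow> (\<forall>k. e ^ k = 1 \<longleftrightarrow> n dvd k)"
proof -
  have "e \<noteq> 0" using e by auto
  have "(frob ^^ k) (nonsplit_map s x) = nonsplit_map s x \<longleftrightarrow> e ^ k = 1" for k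
  proof -
    have "(frob ^^ k) (nonsplit_map s x) = nonsplit_map s x \<longleftrightarrow> x / e ^ k = x"
      using funpow_frob_nonsplit_map[OF x e, of k] x(2) by (simp add: nonsplit_map_eq_iff)
    also have "\<dots> \<longleftrightarrow> e ^ k = 1" using x(3) \<open>e \<noteq> 0\<close> by (auto simp: field_simps)
    finally show ?thesis .
  qed
  then show ?thesis by (simp only: conj_degree_iff[OF n])
qed

text \<open>The hypothesis says that u is an element of norm 1 in the field with q^2 elements. The
  usual witness 1 + u works unless u = -1, where s - s^q, which Frobenius negates, takes its
  place.\<close>

lemma hilbert_90:
  fixes u :: "'a alg_closure"
  assumes u: "u * frob u = 1"
  obtains w where "w \<noteq> 0" "frob (frob w) = w" "u = w / frob w"
proof (cases "u = -1")
  case True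
  show ?thesis
  proof (rule that[of "s - frob s"])
    have eq: "frob (s - frob s) = - (s - frob s)" by (simp add: frob_s)
    show "u = (s - frob s) / frob (s - frob s)"
      unfolding eq True divide_minus_right using frob_s(2) by simp
  qed (use frob_s in simp_all)
next
  case False
  have u0: "u \<noteq> 0" using u by auto
  have f: "frob u = 1 / u" using u u0 by (simp add: field_simps)
  have nz: "1 + u \<noteq> 0" using False by (auto simp: add.commute[of 1] eq_neg_iff_add_eq_0)
  show ?thesis
  proof (rule that[of "1 + u"])
    have "frob (1 + u) = (1 + u) / u" using u0 by (simp add: f field_simps)
    then show "u = (1 + u) / frob (1 + u)" using nz u0 by simp
    show "frob (frob (1 + u)) = 1 + u" by (simp add: f)
  qed (rule nz)
qed

text \<open>With u = w / w', multiplication by u is the action of diag(w, w'). Conjugated into the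
  coordinate of \<open>nonsplit_map\<close>, this matrix has entries that are quotients of two
  elements negated by Frobenius, hence in F_q, and determinant w w'.\<close>

lemma moebius_rel_nonsplit_map:
  assumes u: "u * frob u = 1" and x: "x \<noteq> -1" "u * x \<noteq> -1"
  shows "moebius_rel (nonsplit_map s x) (nonsplit_map s (u * x))"
proof -
  obtain w where w: "w \<noteq> 0" "frob (frob w) = w" "u = w / frob w" using hilbert_90[OF u] .
  define s' w' where "s' = frob s" and "w' = frob w"
  have ss: "s - s' \<noteq> 0" "frob s = s'" "frob s' = s" "frob w = w'" "frob w' = w" "w' \<noteq> 0"
    using frob_s w by (auto simp: s'_def w'_def)
  have fixed: "\<exists>z0. z / (s - s') = to_ac z0" if "frob z = - z" for z
  proof -
    have "frob (z / (s - s')) = - z / - (s - s')" using that by (simp add: ss)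
    also have "\<dots> = z / (s - s')" by (rule minus_divide_divide)
    finally show ?thesis by (rule frob_fixedE) blast
  qed
  \<comment> \<open>The four numerators are the entries of ((s, s'), (1, 1)) diag(w, w') ((1, -s'),
    (-1, s)), rows in parentheses; s - s' is the determinant of the first factor.\<close>
  obtain a where a: "(s * w - s' * w') / (s - s') = to_ac a"
    using fixed[of "s * w - s' * w'"] by (auto simp: ss)
  obtain b where b: "s * s' * (w' - w) / (s - s') = to_ac b"
    using fixed[of "s * s' * (w' - w)"] by (auto simp: ss algebra_simps)
  obtain c where c: "(w - w') / (s - s') = to_ac c"
    using fixed[of "w - w'"] by (auto simp: ss)
  obtain d where d: "(s * w' - s' * w) / (s - s') = to_ac d"
    using fixed[of "s * w' - s' * w"] by (auto simp: ss)
  show ?thesis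
  proof (rule moebius_relI)
    have "to_ac (a * d - b * c) = (s * w - s' * w') / (s - s') * ((s * w' - s' * w) / (s - s')) -
        s * s' * (w' - w) / (s - s') * ((w - w') / (s - s'))"
      by (simp only: to_ac_diff to_ac_mult a b c d)
    also have "\<dots> =
      ((s * w - s' * w') * (s * w' - s' * w) - s * s' * (w' - w) * (w - w')) / ((s - s') * (s - s'))"
      by (simp only: times_divide_times_eq diff_divide_distrib[symmetric])
    also have "(s * w - s' * w') * (s * w' - s' * w) - s * s' * (w' - w) * (w - w')
      = (w * w') * ((s - s') * (s - s'))" by (simp add: algebra_simps)
    finally have "to_ac (a * d - b * c) = w * w'" using ss(1) by simp
    then have "to_ac (a * d - b * c) \<noteq> 0" using w(1) ss(6) by simp
    then show "a * d - b * c \<noteq> 0" by (simp only: to_ac_eq_0_iff simp_thms)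
    define y where "y = nonsplit_map s x"
    have x1: "x + 1 \<noteq> 0" using x(1) by (auto simp: eq_neg_iff_add_eq_0)
    have yx: "y * (x + 1) = s * x + s'" using x1 by (simp add: y_def nonsplit_map_def ss)
    have combine: "A / (s - s') * y + B / (s - s') = (A * (y * (x + 1)) + B * (x + 1)) / ((s - s') * (x + 1))"
      for A B
    proof -
      have "A * (y * (x + 1)) + B * (x + 1) = (A * y + B) * (x + 1)" by (simp add: algebra_simps)
      then show ?thesis using x1 by (simp add: add_divide_distrib)
    qed
    have "to_ac c * y + to_ac d = ((w - w') * (y * (x + 1)) + (s * w' - s' * w) * (x + 1)) / ((s - s') * (x + 1))"
      by (simp only: combine flip: c d)
    also have "(w - w') * (y * (x + 1)) + (s * w' - s' * w) * (x + 1) = (w * x + w') * (s - s')"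
      unfolding yx by (simp add: algebra_simps)
    finally have den: "to_ac c * y + to_ac d = (w * x + w') / (x + 1)" using ss(1) by simp
    have "to_ac a * y + to_ac b = ((s * w - s' * w') * (y * (x + 1)) + s * s' * (w' - w) * (x + 1)) / ((s - s') * (x + 1))"
      by (simp only: combine flip: a b)
    also have "(s * w - s' * w') * (y * (x + 1)) + s * s' * (w' - w) * (x + 1) = (s * w * x + s' * w') * (s - s')"
      unfolding yx by (simp add: algebra_simps)
    finally have num: "to_ac a * y + to_ac b = (s * w * x + s' * w') / (x + 1)" using ss(1) by simp
    have u': "u = w / w'" using w(3) by (simp add: w'_def)
    have ux: "u * x + 1 = (w * x + w') / w'" "s * (u * x) + s' = (s * w * x + s' * w') / w'"
      using ss(6) by (simp_all add: u' add_divide_distrib)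
    have "u * x + 1 \<noteq> 0" using x(2) by (auto simp: eq_neg_iff_add_eq_0)
    then have nz: "w * x + w' \<noteq> 0" unfolding ux(1) by auto
    have "nonsplit_map s (u * x) = (s * w * x + s' * w') / (w * x + w')"
      unfolding nonsplit_map_def ss(2) ux using ss(6) by (simp add: distrib_right)
    then show "nonsplit_map s (u * x) * (to_ac c * nonsplit_map s x + to_ac d) = to_ac a * nonsplit_map s x + to_ac b"
      using den num nz by (simp add: y_def)
  qed
qed

text \<open>Inversion of x exchanges the points s and s^q, as does the reflection z \<mapsto> s +
  s^q - z, which is defined over F_q; the two coincide.\<close>

lemma moebius_rel_nonsplit_map_inverse:
  assumes "x \<noteq> -1" "x \<noteq> 0"
  shows "moebius_rel (nonsplit_map s x) (nonsplit_map s (1 / x))"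
proof -
  have "frob (s + frob s) = s + frob s" by (simp add: frob_s add.commute)
  then obtain t where t: "s + frob s = to_ac t" by (rule frob_fixedE)
  have nz: "x + 1 \<noteq> 0" using assms(1) by (auto simp: eq_neg_iff_add_eq_0)
  have "nonsplit_map s (1 / x) = (s + frob s * x) / (x + 1)"
    by (rule nonsplit_map_inverse[OF assms(2)])
  also have "s + frob s * x = to_ac t * (x + 1) - (s * x + frob s)"
    unfolding t[symmetric] by (simp add: algebra_simps)
  also have "\<dots> / (x + 1) = to_ac t - nonsplit_map s x"
    using nz by (simp add: nonsplit_map_def diff_divide_distrib)
  finally have eq: "nonsplit_map s (1 / x) = to_ac t - nonsplit_map s x" .
  show ?thesis
    by (rule moebius_relI[of "-1" 1 t 0]) (simp_all add: eq)
qed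

text \<open>The fixed points r, r' of A are conjugate, as are s and s^q, so an affine map over F_q
  takes one pair to the other. In the coordinate x, which has r and r' at \<infinity> and 0, the
  matrix A multiplies by a constant.\<close>

lemma nonsplit_normal_form:
  assumes \<alpha>: "conj_degree n \<alpha>" "n > 1" and det: "a * d - b * c \<noteq> 0"
    and frob_\<alpha>: "frob \<alpha> * (to_ac c * \<alpha> + to_ac d) = to_ac a * \<alpha> + to_ac b"
    and r: "r \<in> ext_field 2 - range to_ac" "r * (to_ac c * r + to_ac d) = to_ac a * r + to_ac b"
    and odd: "odd n"
  obtains x e where "moebius_rel \<alpha> (nonsplit_map s x)" "x * frob x = e" "x \<noteq> -1" "x \<noteq> 0" "frob e * e = 1"
proof -
  have fr: "frob (frob r) = r" "r - frob r \<noteq> 0"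
    using r(1) by (auto simp: ext_field_iff eval_nat_numeral simp flip: frob_fixed_iff)
  define r' where "r' = frob r"
  note fr = fr[folded r'_def]
  have r': "r' * (to_ac c * r' + to_ac d) = to_ac a * r' + to_ac b"
    using arg_cong[OF r(2), of frob] by (simp add: r'_def)
  \<comment> \<open>With v below, the affine map z \<mapsto> u z + v taking s to r and s^q to r';
    both coefficients turn out to be fixed by Frobenius.\<close>
  define u where "u = (r - r') / (s - frob s)"
  have "frob u = - (r - r') / - (s - frob s)" using fr by (simp add: u_def frob_s r'_def)
  then have "frob u = u" unfolding u_def minus_divide_divide .
  then obtain u0 where u0: "u = to_ac u0" by (rule frob_fixedE)
  have u_nz: "u \<noteq> 0" using fr frob_s by (simp add: u_def)
  have us: "u * (s - frob s) = r - r'" using frob_s by (simp add: u_def)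
  define v where "v = r - u * s"
  have "frob v = r' - u * frob s" using \<open>frob u = u\<close> by (simp add: v_def r'_def)
  then have v': "frob v = v"
    using us by (simp only: \<open>frob v = r' - u * frob s\<close>) (simp add: v_def algebra_simps)
  then obtain v0 where v0: "v = to_ac v0" by (rule frob_fixedE)
  have "v = r' - u * frob s" using v' \<open>frob v = r' - u * frob s\<close> by (rule subst)
  moreover have "r = u * s + v" by (simp add: v_def)
  ultimately have rs: "r' = u * frob s + v" "r = u * s + v" by simp_all
  \<comment> \<open>An odd n > 1 does not divide 2, so \<alpha> is outside the field with q^2
    elements and avoids both fixed points.\<close>
  have \<alpha>2: "(frob ^^ 2) \<alpha> \<noteq> \<alpha>"
    using conj_degree_fixed_iff[OF \<alpha>(1), of 2] \<alpha>(2) odd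
    by (cases "n = 2") (auto dest!: dvd_imp_le)
  have ne: "\<alpha> - r \<noteq> 0" "\<alpha> - r' \<noteq> 0"
    using \<alpha>2 fr by (auto simp: eval_nat_numeral r'_def)
  define D where "D x = to_ac c * x + to_ac d" for x
  have nr: "r \<notin> range to_ac" "r' \<notin> range to_ac"
    using r(1) fr by (auto simp: r'_def simp flip: frob_fixed_iff)
  have D: "D r \<noteq> 0" "D r' \<noteq> 0" "D \<alpha> \<noteq> 0"
    using moebius_denominator[OF nr(1) det] moebius_denominator[OF nr(2) det]
      moebius_denominator[OF conj_degree_notin_range[OF \<alpha>] det] by (auto simp: D_def)
  define \<delta> where "\<delta> = to_ac a * to_ac d - to_ac b * to_ac c"
  have diff: "(frob \<alpha> - y) * (D \<alpha> * D y) = \<delta> * (\<alpha> - y)"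
    if "y * D y = to_ac a * y + to_ac b" for y
  proof -
    have "(frob \<alpha> - y) * (D \<alpha> * D y) = (frob \<alpha> * D \<alpha>) * D y - (y * D y) * D \<alpha>"
      by (simp add: algebra_simps)
    also have "\<dots> = (to_ac a * \<alpha> + to_ac b) * D y - (to_ac a * y + to_ac b) * D \<alpha>"
      using frob_\<alpha> that by (simp add: D_def)
    also have "\<dots> = \<delta> * (\<alpha> - y)" by (simp add: D_def \<delta>_def algebra_simps)
    finally show ?thesis .
  qed
  \<comment> \<open>The ratio of the eigenvalues of A on (r', 1) and (r, 1); Frobenius swaps them,
    whence \<open>frob e * e = 1\<close>.\<close>
  define e where "e = D r' / D r"
  \<comment> \<open>The solution of (r x + r') / (x + 1) = \<alpha>.\<close>
  define x where "x = (r' - \<alpha>) / (\<alpha> - r)"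
  have x0: "x \<noteq> 0" using ne by (simp add: x_def)
  have x1: "x + 1 = (r' - r) / (\<alpha> - r)" using ne by (simp add: x_def field_simps)
  then have x1': "x + 1 \<noteq> 0" using ne fr by simp
  have fr_ne: "frob \<alpha> - r \<noteq> 0" "frob \<alpha> - r' \<noteq> 0"
  proof -
    have "frob \<alpha> - r = frob (\<alpha> - r')" "frob \<alpha> - r' = frob (\<alpha> - r)"
      using fr(1) by (simp_all add: r'_def)
    with ne show "frob \<alpha> - r \<noteq> 0" "frob \<alpha> - r' \<noteq> 0" by (simp_all only: frob_eq_0_iff) simp_all
  qed
  have "frob x = (r - frob \<alpha>) / (frob \<alpha> - r')" using fr(1) by (simp add: x_def r'_def)
  moreover have "(r - frob \<alpha>) / (frob \<alpha> - r') * ((r' - \<alpha>) / (\<alpha> - r)) = e"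
  proof -
    have "\<delta> \<noteq> 0"
      using diff[of r] r(2) fr_ne(1) D ne by (auto simp: D_def)
    have "((frob \<alpha> - r) * (D \<alpha> * D r)) * (\<delta> * (\<alpha> - r')) = (\<delta> * (\<alpha> - r)) * ((frob \<alpha> - r') * (D \<alpha> * D r'))"
      using diff[of r] diff[of r'] r(2) r' by (simp add: D_def)
    then have "(\<delta> * D \<alpha>) * ((frob \<alpha> - r) * D r * (\<alpha> - r')) = (\<delta> * D \<alpha>) * ((\<alpha> - r) * (frob \<alpha> - r') * D r')"
      by (simp add: mult_ac)
    then have "(frob \<alpha> - r) * D r * (\<alpha> - r') = (\<alpha> - r) * (frob \<alpha> - r') * D r'"
      using \<open>\<delta> \<noteq> 0\<close> D by simp
    then have "(frob \<alpha> - r) * (\<alpha> - r') / ((frob \<alpha> - r') * (\<alpha> - r)) = e"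
      unfolding e_def using D fr_ne ne by (simp add: frac_eq_eq mult_ac)
    moreover have "(r - frob \<alpha>) * (r' - \<alpha>) = (frob \<alpha> - r) * (\<alpha> - r')" by (simp add: algebra_simps)
    ultimately show ?thesis by simp
  qed
  ultimately have e: "x * frob x = e" by (simp add: x_def mult.commute)
  have "frob (D r) = D r'" "frob (D r') = D r" using fr(1) by (simp_all add: D_def r'_def)
  then have "frob e * e = 1" using D by (simp add: e_def)
  moreover have "moebius_rel \<alpha> (nonsplit_map s x)"
  proof (rule moebius_relI[of 1 u0 "- v0" 0])
    show "1 * u0 - - v0 * 0 \<noteq> 0" using u_nz u0 by simp
    have "nonsplit_map s x * (x + 1) = s * x + frob s" using x1' by (simp add: nonsplit_map_def)
    then have "u * (nonsplit_map s x * (x + 1)) = u * (s * x + frob s)" by (rule arg_cong)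
    then have "nonsplit_map s x * u * (x + 1) = (u * s) * x + u * frob s"
      by (simp only: distrib_left mult_ac)
    also have "\<dots> = (r - v) * x + (r' - v)" unfolding rs by simp
    also have "\<dots> = (\<alpha> - v) * (x + 1)"
    proof -
      have "x * (\<alpha> - r) = r' - \<alpha>" using ne by (simp add: x_def)
      then show ?thesis by (simp add: algebra_simps)
    qed
    finally have "nonsplit_map s x * u = \<alpha> - v" using x1' by simp
    then show "nonsplit_map s x * (to_ac 0 * \<alpha> + to_ac u0) = to_ac 1 * \<alpha> + to_ac (- v0)"
      by (simp add: u0 v0)
  qed
  moreover have "x \<noteq> -1" using x1' by auto
  ultimately show ?thesis using that e x0 by blast
qed

text \<open>The conjugates are the values at x / e^i. Invariance of the cross ratio, here for the
  matrix ((s, s^q), (1, 1)) over the closure, reduces the claim to a geometric sequence of ratio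
  1/e, whose value is symmetric in e and 1/e.\<close>

lemma frob_cross_ratio_nonsplit_map:
  assumes x: "x * frob x = e" "x \<noteq> -1" "x \<noteq> 0" and e: "frob e * e = 1" "e \<noteq> 1"
  shows "frob_cross_ratio (nonsplit_map s x) = (1 + e) ^ 2 / e"
proof -
  have e0: "e \<noteq> 0" using e by auto
  note f = funpow_frob_nonsplit_map[OF x e(1)]
  have den: "1 * (x / e ^ i) + 1 \<noteq> 0" for i
    using f(2)[of i] by (auto simp: eq_neg_iff_add_eq_0)
  have "frob_cross_ratio (nonsplit_map s x) = cross_ratio (x / e ^ 0) (x / e ^ 1) (x / e ^ 2) (x / e ^ 3)"
    unfolding frob_cross_ratio_def
  proof (rule cross_ratio_moebius[where y = "\<lambda>i. (frob ^^ i) (nonsplit_map s x)" and x = "\<lambda>i. x / e ^ i"])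
    show "s * 1 - frob s * 1 \<noteq> 0" using frob_s by simp
    fix i
    show "1 * (x / e ^ i) + 1 \<noteq> 0" by (rule den)
    then show "(frob ^^ i) (nonsplit_map s x) * (1 * (x / e ^ i) + 1) = s * (x / e ^ i) + frob s"
      unfolding f(1) by (simp add: nonsplit_map_def)
  qed
  also have "\<dots> = cross_ratio x (x * (1 / e)) (x * (1 / e) ^ 2) (x * (1 / e) ^ 3)"
    by (simp add: power_divide)
  also have "\<dots> = (1 + 1 / e) ^ 2 / (1 / e)"
    using x e e0 by (intro cross_ratio_geometric) auto
  also have "\<dots> = (1 + e) ^ 2 / e" using e0 by (simp add: field_simps power2_eq_square)
  finally show ?thesis .
qed

end

lemma frob_cross_ratio_multiplicative:
  assumes "frob \<gamma> = to_ac a * \<gamma>" "\<gamma> \<noteq> 0" "a \<noteq> 0" "a \<noteq> 1"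
  shows "frob_cross_ratio \<gamma> = (1 + to_ac a) ^ 2 / to_ac a"
proof -
  have "to_ac a \<noteq> to_ac 1" using assms by (simp only: to_ac_eq_iff) simp
  then show ?thesis
    unfolding frob_cross_ratio_def funpow_frob_multiplicative[OF assms(1)]
    using cross_ratio_geometric[of \<gamma> "to_ac a"] assms by simp
qed


section \<open>Roots of unity\<close>

lemma has_mult_order_pow_eq_1_iff:
  assumes "has_mult_order z m"
  shows "z ^ k = 1 \<longleftrightarrow> m dvd k"
proof -
  have m: "0 < m" "z ^ m = 1" using assms by (auto simp: has_mult_order_def)
  have "z ^ k = z ^ (m * (k div m) + k mod m)" by simp
  also have "\<dots> = z ^ (k mod m)" by (simp only: power_add power_mult m(2)) simp
  finally have "z ^ k = z ^ (k mod m)" .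
  moreover have "z ^ (k mod m) = 1 \<longleftrightarrow> k mod m = 0"
    using assms m(1) by (auto simp: has_mult_order_def)
  ultimately show ?thesis by (auto simp: dvd_eq_mod_eq_0)
qed

lemma generates_units_has_mult_order:
  fixes \<zeta> :: "'a::finite_field"
  assumes "generates_units \<zeta>"
  shows "has_mult_order \<zeta> (CARD('a) - 1)"
proof -
  have rng: "range (\<lambda>k::nat. \<zeta> ^ k) = UNIV - {0}" using assms by (simp add: generates_units_def)
  then have "\<zeta> ^ 1 \<in> UNIV - {0}" by blast
  then have nz: "\<zeta> \<noteq> 0" by simp
  have "\<zeta> * \<zeta> ^ (CARD('a) - 1) = \<zeta> ^ CARD('a)"
    using card_field_gt_1[where 'a='a] by (simp flip: power_Suc)
  then have one: "\<zeta> ^ (CARD('a) - 1) = 1"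
    using nz by (simp add: finite_field_power_card_eq_same)
  have "\<zeta> ^ k \<noteq> 1" if k: "0 < k" "k < CARD('a) - 1" for k
  proof
    assume k1: "\<zeta> ^ k = 1"
    have "\<zeta> ^ j \<in> (\<lambda>k. \<zeta> ^ k) ` {..<k}" for j
    proof -
      have "\<zeta> ^ j = \<zeta> ^ (k * (j div k) + j mod k)" by simp
      also have "\<dots> = \<zeta> ^ (j mod k)" by (simp only: power_add power_mult k1) simp
      finally show ?thesis using k(1) by auto
    qed
    then have "UNIV - {0} \<subseteq> (\<lambda>k. \<zeta> ^ k) ` {..<k}" unfolding rng[symmetric] by blast
    then have "card (UNIV - {0::'a}) \<le> card ((\<lambda>k. \<zeta> ^ k) ` {..<k})" by (intro card_mono) auto
    also have "\<dots> \<le> k" using card_image_le[of "{..<k}" "\<lambda>k. \<zeta> ^ k"] by simp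
    finally show False using k(2) by simp
  qed
  then show ?thesis using one card_field_gt_1[where 'a='a] by (auto simp: has_mult_order_def)
qed

lemma power_order_coprime:
  fixes \<omega> :: "'k::field"
  assumes \<omega>: "\<And>k. \<omega> ^ k = 1 \<longleftrightarrow> n dvd k" and "coprime i n"
  shows "(\<omega> ^ i) ^ k = 1 \<longleftrightarrow> n dvd k"
  using assms by (simp add: coprime_commute coprime_dvd_mult_right_iff flip: power_mult)

lemma power_eq_order_dvd_diff:
  fixes \<omega> :: "'k::field"
  assumes \<omega>: "\<And>k. \<omega> ^ k = 1 \<longleftrightarrow> n dvd k" and "n > 0" and ij: "\<omega> ^ i = \<omega> ^ j" "i \<le> j"
  shows "n dvd j - i"
proof -
  have nz: "\<omega> \<noteq> 0" using \<omega>[of n] \<open>n > 0\<close> by (auto simp: power_0_left)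
  have "\<omega> ^ i * \<omega> ^ (j - i) = \<omega> ^ j" using ij(2) by (simp flip: power_add)
  also have "\<dots> = \<omega> ^ i * 1" using ij(1) by simp
  finally have "\<omega> ^ (j - i) = 1" using nz by simp
  then show ?thesis using \<omega> by blast
qed

text \<open>Both exponents lie below n/2, so 0 < i + j < n: the powers are never inverse to each
  other, and equal powers force equal exponents.\<close>

lemma half_exponent_unique:
  fixes \<omega> :: "'k::field"
  assumes \<omega>: "\<And>k. \<omega> ^ k = 1 \<longleftrightarrow> n dvd k"
    and ij: "0 < i" "2 * i < n" "0 < j" "2 * j < n"
    and eq: "\<omega> ^ i = \<omega> ^ j \<or> \<omega> ^ i * \<omega> ^ j = 1"
  shows "i = j"
proof -
  have le: "i = j" if "\<omega> ^ i = \<omega> ^ j" "i \<le> j" "2 * j < n" for i j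
    using power_eq_order_dvd_diff[OF \<omega> _ that(1,2)] that by (auto dest!: dvd_imp_le)
  from eq show ?thesis
  proof
    assume "\<omega> ^ i = \<omega> ^ j"
    then show ?thesis using le[of i j] le[of j i] ij by (cases "i \<le> j") auto
  next
    assume "\<omega> ^ i * \<omega> ^ j = 1"
    then have "n dvd i + j" using \<omega>[of "i + j"] by (simp add: power_add)
    then show ?thesis using ij by (auto dest!: dvd_imp_le)
  qed
qed

text \<open>The powers of \<omega> exhaust the roots of X^n - 1, so e = \<omega>^j, with j coprime
  to n because e has order n too. An exponent above n/2 is replaced by n - j, at the price of an
  inversion; 2 j = n is impossible for odd n.\<close>

lemma half_exponent_exists:
  fixes \<omega> e :: "'k::field"
  assumes \<omega>: "\<And>k. \<omega> ^ k = 1 \<longleftrightarrow> n dvd k" and e: "\<And>k. e ^ k = 1 \<longleftrightarrow> n dvd k"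
    and n: "odd n" "n > 1"
  obtains i where "0 < i" "2 * i < n" "coprime i n" "e = \<omega> ^ i \<or> e * \<omega> ^ i = 1"
proof -
  have inj: "inj_on (\<lambda>i. \<omega> ^ i) {..<n}"
  proof (rule linorder_inj_onI)
    fix i j assume ij: "i < j" "i \<in> {..<n}" "j \<in> {..<n}"
    then show "\<omega> ^ i \<noteq> \<omega> ^ j"
      using power_eq_order_dvd_diff[OF \<omega>, of i j] n by (auto dest!: dvd_imp_le)
  qed auto
  define P :: "'k poly" where "P = monom 1 n - 1"
  have "coeff P n = 1" using n by (simp add: P_def)
  then have "P \<noteq> 0" by auto
  have "degree P \<le> n" unfolding P_def by (intro degree_diff_le) (auto intro: degree_monom_le)
  have roots: "{x. poly P x = 0} = {x. x ^ n = 1}" by (auto simp: P_def poly_monom)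
  have "(\<lambda>i. \<omega> ^ i) ` {..<n} = {x. x ^ n = 1}"
  proof (rule card_seteq)
    show "finite {x::'k. x ^ n = 1}" using poly_roots_finite[OF \<open>P \<noteq> 0\<close>] by (simp add: roots)
    show "(\<lambda>i. \<omega> ^ i) ` {..<n} \<subseteq> {x. x ^ n = 1}" using \<omega> by (auto simp flip: power_mult)
    show "card {x::'k. x ^ n = 1} \<le> card ((\<lambda>i. \<omega> ^ i) ` {..<n})"
      using card_poly_roots_bound[OF \<open>P \<noteq> 0\<close>] \<open>degree P \<le> n\<close> by (simp add: roots card_image[OF inj])
  qed
  moreover have "e ^ n = 1" using e by simp
  ultimately obtain j where j: "j < n" "e = \<omega> ^ j" by blast
  have cop: "coprime j n"
  proof (rule ccontr)
    assume "\<not> coprime j n"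
    then have g: "gcd j n \<noteq> 1" by (simp add: coprime_iff_gcd_eq_1)
    define d where "d = gcd j n"
    obtain j' n' where d: "j = d * j'" "n = d * n'" unfolding d_def by (meson dvdE gcd_dvd1 gcd_dvd2)
    have "d \<noteq> 0" using n(2) by (simp add: d_def)
    then have "d > 1" using g unfolding d_def by linarith
    have "n' > 0" using d n(2) by (cases n') auto
    have "n dvd j * n'" by (simp add: d)
    then have "e ^ n' = 1" using \<omega> by (simp add: j(2) flip: power_mult)
    then have "n dvd n'" using e by blast
    then have "n \<le> n'" using \<open>n' > 0\<close> by (rule dvd_imp_le)
    then show False using d(2) \<open>d > 1\<close> \<open>n' > 0\<close> by simp
  qed
  have "j > 0" using cop n(2) by (cases j) auto
  show ?thesis
  proof (cases "2 * j < n")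
    case True
    then show ?thesis using that[of j] cop \<open>j > 0\<close> j(2) by simp
  next
    case False
    moreover have "2 * j \<noteq> n" using n(1) by auto
    ultimately have "2 * (n - j) < n" "0 < n - j" using j(1) by auto
    moreover have "coprime (n - j) n"
    proof (rule coprimeI)
      fix d assume d: "d dvd n - j" "d dvd n"
      then have "d dvd n - (n - j)" using dvd_diff_nat by blast
      with d j(1) show "d dvd 1" using coprime_common_divisor[OF cop] by simp
    qed
    moreover have "e * \<omega> ^ (n - j) = 1" using j \<omega>[of n] by (simp flip: power_add)
    ultimately show ?thesis using that by blast
  qed
qed

text \<open>Moebius equivalence preserves the orbit length n, which each normal form reveals: as the
  characteristic, as the order of a in the unit group of F_q, or as the order of e with e^(q+1) = 1.
  The nonsplit case is stated for every s because the theorem lets s be arbitrary.\<close>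

lemma frob_moebius_normal_form:
  fixes \<alpha> :: "'a::finite_field alg_closure"
  assumes \<alpha>: "\<alpha> \<in> frob_moebius n" and n: "odd n" "n > 1"
  obtains (unipotent) \<gamma> where "n = CHAR('a)" "moebius_rel \<alpha> \<gamma>" "frob \<gamma> = \<gamma> + 1"
  | (split) a \<gamma> where "n dvd CARD('a) - 1" "moebius_rel \<alpha> \<gamma>" "\<gamma> \<noteq> 0" "frob \<gamma> = to_ac a * \<gamma>"
      "\<And>k. to_ac a ^ k = (1 :: 'a alg_closure) \<longleftrightarrow> n dvd k"
  | (nonsplit) "n dvd CARD('a) + 1"
      "\<And>s. s \<in> ext_field 2 - range to_ac \<Longrightarrow> \<exists>x e. moebius_rel \<alpha> (nonsplit_map s x) \<and>
         x * frob x = e \<and> x \<noteq> -1 \<and> x \<noteq> 0 \<and> frob e * e = 1 \<and> (\<forall>k. e ^ k = 1 \<longleftrightarrow> n dvd k)"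
proof -
  have c: "conj_degree n \<alpha>" using \<alpha> by (simp add: frob_moebius_def)
  have n0: "n > 0" using n by simp
  show ?thesis
  proof (cases rule: frob_moebius_fixed_point_cases[OF \<alpha> n(2)])
    case (1 a b \<beta>)
    show ?thesis
    proof (cases rule: frob_affine_normal_form[OF c n(2) 1])
      case (1 \<gamma>)
      have "conj_degree n \<gamma>" by (rule moebius_rel_conj_degree[OF c n(2) 1(1)])
      then have "n = CHAR('a)" using 1(2) conj_degree_additive[of \<gamma> 1 n] by simp
      with 1 show ?thesis by (intro unipotent)
    next
      case (2 \<gamma>)
      have "conj_degree n \<gamma>" by (rule moebius_rel_conj_degree[OF c n(2) 2(1)])
      then have ord: "\<forall>k. to_ac a ^ k = (1 :: 'a alg_closure) \<longleftrightarrow> n dvd k"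
        using conj_degree_multiplicative[OF 2(2,3) n0] by simp
      have "a * a ^ (CARD('a) - 1) = a ^ CARD('a)"
        using card_field_gt_1[where 'a='a] by (simp flip: power_Suc)
      then have "a ^ (CARD('a) - 1) = 1"
        using \<open>a \<noteq> 0\<close> by (simp add: finite_field_power_card_eq_same)
      then have "to_ac a ^ (CARD('a) - 1) = (1 :: 'a alg_closure)" by (simp flip: to_ac_power)
      then have "n dvd CARD('a) - 1" using ord by blast
      with 2 ord show ?thesis by (intro split) auto
    qed
  next
    case (2 a b c' d r)
    have ex: "\<exists>x e. moebius_rel \<alpha> (nonsplit_map s x) \<and> x * frob x = e \<and> x \<noteq> -1 \<and> x \<noteq> 0 \<and>
      frob e * e = 1 \<and> (\<forall>k. e ^ k = 1 \<longleftrightarrow> n dvd k)" if s: "s \<in> ext_field 2 - range to_ac" for s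
    proof -
      obtain x e where x: "moebius_rel \<alpha> (nonsplit_map s x)" "x * frob x = e" "x \<noteq> -1" "x \<noteq> 0"
        "frob e * e = 1"
        using nonsplit_normal_form[OF s c n(2) 2 n(1)] .
      have "conj_degree n (nonsplit_map s x)" by (rule moebius_rel_conj_degree[OF c n(2) x(1)])
      then have "\<forall>k. e ^ k = 1 \<longleftrightarrow> n dvd k"
        using conj_degree_nonsplit_map[OF s x(2-5) n0] by simp
      with x show ?thesis by blast
    qed
    \<comment> \<open>The irrational fixed point r itself serves as s.\<close>
    then obtain e :: "'a alg_closure" where e: "frob e * e = 1" "\<forall>k. e ^ k = 1 \<longleftrightarrow> n dvd k"
      using 2(3) by blast
    have "e ^ (CARD('a) + 1) = 1" using e(1) by (simp add: frob_def mult.commute)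
    then have "n dvd CARD('a) + 1" using e(2) by blast
    then show ?thesis using ex by (rule nonsplit)
  qed
qed

section \<open>Explicit binary forms\<close>

lemma binomial_form:
  "poly (var_x ^ n - const2 c * var_y ^ n) 1 = monom 1 n - [:c:]"
  "homogeneous n (var_x ^ n - const2 c * var_y ^ n)"
proof -
  let ?f = "var_x ^ n - const2 c * var_y ^ n"
  show 1: "poly ?f 1 = monom 1 n - [:c:]"
    by (simp add: var_x_def var_y_def const2_def monom_altdef)
  have tw: "twist ?f = monom (monom 1 n) n - monom [:c:] n"
    by (simp add: monom_power smult_monom)
  show "homogeneous n ?f" unfolding homogeneous_iff_twist 1 tw by (rule diff_monom)
qed

lemma artin_schreier_form:
  assumes "n > 0"
  shows "poly (var_x ^ n - var_x * var_y ^ (n - 1) - const2 c * var_y ^ n) 1 = monom 1 n - [:c, 1:]"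
    "homogeneous n (var_x ^ n - var_x * var_y ^ (n - 1) - const2 c * var_y ^ n)"
proof -
  let ?f = "var_x ^ n - var_x * var_y ^ (n - 1) - const2 c * var_y ^ n"
  show 1: "poly ?f 1 = monom 1 n - [:c, 1:]"
    by (simp add: var_x_def var_y_def const2_def monom_altdef)
  have "twist ?f = monom (monom 1 n) n - monom (monom 1 1) n - monom [:c:] n"
    using assms by (simp add: monom_power smult_monom mult_monom)
  also have "\<dots> = monom (monom 1 n - monom 1 1 - [:c:]) n" by (simp only: diff_monom)
  also have "monom 1 n - monom 1 1 - [:c:] = monom 1 n - [:c, 1:]"
    by (simp add: monom_altdef)
  finally show "homogeneous n ?f" unfolding homogeneous_iff_twist 1 .
qed


section \<open>Representatives\<close>

text \<open>With \<open>not_dvd_both\<close>, this makes the three cases exclude one another, so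
  that only one normal form survives for each family of representatives.\<close>

lemma CHAR_not_dvd: "\<not> CHAR('a::finite_field) dvd CARD('a) - 1" "\<not> CHAR('a) dvd CARD('a) + 1"
proof -
  obtain m where "m > 0" "CARD('a) = CHAR('a) ^ m" using card_finite_field_char_power by blast
  then have dvd: "CHAR('a) dvd CARD('a)" by simp
  have p: "\<not> CHAR('a) dvd 1" by (simp add: CHAR_not_1)
  show "\<not> CHAR('a) dvd CARD('a) + 1" using dvd p by (metis dvd_add_right_iff)
  have "CARD('a) = (CARD('a) - 1) + 1" using card_field_gt_1[where 'a='a] by simp
  then show "\<not> CHAR('a) dvd CARD('a) - 1" using dvd p by (metis dvd_add_right_iff)
qed

lemma not_dvd_both:
  fixes n q :: nat
  assumes "odd n" "n > 1" "q > 1" "n dvd q - 1" "n dvd q + 1"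
  shows False
proof -
  have "n dvd (q + 1) - (q - 1)" using dvd_diff_nat[OF assms(5,4)] .
  then have "n dvd 2" using assms(3) by (simp add: numeral_2_eq_2)
  then have "n \<le> 2" by (rule dvd_imp_le) simp
  with assms show False by (cases "n = 2") auto
qed

lemma monicI: "degree g \<le> n \<Longrightarrow> coeff g n = 1 \<Longrightarrow> degree g = n \<and> lead_coeff g = 1"
  for g :: "'a::field poly"
  by (metis le_antisym le_degree zero_neq_one)

text \<open>Raising to the p-th power m times, where q = p^m, adds t, t^p, ..., up to exponent
  p^(m-1); the total is the trace.\<close>

lemma frob_artin_schreier_root:
  fixes \<delta> :: "'a::finite_field alg_closure"
  assumes "\<delta> ^ CHAR('a) = \<delta> + to_ac t"
  shows "frob \<delta> = \<delta> + to_ac (abs_trace t)"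
proof -
  note p = CHAR_alg_closure_prime[where 'a='a]
  obtain m where m: "CARD('a) = CHAR('a) ^ m" using card_finite_field_char_power by blast
  have "CHAR('a) > 1" using p prime_gt_1_nat by simp
  then have the_m: "(THE m. CARD('a) = CHAR('a) ^ m) = m"
    using m by (intro the_equality) (auto dest: power_inject_exp[THEN iffD1, rotated])
  have "\<delta> ^ (CHAR('a) ^ k) = \<delta> + to_ac (\<Sum>i<k. t ^ (CHAR('a) ^ i))" for k
  proof (induction k)
    case (Suc k)
    have "\<delta> ^ (CHAR('a) ^ Suc k) = (\<delta> ^ (CHAR('a) ^ k)) ^ CHAR('a)"
      by (simp add: mult.commute flip: power_mult)
    also have "\<dots> = \<delta> ^ CHAR('a) + to_ac (\<Sum>i<k. t ^ (CHAR('a) ^ i)) ^ CHAR('a)"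
      unfolding Suc using freshmans_dream[OF p] by simp
    also have "to_ac (\<Sum>i<k. t ^ (CHAR('a) ^ i)) ^ CHAR('a) = to_ac (\<Sum>i<k. t ^ (CHAR('a) ^ Suc i))"
      using freshmans_dream_sum[of "CHAR('a)" "\<lambda>i. t ^ (CHAR('a) ^ i)" "{..<k}"] p
      by (simp add: mult.commute flip: to_ac_power power_mult)
    also have "\<delta> ^ CHAR('a) + \<dots> = \<delta> + to_ac (\<Sum>i<Suc k. t ^ (CHAR('a) ^ i))"
      unfolding assms by (subst sum.lessThan_Suc_shift) (simp add: add.assoc)
    finally show ?case .
  qed simp
  from this[of m] show ?thesis by (simp add: frob_def m abs_trace_def the_m flip: m)
qed

lemma unipotent_representative:
  fixes t :: "'a::finite_field"
  assumes n: "odd n" "n > 1" "n = CHAR('a)" and t: "abs_trace t \<noteq> 0"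
  shows "complete_unique_reps (PGL2 :: ('a^2^2) set monoid) (places_frob_deg n 1)
    (divisor_act (places_frob_deg n 1))
    (divisor ` {var_x ^ n - var_x * var_y ^ (n - 1) - const2 t * var_y ^ n})"
proof -
  define f where "f = var_x ^ n - var_x * var_y ^ (n - 1) - const2 t * var_y ^ n"
  have "n > 0" using n by simp
  note f = artin_schreier_form[OF this, of t, folded f_def]
  have "degree (monom 1 n - [:t, 1:]) \<le> n"
    using n(2) by (intro degree_diff_le) (auto intro: degree_monom_le)
  moreover have "coeff (monom 1 n - [:t, 1:]) n = 1"
    using n(2) by (simp add: coeff_pCons split: nat.split)
  ultimately have monic: "degree (poly f 1) = n" "lead_coeff (poly f 1) = 1"
    using monicI unfolding f(1) by blast+
  obtain \<delta> where \<delta>: "form_root f \<delta>" using form_root_exists[of f] monic n by auto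
  then have "\<delta> ^ n - (\<delta> + to_ac t) = 0"
    by (simp add: form_root_def f(1) eval_ac_hom.hom_diff add.commute)
  then have fr: "frob \<delta> = \<delta> + to_ac (abs_trace t)"
    unfolding n(3) by (intro frob_artin_schreier_root) simp
  \<comment> \<open>The nonzero trace makes Frobenius a proper translation on \<delta>, so \<delta>
    has degree p; this is also what makes the form irreducible.\<close>
  then have "conj_degree n \<delta>" using conj_degree_additive[OF fr t] n(3) by simp
  moreover have "moebius_rel \<delta> (frob \<delta>)"
    by (rule moebius_relI[of 1 1 "abs_trace t" 0]) (simp_all add: fr)
  ultimately have X: "\<delta> \<in> frob_moebius n" by (simp add: frob_moebius_def)
  have "moebius_rel \<alpha> \<delta>" if \<alpha>: "\<alpha> \<in> frob_moebius n" for \<alpha>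
  proof (cases rule: frob_moebius_normal_form[OF \<alpha> n(1,2)])
    case (1 \<gamma>)
    \<comment> \<open>Frobenius adds the trace both to \<delta> and to the trace times \<gamma>, so
      the difference lies in F_q.\<close>
    have "frob (\<delta> - to_ac (abs_trace t) * \<gamma>) = \<delta> - to_ac (abs_trace t) * \<gamma>"
      by (simp add: fr 1 algebra_simps)
    then obtain b where "\<delta> - to_ac (abs_trace t) * \<gamma> = to_ac b" by (rule frob_fixedE)
    then have "moebius_rel \<gamma> \<delta>"
      using t by (intro moebius_relI[of "abs_trace t" 1 b 0]) (simp_all add: algebra_simps)
    with 1(2) show ?thesis by (rule moebius_rel_trans)
  qed (use n(3) CHAR_not_dvd in auto)
  then show ?thesis
    using complete_unique_reps_places[of n "{()}" "\<lambda>_. f" "\<lambda>_. \<delta>"] n X \<delta>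
      place_formsI[OF f(2) monic \<open>conj_degree n \<delta>\<close> \<delta>]
    by (simp add: f_def)
qed

lemma split_representatives:
  fixes \<zeta> :: "'a::finite_field"
  assumes n: "odd n" "n > 1" "n dvd CARD('a) - 1" and \<zeta>: "generates_units \<zeta>"
  shows "complete_unique_reps (PGL2 :: ('a^2^2) set monoid) (places_frob_deg n 1)
    (divisor_act (places_frob_deg n 1))
    (divisor ` (\<lambda>i. var_x ^ n - const2 (\<zeta> ^ i) * var_y ^ n) ` {i. 0 < i \<and> 2 * i < n \<and> coprime i n})"
proof -
  define m where "m = (CARD('a) - 1) div n"
  have nm: "n * m = CARD('a) - 1" using n by (simp add: m_def)
  have n0: "n > 0" using n by simp
  have m0: "m > 0" using nm card_field_gt_1[where 'a='a] by (cases m) auto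
  define f where "f i = var_x ^ n - const2 (\<zeta> ^ i) * var_y ^ n" for i :: nat
  note f = binomial_form[of n "\<zeta> ^ _", folded f_def]
  have z: "\<zeta> ^ k = 1 \<longleftrightarrow> n * m dvd k" for k
    using has_mult_order_pow_eq_1_iff[OF generates_units_has_mult_order[OF \<zeta>]] by (simp only: nm)
  \<comment> \<open>An element of order n in F_q; any multiplier of order n is one of its
    powers.\<close>
  define \<omega> where "\<omega> = \<zeta> ^ m"
  have \<omega>': "\<omega> ^ k = 1 \<longleftrightarrow> n dvd k" for k
    using z[of "m * k"] m0 by (simp add: \<omega>_def mult.commute[of n] flip: power_mult)
  have \<omega>: "to_ac \<omega> ^ k = 1 \<longleftrightarrow> n dvd k" for k
    using \<omega>'[of k] by (metis to_ac_1 to_ac_eq_iff to_ac_power)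
  have \<zeta>0: "\<zeta> \<noteq> 0" using z[of "n * m"] m0 n0 by (auto simp: power_0_left)
  have monic: "degree (poly (f i) 1) = n" "lead_coeff (poly (f i) 1) = 1" for i
  proof -
    have "degree (monom 1 n - [:\<zeta> ^ i:]) \<le> n"
      by (intro degree_diff_le) (auto intro: degree_monom_le)
    moreover have "coeff (monom 1 n - [:\<zeta> ^ i:]) n = 1"
      using n(2) by (simp add: coeff_pCons split: nat.split)
    ultimately show "degree (poly (f i) 1) = n" "lead_coeff (poly (f i) 1) = 1"
      using monicI unfolding f(1) by blast+
  qed
  have "\<exists>\<delta>. form_root (f i) \<delta>" for i using form_root_exists[of "f i"] monic(1) n0 by metis
  then obtain \<delta> where \<delta>: "\<And>i. form_root (f i) (\<delta> i)" by metis
  have pw: "\<delta> i ^ n = to_ac \<zeta> ^ i" for i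
    using \<delta>[of i] by (simp add: form_root_def f(1) eval_ac_hom.hom_diff)
  have \<delta>0: "\<delta> i \<noteq> 0" for i using pw[of i] \<zeta>0 n0 by (auto simp: power_0_left)
  have fr: "frob (\<delta> i) = to_ac (\<omega> ^ i) * \<delta> i" for i
  proof -
    \<comment> \<open>From q = n m + 1 and \<delta>^n = \<zeta>^i: Frobenius multiplies by
      \<zeta>^(i m) = \<omega>^i.\<close>
    have "frob (\<delta> i) = \<delta> i ^ (n * m + 1)"
      using card_field_gt_1[where 'a='a] by (simp add: frob_def nm)
    also have "\<dots> = (\<delta> i ^ n) ^ m * \<delta> i" by (simp add: power_add power_mult)
    also have "(\<delta> i ^ n) ^ m = to_ac (\<omega> ^ i)"
      by (simp add: pw \<omega>_def flip: power_mult) (simp add: mult.commute)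
    finally show ?thesis .
  qed
  define I where "I = {i. 0 < i \<and> 2 * i < n \<and> coprime i n}"
  have cd: "conj_degree n (\<delta> i)" if "i \<in> I" for i
    using conj_degree_multiplicative[OF fr \<delta>0 n0] power_order_coprime[OF \<omega>, of i] that
    by (simp add: I_def)
  have X: "\<delta> i \<in> frob_moebius n" if "i \<in> I" for i
  proof -
    have "moebius_rel (\<delta> i) (frob (\<delta> i))"
      by (rule moebius_relI[of "\<omega> ^ i" 1 0 0]) (simp_all add: fr \<omega>_def \<zeta>0)
    with cd[OF that] show ?thesis by (simp add: frob_moebius_def)
  qed
  have ex: "\<exists>i\<in>I. moebius_rel \<alpha> (\<delta> i)" if \<alpha>: "\<alpha> \<in> frob_moebius n" for \<alpha>
  proof (cases rule: frob_moebius_normal_form[OF \<alpha> n(1,2)])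
    case (2 a \<gamma>)
    obtain i where i: "0 < i" "2 * i < n" "coprime i n" "to_ac a = to_ac \<omega> ^ i \<or> to_ac a * to_ac \<omega> ^ i = 1"
      using half_exponent_exists[OF \<omega> 2(5) n(1,2)] by blast
    \<comment> \<open>Inverting \<gamma> inverts its multiplier, which settles the second
      alternative for the exponent i.\<close>
    obtain \<gamma>' where \<gamma>': "moebius_rel \<gamma> \<gamma>'" "\<gamma>' \<noteq> 0" "frob \<gamma>' = to_ac (\<omega> ^ i) * \<gamma>'"
    proof (cases "to_ac a = to_ac \<omega> ^ i")
      case True
      then show ?thesis using 2 by (intro that[of \<gamma>] moebius_rel_refl) auto
    next
      case False
      then have "to_ac a * to_ac (\<omega> ^ i) = 1" using i(4) by simp
      moreover from this have "to_ac a \<noteq> 0" by auto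
      ultimately have "1 / to_ac a = to_ac (\<omega> ^ i)" by (simp only: divide_eq_eq) (simp add: mult.commute)
      moreover have "frob (1 / \<gamma>) = 1 / to_ac a * (1 / \<gamma>)" by (simp add: 2)
      moreover have "moebius_rel \<gamma> (1 / \<gamma>)"
        using 2(3) by (intro moebius_relI[of 0 0 1 1]) auto
      ultimately show ?thesis using 2(3) by (intro that[of "1 / \<gamma>"]) simp_all
    qed
    \<comment> \<open>Equal multipliers cancel in the quotient, which therefore lies in F_q: the two
      points differ by a scaling.\<close>
    have "frob (\<delta> i / \<gamma>') = \<delta> i / \<gamma>'" by (simp add: fr \<gamma>'(3) \<omega>_def \<zeta>0)
    then obtain u where u: "\<delta> i / \<gamma>' = to_ac u" by (rule frob_fixedE)
    then have "u \<noteq> 0" using \<delta>0[of i] \<gamma>'(2) by auto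
    then have "moebius_rel \<gamma>' (\<delta> i)"
      using u \<gamma>'(2) by (intro moebius_relI[of u 1 0 0]) (auto simp: field_simps)
    then have "moebius_rel \<alpha> (\<delta> i)" using moebius_rel_trans 2(2) \<gamma>'(1) by blast
    with i show ?thesis by (auto simp: I_def)
  next
    case 3
    then show ?thesis using not_dvd_both[OF n(1,2) card_field_gt_1 n(3)] by blast
  qed (use n(3) CHAR_not_dvd in auto)
  have unique: "i = j" if ij: "i \<in> I" "j \<in> I" "moebius_rel (\<delta> i) (\<delta> j)" for i j
  proof -
    have ne: "\<omega> ^ k \<noteq> 0" "\<omega> ^ k \<noteq> 1" if "k \<in> I" for k
      using that \<zeta>0 \<omega>'[of k] by (auto simp: \<omega>_def I_def dest!: dvd_imp_le)
    have "frob_cross_ratio (\<delta> i) = frob_cross_ratio (\<delta> j)"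
      by (rule frob_cross_ratio_cong[OF cd[OF ij(1)] n(2) ij(3)])
    then have "(1 + to_ac (\<omega> ^ i)) ^ 2 / to_ac (\<omega> ^ i) = (1 + to_ac (\<omega> ^ j)) ^ 2 / to_ac (\<omega> ^ j)"
      using frob_cross_ratio_multiplicative[OF fr \<delta>0 ne[OF ij(1)]]
        frob_cross_ratio_multiplicative[OF fr \<delta>0 ne[OF ij(2)]] by simp
    then have "to_ac (\<omega> ^ i) = to_ac (\<omega> ^ j) \<or> to_ac (\<omega> ^ i) * to_ac (\<omega> ^ j) = 1"
      using ne ij(1,2) by (intro geometric_invariant_eqD) (simp_all only: to_ac_eq_0_iff, simp_all)
    then show ?thesis
      using half_exponent_unique[OF \<omega>, of i j] ij(1,2) by (simp add: I_def)
  qed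
  show ?thesis
    using complete_unique_reps_places[OF n(1,2), of I f \<delta>, OF place_formsI[OF f(2) monic cd \<delta>] \<delta> X ex unique]
    by (simp add: f_def[abs_def] I_def)
qed

lemma nonsplit_representatives:
  fixes \<xi> :: "'a::finite_field alg_closure"
  assumes n: "odd n" "n > 1" "n dvd CARD('a) + 1" and s: "s \<in> ext_field 2 - range to_ac"
    and \<xi>: "has_mult_order \<xi> (n * (CARD('a) + 1))"
  shows "complete_unique_reps (PGL2 :: ('a^2^2) set monoid) (places_frob_deg n 1)
    (divisor_act (places_frob_deg n 1))
    (divisor ` (\<lambda>i. homogenize (min_poly (nonsplit_map s (\<xi> ^ i)))) ` {i. 0 < i \<and> 2 * i < n \<and> coprime i n})"
proof -
  have n0: "n > 0" using n by simp
  note z = has_mult_order_pow_eq_1_iff[OF \<xi>]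
  have \<xi>0: "\<xi> \<noteq> 0" using z[of "n * (CARD('a) + 1)"] n0 by (auto simp: power_0_left)
  \<comment> \<open>This is \<xi>^(q+1), the value of e that belongs to x = \<xi>; its order is n
    because \<xi> has order n (q + 1).\<close>
  define \<omega> where "\<omega> = \<xi> * frob \<xi>"
  have \<omega>_eq: "\<omega> = \<xi> ^ (CARD('a) + 1)" by (simp add: \<omega>_def frob_def)
  have \<omega>: "\<omega> ^ k = 1 \<longleftrightarrow> n dvd k" for k
  proof -
    have "\<omega> ^ k = 1 \<longleftrightarrow> (CARD('a) + 1) * n dvd (CARD('a) + 1) * k"
      using z[of "(CARD('a) + 1) * k"] unfolding \<omega>_eq power_mult[symmetric] by (simp only: mult.commute)
    then show ?thesis by (subst (asm) dvd_times_left_cancel_iff) simp_all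
  qed
  have "frob \<omega> * \<omega> = \<omega> ^ (CARD('a) + 1)" by (simp add: frob_def mult.commute)
  also have "\<dots> = 1" using \<omega> n(3) by blast
  finally have \<omega>1: "frob \<omega> * \<omega> = 1" .
  then have \<omega>0: "\<omega> \<noteq> 0" by auto
  from \<omega>1 have e1: "frob (\<omega> ^ i) * \<omega> ^ i = 1" for i by (simp flip: power_mult_distrib)
  define I where "I = {i. 0 < i \<and> 2 * i < n \<and> coprime i n}"
  have xe: "\<xi> ^ i * frob (\<xi> ^ i) = \<omega> ^ i" for i by (simp add: \<omega>_def power_mult_distrib)
  have x0: "\<xi> ^ i \<noteq> 0" for i using \<xi>0 by simp
  \<comment> \<open>Keeps the junk value of \<open>nonsplit_map\<close> away: \<xi>^i = -1 would
    make n divide 2 i, which lies strictly between 0 and n.\<close>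
  have x1: "\<xi> ^ i \<noteq> -1" if "i \<in> I" for i
  proof
    assume "\<xi> ^ i = -1"
    then have "\<xi> ^ (i * 2) = 1" by (simp add: power_mult)
    then have "n * (CARD('a) + 1) dvd i * 2" by (simp only: z)
    then have "n dvd i * 2" by (rule dvd_mult_left)
    then show False using that by (auto simp: I_def dest!: dvd_imp_le)
  qed
  define r where "r i = nonsplit_map s (\<xi> ^ i)" for i
  have cd: "conj_degree n (r i)" if "i \<in> I" for i
    unfolding r_def
    using conj_degree_nonsplit_map[OF s xe x1[OF that] x0 e1 n0] power_order_coprime[OF \<omega>, of i] that
    by (simp add: I_def)
  have X: "r i \<in> frob_moebius n" if i: "i \<in> I" for i
  proof -
    note fr = frob_nonsplit_map[OF s xe x1[OF i] x0]
    have nz: "\<omega> ^ i \<noteq> 0" using \<omega>0 by simp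
    \<comment> \<open>Frobenius divides the coordinate by \<omega>^i, an element of norm 1; so it
      acts through the torus, as a Moebius map over F_q.\<close>
    have "1 / \<omega> ^ i * frob (1 / \<omega> ^ i) = 1 / (frob (\<omega> ^ i) * \<omega> ^ i)" by simp
    then have "1 / \<omega> ^ i * frob (1 / \<omega> ^ i) = 1" unfolding e1 by simp
    from moebius_rel_nonsplit_map[OF s this x1[OF i]] fr(2)
    have "moebius_rel (nonsplit_map s (\<xi> ^ i)) (nonsplit_map s (\<xi> ^ i / \<omega> ^ i))" by simp
    then show ?thesis using cd[OF i] fr(1) by (simp add: frob_moebius_def r_def)
  qed
  have ex: "\<exists>i\<in>I. moebius_rel \<alpha> (r i)" if \<alpha>: "\<alpha> \<in> frob_moebius n" for \<alpha>
  proof (cases rule: frob_moebius_normal_form[OF \<alpha> n(1,2)])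
    case 3
    obtain x e where x: "moebius_rel \<alpha> (nonsplit_map s x)" "x * frob x = e" "x \<noteq> -1" "x \<noteq> 0"
      "frob e * e = 1" and e: "\<And>k. e ^ k = 1 \<longleftrightarrow> n dvd k"
      using 3(2)[OF s] by blast
    obtain i where i: "0 < i" "2 * i < n" "coprime i n" "e = \<omega> ^ i \<or> e * \<omega> ^ i = 1"
      using half_exponent_exists[OF \<omega> e n(1,2)] by blast
    then have iI: "i \<in> I" by (simp add: I_def)
    obtain y where y: "moebius_rel (nonsplit_map s x) (nonsplit_map s y)" "y * frob y = \<omega> ^ i" "y \<noteq> -1" "y \<noteq> 0"
    proof (cases "e = \<omega> ^ i")
      case True
      then show ?thesis using x by (intro that[of x] moebius_rel_refl) auto
    next
      case False
      then have inv: "e * \<omega> ^ i = 1" using i(4) by simp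
      have "1 / x * frob (1 / x) = 1 / e" using x(2) by simp
      also have "\<dots> = \<omega> ^ i" using inv by (metis mult_zero_left nonzero_mult_div_cancel_left zero_neq_one)
      finally have "1 / x * frob (1 / x) = \<omega> ^ i" .
      moreover have "1 / x \<noteq> -1"
      proof
        assume "1 / x = -1"
        then have "1 = - x" using x(4) by (simp add: divide_eq_eq)
        then have "- 1 = - (- x)" by (rule arg_cong)
        with x(3) show False by simp
      qed
      ultimately show ?thesis
        using moebius_rel_nonsplit_map_inverse[OF s x(3,4)] x(4) by (intro that[of "1 / x"]) simp_all
    qed
    have nz: "\<omega> ^ i \<noteq> 0" using \<omega>0 by simp
    \<comment> \<open>Both coordinates have the same product \<omega>^i with their Frobenius image,
      so their quotient has norm 1 and the torus joins the two points.\<close>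
    have "\<xi> ^ i / y * frob (\<xi> ^ i / y) = (\<xi> ^ i * frob (\<xi> ^ i)) / (y * frob y)"
      by (simp only: frob_divide times_divide_times_eq)
    also have "\<dots> = 1" unfolding xe y(2) using nz by simp
    finally have u: "\<xi> ^ i / y * frob (\<xi> ^ i / y) = 1" .
    have "moebius_rel (nonsplit_map s y) (nonsplit_map s (\<xi> ^ i / y * y))"
      by (rule moebius_rel_nonsplit_map[OF s u y(3)]) (use x1[OF iI] y(4) in simp)
    then have "moebius_rel (nonsplit_map s y) (r i)" using y(4) by (simp add: r_def)
    then have "moebius_rel \<alpha> (r i)" using moebius_rel_trans x(1) y(1) by blast
    with iI show ?thesis by blast
  next
    case (2 a \<gamma>)
    then show ?thesis using not_dvd_both[OF n(1,2) card_field_gt_1 _ n(3)] by blast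
  qed (use n(3) CHAR_not_dvd in auto)
  have unique: "i = j" if ij: "i \<in> I" "j \<in> I" "moebius_rel (r i) (r j)" for i j
  proof -
    have ne: "\<omega> ^ k \<noteq> 0" "\<omega> ^ k \<noteq> 1" if "k \<in> I" for k
      using that \<omega>0 \<omega>[of k] by (auto simp: I_def dest!: dvd_imp_le)
    have cr: "frob_cross_ratio (r k) = (1 + \<omega> ^ k) ^ 2 / \<omega> ^ k" if "k \<in> I" for k
      unfolding r_def by (rule frob_cross_ratio_nonsplit_map[OF s xe x1[OF that] x0 e1 ne(2)[OF that]])
    have "frob_cross_ratio (r i) = frob_cross_ratio (r j)"
      by (rule frob_cross_ratio_cong[OF cd[OF ij(1)] n(2) ij(3)])
    then have "\<omega> ^ i = \<omega> ^ j \<or> \<omega> ^ i * \<omega> ^ j = 1"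
      using cr ne ij(1,2) by (intro geometric_invariant_eqD) simp_all
    then show ?thesis
      using half_exponent_unique[OF \<omega>, of i j] ij(1,2) by (simp add: I_def)
  qed
  show ?thesis
    using complete_unique_reps_places[OF n(1,2), of I "\<lambda>i. homogenize (min_poly (r i))" r,
        OF homogenize_min_poly(1)[OF cd] homogenize_min_poly(2)[OF cd] X ex unique]
    by (simp add: r_def[abs_def] I_def)
qed

theorem theorem2p9:
  fixes q p :: nat
  assumes "q = CARD('a::finite_field)" and "p = CHAR('a)"
  shows "(\<forall>n. odd n \<and> n > 1 \<and> (places_frob_deg n 1 :: 'a alg_closure point multiset set) \<noteq> {} \<longrightarrow>
            n = p \<or> n dvd q - 1 \<or> n dvd q + 1)
       \<and> (\<forall>n s (t :: 'a) (\<zeta> :: 'a) (\<xi> :: 'a alg_closure) T.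
            odd n \<and> n > 1 \<and> s \<in> ext_field 2 - range to_ac \<and>
            (n = p \<and> abs_trace t \<noteq> 0 \<and>
               T = {var_x ^ n - var_x * var_y ^ (n - 1) - const2 t * var_y ^ n}
             \<or> n dvd q - 1 \<and> generates_units \<zeta> \<and>
               T = {var_x ^ n - const2 (\<zeta> ^ i) * var_y ^ n | i. 0 < i \<and> 2 * i < n \<and> coprime i n}
             \<or> n dvd q + 1 \<and> \<xi> \<in> ext_field (2 * n) \<and> has_mult_order \<xi> (n * (q + 1)) \<and>
               T = {homogenize (min_poly ((s * \<xi> ^ i + s ^ q) / (\<xi> ^ i + 1))) | i.
                      0 < i \<and> 2 * i < n \<and> coprime i n})
            \<longrightarrow> complete_unique_reps (PGL2 :: ('a^2^2) set monoid)
                  (places_frob_deg n 1) (divisor_act (places_frob_deg n 1)) (divisor ` T))"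
proof (intro conjI allI impI, goal_cases)
  case (1 n)
  then have n: "odd n" "n > 1" by auto
  obtain \<alpha> :: "'a alg_closure" where \<alpha>: "\<alpha> \<in> frob_moebius n"
    using 1 unfolding places_frob_deg_1[OF n] by blast
  show ?case
    by (cases rule: frob_moebius_normal_form[OF \<alpha> n]) (simp_all add: assms)
next
  case (2 n s t \<zeta> \<xi> T)
  then have n: "odd n" "n > 1" and s: "s \<in> ext_field 2 - range to_ac" by auto
  have img: "{g i | i. 0 < i \<and> 2 * i < n \<and> coprime i n} = g ` {i. 0 < i \<and> 2 * i < n \<and> coprime i n}"
    for g :: "nat \<Rightarrow> 'a poly poly" by blast
  have ns: "(s * \<xi> ^ i + s ^ q) / (\<xi> ^ i + 1) = nonsplit_map s (\<xi> ^ i)" for i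
    by (simp add: nonsplit_map_def frob_def assms)
  from 2 consider
      "n = p" "abs_trace t \<noteq> 0" "T = {var_x ^ n - var_x * var_y ^ (n - 1) - const2 t * var_y ^ n}"
    | "n dvd q - 1" "generates_units \<zeta>"
      "T = {var_x ^ n - const2 (\<zeta> ^ i) * var_y ^ n | i. 0 < i \<and> 2 * i < n \<and> coprime i n}"
    | "n dvd q + 1" "has_mult_order \<xi> (n * (q + 1))"
      "T = {homogenize (min_poly (nonsplit_map s (\<xi> ^ i))) | i. 0 < i \<and> 2 * i < n \<and> coprime i n}"
    unfolding ns by blast
  then show ?case
  proof cases
    case 1
    with unipotent_representative[OF n] show ?thesis unfolding assms by blast
  next
    case 2
    with split_representatives[OF n] show ?thesis unfolding assms img by blast
  next
    case 3
    with nonsplit_representatives[OF n _ s] show ?thesis unfolding assms img by blast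
  qed
qed

end
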